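(* Let $T$ be a complete NIP theory with monster model $\mathfrak{C}$ such that $\mathrm{dcl}(\varnothing)=M_0$ is a model, and let $G$ be a $\varnothing$-definable group of $T$. For any small model $M$ we have $X_{M_0}\subseteq X_M^2$, and hence $G^{\infty}_{M_0}=G^{\infty}_M$.
   Context: $\mathfrak{C}$ is a monster model (sufficiently saturated and strongly homogeneous), "small" means of size less than its degree of saturation, and $G=G(\mathfrak{C})$. For a small model $M\preccurlyeq\mathfrak{C}$, $X_M:=\{a^{-1}b:a,b\in G,\ \mathrm{tp}(a/M)=\mathrm{tp}(b/M)\}$, and $X_M^2=\{xy:x,y\in X_M\}$. $G^{\infty}_M$ is the smallest subgroup of $G(\mathfrak{C})$ that is invariant over $M$ (setwise invariant under automorphisms of $\mathfrak{C}$ fixing $M$ pointwise) and of bounded index (index smaller than the degree of saturation of $\mathfrak{C}$); it is equal to the subgroup generated by $X_M$. NIP: every partitioned formula has finite VC-dimension. *)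

theory Defs
  imports Main "HOL-Algebra.Coset"
begin

section \<open>First-order logic\<close>

text \<open>A language is given by sets of function and relation symbols, each paired with its arity;
  constants are function symbols of arity 0.\<close>

record ('f, 'r) language =
  Funs :: "('f \<times> nat) set"
  Rels :: "('r \<times> nat) set"

datatype 'f trm = Var nat | Fn 'f "'f trm list"

datatype ('f, 'r) fm =
    Eq "'f trm" "'f trm"
  | Rel 'r "'f trm list"
  | Neg "('f, 'r) fm"
  | Conj "('f, 'r) fm" "('f, 'r) fm"
  | Exists nat "('f, 'r) fm"

fun wf_trm :: "('f, 'r) language \<Rightarrow> 'f trm \<Rightarrow> bool" where
  "wf_trm L (Var i) = True"
| "wf_trm L (Fn f ts) = ((f, length ts) \<in> Funs L \<and> list_all (wf_trm L) ts)"

primrec wf_fm :: "('f, 'r) language \<Rightarrow> ('f, 'r) fm \<Rightarrow> bool" where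
  "wf_fm L (Eq s t) = (wf_trm L s \<and> wf_trm L t)"
| "wf_fm L (Rel r ts) = ((r, length ts) \<in> Rels L \<and> list_all (wf_trm L) ts)"
| "wf_fm L (Neg \<phi>) = wf_fm L \<phi>"
| "wf_fm L (Conj \<phi> \<psi>) = (wf_fm L \<phi> \<and> wf_fm L \<psi>)"
| "wf_fm L (Exists i \<phi>) = wf_fm L \<phi>"

fun fv_trm :: "'f trm \<Rightarrow> nat set" where
  "fv_trm (Var i) = {i}"
| "fv_trm (Fn f ts) = \<Union> (fv_trm ` set ts)"

primrec fv :: "('f, 'r) fm \<Rightarrow> nat set" where
  "fv (Eq s t) = fv_trm s \<union> fv_trm t"
| "fv (Rel r ts) = \<Union> (fv_trm ` set ts)"
| "fv (Neg \<phi>) = fv \<phi>"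
| "fv (Conj \<phi> \<psi>) = fv \<phi> \<union> fv \<psi>"
| "fv (Exists i \<phi>) = fv \<phi> - {i}"

text \<open>The \<open>L\<close>-formulas \<open>\<phi>(x\<^sub>0, \<dots>, x\<^sub>n\<^sub>-\<^sub>1)\<close>; for \<open>n = 0\<close> these are the \<open>L\<close>-sentences.\<close>

definition formulas :: "('f, 'r) language \<Rightarrow> nat \<Rightarrow> ('f, 'r) fm set" where
  "formulas L n = {\<phi>. wf_fm L \<phi> \<and> fv \<phi> \<subseteq> {..<n}}"

text \<open>Interpretations of the symbols over the type \<open>'a\<close>. The universe of the structure is the whole
  of \<open>'a\<close>; its substructures are sets \<open>M :: 'a set\<close>, to which quantifiers are relativised by the
  first argument of \<open>sat\<close>.\<close>

record ('f, 'r, 'a) interp =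
  fun_int :: "'f \<Rightarrow> 'a list \<Rightarrow> 'a"
  rel_int :: "'r \<Rightarrow> 'a list \<Rightarrow> bool"

primrec val :: "('f, 'r, 'a) interp \<Rightarrow> (nat \<Rightarrow> 'a) \<Rightarrow> 'f trm \<Rightarrow> 'a" where
  "val C e (Var i) = e i"
| "val C e (Fn f ts) = fun_int C f (map (val C e) ts)"

primrec sat :: "'a set \<Rightarrow> ('f, 'r, 'a) interp \<Rightarrow> (nat \<Rightarrow> 'a) \<Rightarrow> ('f, 'r) fm \<Rightarrow> bool" where
  "sat U C e (Eq s t) = (val C e s = val C e t)"
| "sat U C e (Rel r ts) = rel_int C r (map (val C e) ts)"
| "sat U C e (Neg \<phi>) = (\<not> sat U C e \<phi>)"
| "sat U C e (Conj \<phi> \<psi>) = (sat U C e \<phi> \<and> sat U C e \<psi>)"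
| "sat U C e (Exists i \<phi>) = (\<exists>a\<in>U. sat U C (e(i := a)) \<phi>)"

text \<open>\<open>holds C \<phi> xs\<close> is \<open>C \<Turnstile> \<phi>(xs)\<close>. It is only used for
  \<open>\<phi> \<in> formulas L (length xs)\<close>, so the entries beyond the end of \<open>xs\<close> do not matter.\<close>

definition holds :: "('f, 'r, 'a) interp \<Rightarrow> ('f, 'r) fm \<Rightarrow> 'a list \<Rightarrow> bool" where
  "holds C \<phi> xs = sat UNIV C (\<lambda>i. xs ! i) \<phi>"

text \<open>A complete theory is a maximal set of sentences. Only theories with a model are considered,
  so consistency is automatic.\<close>

definition complete_theory :: "('f, 'r) language \<Rightarrow> ('f, 'r) fm set \<Rightarrow> bool" where
  "complete_theory L T \<longleftrightarrow>
     T \<subseteq> formulas L 0 \<and> (\<forall>\<phi>\<in>formulas L 0. \<phi> \<in> T \<or> Neg \<phi> \<in> T)"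

definition models :: "('f, 'r, 'a) interp \<Rightarrow> ('f, 'r) fm set \<Rightarrow> bool" where
  "models C T \<longleftrightarrow> (\<forall>\<phi>\<in>T. holds C \<phi> [])"

definition elementary_submodel ::
  "('f, 'r) language \<Rightarrow> ('f, 'r, 'a) interp \<Rightarrow> 'a set \<Rightarrow> bool" where
  "elementary_submodel L C M \<longleftrightarrow>
     M \<noteq> {} \<and>
     (\<forall>(f, n)\<in>Funs L. \<forall>xs. length xs = n \<and> set xs \<subseteq> M \<longrightarrow> fun_int C f xs \<in> M) \<and>
     (\<forall>xs. set xs \<subseteq> M \<longrightarrow>
        (\<forall>\<phi>\<in>formulas L (length xs). sat M C (\<lambda>i. xs ! i) \<phi> \<longleftrightarrow> holds C \<phi> xs))"

definition automorphism ::
  "('f, 'r) language \<Rightarrow> ('f, 'r, 'a) interp \<Rightarrow> ('a \<Rightarrow> 'a) \<Rightarrow> bool" where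
  "automorphism L C \<sigma> \<longleftrightarrow>
     bij \<sigma> \<and>
     (\<forall>(f, n)\<in>Funs L. \<forall>xs. length xs = n \<longrightarrow> \<sigma> (fun_int C f xs) = fun_int C f (map \<sigma> xs)) \<and>
     (\<forall>(r, n)\<in>Rels L. \<forall>xs. length xs = n \<longrightarrow> (rel_int C r (map \<sigma> xs) \<longleftrightarrow> rel_int C r xs))"

text \<open>\<open>tp(a/B)\<close> for a tuple \<open>a\<close>: a pair \<open>(\<phi>, c)\<close> stands for the formula \<open>\<phi>(x, c)\<close> with
  parameters \<open>c\<close> from \<open>B\<close>.\<close>

definition tp ::
  "('f, 'r) language \<Rightarrow> ('f, 'r, 'a) interp \<Rightarrow> 'a list \<Rightarrow> 'a set \<Rightarrow> (('f, 'r) fm \<times> 'a list) set" where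
  "tp L C a B =
     {(\<phi>, c). \<phi> \<in> formulas L (length a + length c) \<and> set c \<subseteq> B \<and> holds C \<phi> (a @ c)}"

definition definable_over ::
  "('f, 'r) language \<Rightarrow> ('f, 'r, 'a) interp \<Rightarrow> 'a set \<Rightarrow> nat \<Rightarrow> 'a list set \<Rightarrow> bool" where
  "definable_over L C B n S \<longleftrightarrow>
     (\<exists>c. set c \<subseteq> B \<and>
        (\<exists>\<phi>\<in>formulas L (n + length c). S = {xs. length xs = n \<and> holds C \<phi> (xs @ c)}))"

definition dcl :: "('f, 'r) language \<Rightarrow> ('f, 'r, 'a) interp \<Rightarrow> 'a set \<Rightarrow> 'a set" where
  "dcl L C B = {b. definable_over L C B 1 {[b]}}"


section \<open>NIP\<close>

definition shatters :: "'x set set \<Rightarrow> 'x set \<Rightarrow> bool" where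
  "shatters F A \<longleftrightarrow> (\<forall>B\<subseteq>A. \<exists>S\<in>F. S \<inter> A = B)"

definition finite_VC_dim :: "'x set set \<Rightarrow> bool" where
  "finite_VC_dim F \<longleftrightarrow> (\<exists>d. \<forall>A. finite A \<and> shatters F A \<longrightarrow> card A \<le> d)"

text \<open>The partitioned formulas are the \<open>\<phi>(x; y)\<close> where \<open>x\<close> consists of the first \<open>k\<close> variables and
  \<open>y\<close> of the next \<open>m\<close>. Finiteness of the VC-dimension in one model of a complete theory is
  equivalent to its finiteness in all models, so NIP of the theory of \<open>C\<close> is stated in \<open>C\<close>.\<close>

definition NIP :: "('f, 'r) language \<Rightarrow> ('f, 'r, 'a) interp \<Rightarrow> bool" where
  "NIP L C \<longleftrightarrow>
     (\<forall>k m. \<forall>\<phi>\<in>formulas L (k + m).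
        finite_VC_dim {{a. length a = k \<and> holds C \<phi> (a @ b)} |b. length b = m})"


section \<open>Monster models\<close>

text \<open>The degree of saturation \<open>\<kappa>\<close> is a cardinal in the sense of the cardinal library in
  \<open>Main\<close>.\<close>

definition small :: "'k rel \<Rightarrow> 'x set \<Rightarrow> bool" where
  "small \<kappa> A \<longleftrightarrow> (card_of A, \<kappa>) \<in> ordLess"

definition saturated ::
  "('f, 'r) language \<Rightarrow> ('f, 'r, 'a) interp \<Rightarrow> 'k rel \<Rightarrow> bool" where
  "saturated L C \<kappa> \<longleftrightarrow>
     (\<forall>A p. small \<kappa> A \<and> p \<subseteq> {(\<phi>, c). \<phi> \<in> formulas L (1 + length c) \<and> set c \<subseteq> A} \<and>
        (\<forall>q. finite q \<and> q \<subseteq> p \<longrightarrow> (\<exists>a. \<forall>(\<phi>, c)\<in>q. holds C \<phi> (a # c)))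
        \<longrightarrow> (\<exists>a. \<forall>(\<phi>, c)\<in>p. holds C \<phi> (a # c)))"

definition elementary_map ::
  "('f, 'r) language \<Rightarrow> ('f, 'r, 'a) interp \<Rightarrow> 'a set \<Rightarrow> ('a \<Rightarrow> 'a) \<Rightarrow> bool" where
  "elementary_map L C A f \<longleftrightarrow>
     (\<forall>xs. set xs \<subseteq> A \<longrightarrow>
        (\<forall>\<phi>\<in>formulas L (length xs). holds C \<phi> (map f xs) \<longleftrightarrow> holds C \<phi> xs))"

definition strongly_homogeneous ::
  "('f, 'r) language \<Rightarrow> ('f, 'r, 'a) interp \<Rightarrow> 'k rel \<Rightarrow> bool" where
  "strongly_homogeneous L C \<kappa> \<longleftrightarrow>
     (\<forall>A f. small \<kappa> A \<and> elementary_map L C A f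
        \<longrightarrow> (\<exists>\<sigma>. automorphism L C \<sigma> \<and> (\<forall>a\<in>A. \<sigma> a = f a)))"

text \<open>``Sufficiently'' saturated and homogeneous is read in the usual way: \<open>\<kappa>\<close> is a strong limit
  cardinal greater than the number of \<open>L\<close>-formulas (hence uncountable). It suffices to state the
  strong limit condition for subsets of the type underlying \<open>\<kappa>\<close>, since every cardinal below \<open>\<kappa>\<close> is
  the cardinality of such a set.\<close>

definition strong_limit :: "'k rel \<Rightarrow> bool" where
  "strong_limit \<kappa> \<longleftrightarrow>
     Card_order \<kappa> \<and> infinite (Field \<kappa>) \<and> (\<forall>A :: 'k set. small \<kappa> A \<longrightarrow> small \<kappa> (Pow A))"

definition monster_model ::
  "('f, 'r) language \<Rightarrow> ('f, 'r) fm set \<Rightarrow> ('f, 'r, 'a) interp \<Rightarrow> 'k rel \<Rightarrow> bool" where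
  "monster_model L T C \<kappa> \<longleftrightarrow>
     models C T \<and> strong_limit \<kappa> \<and> small \<kappa> {\<phi>. wf_fm L \<phi>} \<and>
     saturated L C \<kappa> \<and> strongly_homogeneous L C \<kappa>"


section \<open>Definable groups and their connected components\<close>

text \<open>\<open>G\<close> is the group of \<open>C\<close>-points, whose elements are \<open>n\<close>-tuples.\<close>

definition definable_group ::
  "('f, 'r) language \<Rightarrow> ('f, 'r, 'a) interp \<Rightarrow> 'a set \<Rightarrow> nat \<Rightarrow> 'a list monoid \<Rightarrow> bool" where
  "definable_group L C B n G \<longleftrightarrow>
     group G \<and>
     definable_over L C B n (carrier G) \<and>
     definable_over L C B (3 * n)
       {x @ y @ (x \<otimes>\<^bsub>G\<^esub> y) |x y. x \<in> carrier G \<and> y \<in> carrier G}"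

definition X_set ::
  "('f, 'r) language \<Rightarrow> ('f, 'r, 'a) interp \<Rightarrow> 'a list monoid \<Rightarrow> 'a set \<Rightarrow> 'a list set" where
  "X_set L C G M =
     {inv\<^bsub>G\<^esub> a \<otimes>\<^bsub>G\<^esub> b |a b. a \<in> carrier G \<and> b \<in> carrier G \<and> tp L C a M = tp L C b M}"

definition invariant_over ::
  "('f, 'r) language \<Rightarrow> ('f, 'r, 'a) interp \<Rightarrow> 'a set \<Rightarrow> 'a list set \<Rightarrow> bool" where
  "invariant_over L C M H \<longleftrightarrow>
     (\<forall>\<sigma>. automorphism L C \<sigma> \<and> (\<forall>x\<in>M. \<sigma> x = x) \<longrightarrow> map \<sigma> ` H = H)"

definition bounded_index :: "'k rel \<Rightarrow> 'a list monoid \<Rightarrow> 'a list set \<Rightarrow> bool" where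
  "bounded_index \<kappa> G H \<longleftrightarrow> small \<kappa> (rcosets\<^bsub>G\<^esub> H)"

definition G_infinity ::
  "('f, 'r) language \<Rightarrow> ('f, 'r, 'a) interp \<Rightarrow> 'k rel \<Rightarrow> 'a list monoid \<Rightarrow> 'a set \<Rightarrow> 'a list set" where
  "G_infinity L C \<kappa> G M =
     (LEAST H. subgroup H G \<and> invariant_over L C M H \<and> bounded_index \<kappa> G H)"

end

theory Submission
  imports Defs "HOL-Algebra.Generated_Groups"
begin

text \<open>
  Let \<open>a\<close> and \<open>b\<close> have the same type over \<open>M\<^sub>0\<close> and suppose that \<open>a\<inverse>b\<close> is not a product of two
  elements of \<open>X\<^sub>M\<close>. Moving \<open>u a v\<close> to \<open>u b v'\<close> by an automorphism over \<open>M\<close> shows that then \<open>u a v\<close>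
  and \<open>u b v'\<close> have different types over \<open>M\<close> whenever \<open>v\<close> and \<open>v'\<close> have the same type over \<open>M\<close>
  (\<open>product_of_two\<close>). By saturation this is witnessed by finitely many formulas and a single finite
  tuple \<open>m\<close> from \<open>M\<close> (\<open>repels_exists\<close>). From here on \<open>M\<close> has disappeared: there is only a
  \<open>\<emptyset>\<close>-definable relation between \<open>m\<close>, \<open>a\<close> and \<open>b\<close>, and copies of these three tuples are found using
  only that \<open>M\<^sub>0\<close> is a model.

  Suppose that copies \<open>(a\<^sub>i, b\<^sub>i, m\<^sub>i)\<close>, \<open>i < N\<close>, are such that the products \<open>c\<^sub>i\<^sub>+\<^sub>1 \<dots> c\<^sub>N\<^sub>-\<^sub>1\<close> with
  \<open>c\<^sub>j \<in> {a\<^sub>j, b\<^sub>j}\<close> are indistinguishable over \<open>m\<^sub>i\<close>. Two different products \<open>c\<^sub>0 \<dots> c\<^sub>N\<^sub>-\<^sub>1\<close> first differ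
  at some \<open>i\<close>, hence they have the form \<open>u a\<^sub>i v\<close> and \<open>u b\<^sub>i v'\<close> with \<open>v\<close> and \<open>v'\<close> indistinguishable over
  \<open>m\<^sub>i\<close>, hence they are distinguished over \<open>m\<^sub>i\<close>. So \<open>2\<^sup>N\<close> elements realise pairwise different patterns
  of finitely many formulas at \<open>N\<close> parameters, whereas NIP allows only polynomially many patterns
  (\<open>no_repelling_pair\<close>).

  The copies are found one at a time, so that all products of the copies found so far have the same
  type over \<open>M\<^sub>0\<close> (\<open>tower_step\<close>). What is needed is a copy of \<open>(a, b)\<close> inside \<open>M\<^sub>0\<close> whose components
  are not distinguished by finitely many given formulas with parameters from the whole monster model
  (\<open>equivalent_pair_in_model\<close>). This is the main step. It says that the type of \<open>(a, b)\<close> over \<open>M\<^sub>0\<close> has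
  a global coheir whose two projections agree, a fact close to the existence of strictly nonforking
  extensions, and its proof is an instance of the ``broom'' argument of Chernikov and Kaplan.

  For the second assertion, \<open>M\<^sub>0 \<subseteq> M\<close> shows that \<open>X\<^sub>M\<close> is contained in the corresponding set for
  \<open>M\<^sub>0\<close>, so by the first assertion both sets generate the same subgroup. It is invariant over \<open>M\<^sub>0\<close> and of bounded index, since there are few
  types over \<open>M\<^sub>0\<close>, and every subgroup of bounded index that is invariant over \<open>M\<close> contains \<open>X\<^sub>M\<close>
  (\<open>X_set_subset_bounded\<close>).
\<close>

section \<open>Formulas\<close>

lemma finite_fv_trm: "finite (fv_trm t)"
  by (induction t) auto

lemma finite_fv: "finite (fv \<phi>)"
  by (induction \<phi>) (auto simp: finite_fv_trm)

lemma val_cong: "(\<And>i. i \<in> fv_trm t \<Longrightarrow> e i = e' i) \<Longrightarrow> val C e t = val C e' t"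
proof (induction t)
  case (Fn f ts)
  then have "map (val C e) ts = map (val C e') ts"
    by auto
  then show ?case by (simp only: val.simps)
qed simp

lemma sat_cong: "(\<And>i. i \<in> fv \<phi> \<Longrightarrow> e i = e' i) \<Longrightarrow> sat U C e \<phi> = sat U C e' \<phi>"
proof (induction \<phi> arbitrary: e e')
  case (Eq s t)
  then show ?case using val_cong[of s e e' C] val_cong[of t e e' C] by simp
next
  case (Rel r ts)
  have "val C e t = val C e' t" if "t \<in> set ts" for t
    by (rule val_cong, rule Rel.prems) (use that in auto)
  then have "map (val C e) ts = map (val C e') ts" by simp
  then show ?case by (simp only: sat.simps)
next
  case (Neg \<phi>)
  have "sat U C e \<phi> = sat U C e' \<phi>"
    by (rule Neg.IH, rule Neg.prems) simp
  then show ?case by simp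
next
  case (Conj \<phi> \<psi>)
  have "sat U C e \<phi> = sat U C e' \<phi>"
    by (rule Conj.IH(1), rule Conj.prems) simp
  moreover have "sat U C e \<psi> = sat U C e' \<psi>"
    by (rule Conj.IH(2), rule Conj.prems) simp
  ultimately show ?case by simp
next
  case (Exists i \<phi>)
  have "sat U C (e(i := a)) \<phi> = sat U C (e'(i := a)) \<phi>" for a
    by (rule Exists.IH) (use Exists.prems in auto)
  then show ?case by simp
qed

primrec ren_trm :: "(nat \<Rightarrow> nat) \<Rightarrow> 'f trm \<Rightarrow> 'f trm" where
  "ren_trm h (Var i) = Var (h i)"
| "ren_trm h (Fn f ts) = Fn f (map (ren_trm h) ts)"

lemma val_ren_trm: "val C e (ren_trm h t) = val C (e \<circ> h) t"
  by (induction t) (auto intro: arg_cong[where f = "fun_int C _"])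

lemma fv_ren_trm: "fv_trm (ren_trm h t) = h ` fv_trm t"
  by (induction t) auto

lemma wf_ren_trm: "wf_trm L t \<Longrightarrow> wf_trm L (ren_trm h t)"
  by (induction t) (auto simp: list_all_iff)

text \<open>Quantifiers bind named variables, so a renaming has to avoid capture: the bound variable is
  sent to a fresh one. That is why the renamed formula is only asserted to exist.\<close>

lemma formula_renaming:
  assumes "wf_fm L \<phi>"
  shows "\<exists>\<phi>'. wf_fm L \<phi>' \<and> fv \<phi>' \<subseteq> h ` fv \<phi> \<and>
    (\<forall>e. sat U C e \<phi>' = sat U C (e \<circ> h) \<phi>)"
  using assms
proof (induction \<phi> arbitrary: h)
  case (Eq s t)
  then show ?case
    by (intro exI[of _ "Eq (ren_trm h s) (ren_trm h t)"])
      (auto simp: val_ren_trm fv_ren_trm wf_ren_trm comp_def)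
next
  case (Rel r ts)
  have "map (val C e) (map (ren_trm h) ts) = map (val C (e \<circ> h)) ts" for e
    by (simp add: val_ren_trm)
  with Rel show ?case
    by (intro exI[of _ "Rel r (map (ren_trm h) ts)"])
      (auto simp: fv_ren_trm wf_ren_trm list_all_iff comp_def simp del: map_map)
next
  case (Neg \<phi>)
  have "wf_fm L \<phi>" using Neg.prems by simp
  from Neg.IH[OF this, of h] obtain \<phi>' where
    "wf_fm L \<phi>'" "fv \<phi>' \<subseteq> h ` fv \<phi>" "\<forall>e. sat U C e \<phi>' = sat U C (e \<circ> h) \<phi>"
    by blast
  then show ?case by (intro exI[of _ "Neg \<phi>'"]) (auto simp: comp_def)
next
  case (Conj \<phi> \<psi>)
  have wf: "wf_fm L \<phi>" "wf_fm L \<psi>" using Conj.prems by simp_all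
  from Conj.IH(1)[OF wf(1), of h] obtain \<phi>' where
    1: "wf_fm L \<phi>'" "fv \<phi>' \<subseteq> h ` fv \<phi>" "\<forall>e. sat U C e \<phi>' = sat U C (e \<circ> h) \<phi>" by blast
  from Conj.IH(2)[OF wf(2), of h] obtain \<psi>' where
    2: "wf_fm L \<psi>'" "fv \<psi>' \<subseteq> h ` fv \<psi>" "\<forall>e. sat U C e \<psi>' = sat U C (e \<circ> h) \<psi>" by blast
  from 1 2 show ?case by (intro exI[of _ "Conj \<phi>' \<psi>'"]) (auto simp: comp_def)
next
  case (Exists i \<phi>)
  obtain k where k: "k \<notin> h ` fv \<phi>"
    using finite_fv[of \<phi>] ex_new_if_finite[OF infinite_UNIV_nat] by blast
  have "wf_fm L \<phi>" using Exists.prems by simp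
  from Exists.IH[OF this, of "h(i := k)"] obtain \<phi>' where \<phi>':
    "wf_fm L \<phi>'" "fv \<phi>' \<subseteq> h(i := k) ` fv \<phi>"
    "\<forall>e. sat U C e \<phi>' = sat U C (e \<circ> h(i := k)) \<phi>" by blast
  have "sat U C (e(k := a)) \<phi>' = sat U C ((e \<circ> h)(i := a)) \<phi>" for e a
    unfolding \<phi>'(3)[rule_format] using k by (intro sat_cong) auto
  moreover have "fv \<phi>' - {k} \<subseteq> h ` (fv \<phi> - {i})"
    using \<phi>'(2) by (auto split: if_splits)
  ultimately show ?case
    using \<phi>'(1) by (intro exI[of _ "Exists k \<phi>'"]) (auto simp: comp_def)
qed

lemma formulasD: "\<phi> \<in> formulas L k \<Longrightarrow> wf_fm L \<phi>" "\<phi> \<in> formulas L k \<Longrightarrow> i \<in> fv \<phi> \<Longrightarrow> i < k"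
  by (auto simp: formulas_def)

lemma holds_cong:
  "\<phi> \<in> formulas L k \<Longrightarrow> (\<And>i. i < k \<Longrightarrow> xs ! i = ys ! i) \<Longrightarrow> holds C \<phi> xs = holds C \<phi> ys"
  unfolding holds_def by (rule sat_cong) (auto dest: formulasD)

lemma formula_reindex:
  assumes "\<phi> \<in> formulas L m" and "length ps = m" and "set ps \<subseteq> {..<k}"
  obtains \<phi>' where "\<phi>' \<in> formulas L k"
    and "\<And>xs. holds C \<phi>' xs = holds C \<phi> (map ((!) xs) ps)"
proof -
  obtain \<phi>' where \<phi>': "wf_fm L \<phi>'" "fv \<phi>' \<subseteq> (\<lambda>i. ps ! i) ` fv \<phi>"
    "\<forall>e. sat UNIV C e \<phi>' = sat UNIV C (e \<circ> (\<lambda>i. ps ! i)) \<phi>"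
    using formula_renaming[of L \<phi> "\<lambda>i. ps ! i" UNIV C] assms(1) by (auto dest: formulasD)
  have "fv \<phi>' \<subseteq> {..<k}"
    using \<phi>'(2) assms formulasD(2)[OF assms(1)] by (fastforce dest: nth_mem)
  then have 1: "\<phi>' \<in> formulas L k" using \<phi>'(1) by (simp add: formulas_def)
  have 2: "holds C \<phi>' xs = holds C \<phi> (map ((!) xs) ps)" for xs
    unfolding holds_def \<phi>'(3)[rule_format]
    by (rule sat_cong) (use formulasD(2)[OF assms(1)] assms(2) in auto)
  show ?thesis by (rule that[OF 1 2])
qed

lemma formula_ex:
  assumes "\<phi> \<in> formulas L (k + m)"
  shows "\<exists>\<phi>'\<in>formulas L k. \<forall>xs. length xs = k \<longrightarrow>
    holds C \<phi>' xs = (\<exists>ys. length ys = m \<and> holds C \<phi> (xs @ ys))"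
  using assms
proof (induction m arbitrary: \<phi>)
  case (Suc m)
  define \<psi> where "\<psi> = Exists (k + m) \<phi>"
  have \<psi>: "\<psi> \<in> formulas L (k + m)"
    using Suc.prems unfolding \<psi>_def formulas_def by (auto simp: less_Suc_eq subset_eq)
  have *: "holds C \<psi> zs = (\<exists>a. holds C \<phi> (zs @ [a]))" if "length zs = k + m" for zs
  proof -
    have "sat UNIV C ((\<lambda>i. zs ! i)(k + m := a)) \<phi> = sat UNIV C (\<lambda>i. (zs @ [a]) ! i) \<phi>" for a
      by (rule sat_cong) (use that formulasD(2)[OF Suc.prems] in
          \<open>auto simp: nth_append less_Suc_eq\<close>)
    then show ?thesis unfolding \<psi>_def holds_def by simp
  qed
  from Suc.IH[OF \<psi>] obtain \<phi>' where \<phi>': "\<phi>' \<in> formulas L k"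
    "\<forall>xs. length xs = k \<longrightarrow> holds C \<phi>' xs = (\<exists>ys. length ys = m \<and> holds C \<psi> (xs @ ys))" by blast
  have "(\<exists>ys. length ys = m \<and> holds C \<psi> (xs @ ys)) =
      (\<exists>ys. length ys = Suc m \<and> holds C \<phi> (xs @ ys))" if xs: "length xs = k" for xs
  proof
    assume "\<exists>ys. length ys = m \<and> holds C \<psi> (xs @ ys)"
    then obtain ys where "length ys = m" "holds C \<psi> (xs @ ys)" by blast
    moreover from this obtain a where "holds C \<phi> ((xs @ ys) @ [a])"
      using *[of "xs @ ys"] xs by auto
    ultimately have "length ys = m" "holds C \<phi> (xs @ ys @ [a])" by simp_all
    then show "\<exists>ys. length ys = Suc m \<and> holds C \<phi> (xs @ ys)" by (intro exI[of _ "ys @ [a]"]) auto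
  next
    assume "\<exists>ys. length ys = Suc m \<and> holds C \<phi> (xs @ ys)"
    then obtain ys where ys: "length ys = Suc m" "holds C \<phi> (xs @ ys)" by blast
    then obtain zs a where "ys = zs @ [a]" by (cases ys rule: rev_cases) auto
    with ys xs * show "\<exists>ys. length ys = m \<and> holds C \<psi> (xs @ ys)"
      by (intro exI[of _ zs]) auto
  qed
  with \<phi>' show ?case by auto
qed auto

section \<open>Definable relations between tuples\<close>

locale model =
  fixes L :: "('f, 'r) language" and C :: "('f, 'r, 'a) interp"
begin

text \<open>\<open>Q\<close> is a relation between tuples, which are listed as blocks of lengths \<open>ls\<close>; it is definable with
  parameters from \<open>A\<close>. Since group elements are tuples themselves, block numbers take the place of
  variables. The values of \<open>Q\<close> on lists of another shape do not matter.\<close>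

definition defrel :: "'a set \<Rightarrow> nat list \<Rightarrow> ('a list list \<Rightarrow> bool) \<Rightarrow> bool" where
  "defrel A ls Q \<longleftrightarrow> (\<exists>c. set c \<subseteq> A \<and> (\<exists>\<phi>\<in>formulas L (sum_list ls + length c).
     \<forall>Es. map length Es = ls \<longrightarrow> Q Es = holds C \<phi> (concat Es @ c)))"

lemma defrelE:
  assumes "defrel A ls Q"
  obtains c \<phi> where "set c \<subseteq> A" "\<phi> \<in> formulas L (sum_list ls + length c)"
    "\<And>Es. map length Es = ls \<Longrightarrow> Q Es = holds C \<phi> (concat Es @ c)"
  using assms unfolding defrel_def by blast

lemma defrelI:
  assumes "set c \<subseteq> A" "\<phi> \<in> formulas L (sum_list ls + length c)"
    "\<And>Es. map length Es = ls \<Longrightarrow> Q Es = holds C \<phi> (concat Es @ c)"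
  shows "defrel A ls Q"
  using assms unfolding defrel_def by blast

lemma defrel_cong:
  assumes "defrel A ls Q" "\<And>Es. map length Es = ls \<Longrightarrow> Q' Es = Q Es"
  shows "defrel A ls Q'"
proof (rule defrelE[OF assms(1)])
  fix c \<phi>
  assume "set c \<subseteq> A" "\<phi> \<in> formulas L (sum_list ls + length c)"
    "\<And>Es. map length Es = ls \<Longrightarrow> Q Es = holds C \<phi> (concat Es @ c)"
  then show ?thesis using assms(2) by (intro defrelI[of c A \<phi>]) auto
qed

lemma defrel_mono: "defrel A ls Q \<Longrightarrow> A \<subseteq> B \<Longrightarrow> defrel B ls Q"
  unfolding defrel_def by blast

text \<open>Only the concatenation of the blocks matters, so their boundaries may be moved.\<close>

lemma defrel_regroup:
  assumes "defrel A ls Q" and "sum_list ls' = sum_list ls"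
    and "\<And>Es'. map length Es' = ls' \<Longrightarrow> \<exists>Es. map length Es = ls \<and> concat Es = concat Es' \<and> Q' Es' = Q Es"
  shows "defrel A ls' Q'"
proof -
  from assms(1) obtain c \<phi> where *: "set c \<subseteq> A" "\<phi> \<in> formulas L (sum_list ls + length c)"
    "\<And>Es. map length Es = ls \<Longrightarrow> Q Es = holds C \<phi> (concat Es @ c)" by (rule defrelE) blast
  show ?thesis
  proof (rule defrelI)
    show "\<phi> \<in> formulas L (sum_list ls' + length c)" using * assms by simp
    show "Q' Es' = holds C \<phi> (concat Es' @ c)" if "map length Es' = ls'" for Es'
      using assms(3)[OF that] * by auto
  qed fact
qed

lemma defrel_not: "defrel A ls Q \<Longrightarrow> defrel A ls (\<lambda>Es. \<not> Q Es)"
proof (erule defrelE)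
  fix c \<phi> assume "set c \<subseteq> A" "\<phi> \<in> formulas L (sum_list ls + length c)"
    "\<And>Es. map length Es = ls \<Longrightarrow> Q Es = holds C \<phi> (concat Es @ c)"
  then show "defrel A ls (\<lambda>Es. \<not> Q Es)"
    by (intro defrelI[of c A "Neg \<phi>"]) (auto simp: formulas_def holds_def)
qed

lemma length_concat_blocks: "map length Es = ls \<Longrightarrow> length (concat Es) = sum_list ls"
  by (auto simp: length_concat)

lemma map_nth_upt: "k \<le> length xs \<Longrightarrow> map ((!) xs) [0..<k] = take k xs"
  by (rule nth_equalityI) simp_all

lemma map_nth_upt_append: "map ((!) (xs @ ys)) [length xs..<length xs + length ys] = ys"
  by (rule nth_equalityI) simp_all

lemma formula_weaken_params:
  assumes "\<phi> \<in> formulas L (k + length c)"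
  shows "\<exists>\<phi>'\<in>formulas L (k + length (c' @ c)). \<forall>xs. length xs = k \<longrightarrow> holds C \<phi>' (xs @ c' @ c) = holds C \<phi> (xs @ c)"
proof -
  let ?ps = "[0..<k] @ [k + length c'..<k + length c' + length c]"
  obtain \<phi>' where \<phi>': "\<phi>' \<in> formulas L (k + length c' + length c)"
    "\<And>xs. holds C \<phi>' xs = holds C \<phi> (map ((!) xs) ?ps)"
    by (rule formula_reindex[OF assms, of ?ps "k + length c' + length c" C]) auto
  have "map ((!) (xs @ c' @ c)) ?ps = xs @ c" if "length xs = k" for xs
    using map_nth_upt_append[of "xs @ c'" c] map_nth_upt[of k "xs @ c' @ c"] that by simp
  with \<phi>' show ?thesis by (intro bexI[of _ \<phi>']) (auto simp: add.assoc)
qed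

lemma formula_weaken_params_right:
  assumes "\<phi> \<in> formulas L (k + length c)"
  shows "\<phi> \<in> formulas L (k + length (c @ c'))"
    and "length xs = k \<Longrightarrow> holds C \<phi> (xs @ c @ c') = holds C \<phi> (xs @ c)"
proof -
  show "\<phi> \<in> formulas L (k + length (c @ c'))" using assms by (auto simp: formulas_def)
  show "holds C \<phi> (xs @ c @ c') = holds C \<phi> (xs @ c)" if "length xs = k"
    by (rule holds_cong[OF assms]) (use that in \<open>auto simp: nth_append\<close>)
qed

lemma defrel_conj:
  assumes "defrel A ls P" "defrel A ls Q"
  shows "defrel A ls (\<lambda>Es. P Es \<and> Q Es)"
proof -
  from assms(1) obtain c \<phi> where c: "set c \<subseteq> A" "\<phi> \<in> formulas L (sum_list ls + length c)"
    "\<And>Es. map length Es = ls \<Longrightarrow> P Es = holds C \<phi> (concat Es @ c)" by (rule defrelE) blast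
  from assms(2) obtain d \<psi> where d: "set d \<subseteq> A" "\<psi> \<in> formulas L (sum_list ls + length d)"
    "\<And>Es. map length Es = ls \<Longrightarrow> Q Es = holds C \<psi> (concat Es @ d)" by (rule defrelE) blast
  note \<phi> = formula_weaken_params_right[OF c(2)]
  obtain \<psi>' where \<psi>': "\<psi>' \<in> formulas L (sum_list ls + length (c @ d))"
    "\<And>xs. length xs = sum_list ls \<Longrightarrow> holds C \<psi>' (xs @ c @ d) = holds C \<psi> (xs @ d)"
    using formula_weaken_params[OF d(2), of c] by blast
  show ?thesis
  proof (rule defrelI)
    show "set (c @ d) \<subseteq> A" using c d by simp
    show "Conj \<phi> \<psi>' \<in> formulas L (sum_list ls + length (c @ d))"
      using formula_weaken_params_right(1)[OF c(2), of d] \<psi>' by (auto simp: formulas_def)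
    show "(P Es \<and> Q Es) = holds C (Conj \<phi> \<psi>') (concat Es @ c @ d)" if "map length Es = ls" for Es
      using c(3)[OF that] d(3)[OF that] \<phi>(2) \<psi>'(2) length_concat_blocks[OF that]
      by (auto simp: holds_def)
  qed
qed

lemma defrel_True: "defrel A ls (\<lambda>Es. True)"
proof (rule defrelI)
  show "set [] \<subseteq> A" by simp
  show "Neg (Exists 0 (Neg (Eq (Var 0) (Var 0)))) \<in> formulas L (sum_list ls + length [])"
    by (simp add: formulas_def)
qed (simp add: holds_def)

lemma defrel_disj:
  assumes "defrel A ls P" "defrel A ls Q"
  shows "defrel A ls (\<lambda>Es. P Es \<or> Q Es)"
  by (rule defrel_cong[OF defrel_not[OF defrel_conj[OF defrel_not[OF assms(1)] defrel_not[OF assms(2)]]]]) simp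

lemma defrel_imp:
  assumes "defrel A ls P" "defrel A ls Q"
  shows "defrel A ls (\<lambda>Es. P Es \<longrightarrow> Q Es)"
  by (rule defrel_cong[OF defrel_disj[OF defrel_not[OF assms(1)] assms(2)]]) simp

lemma defrel_iff:
  assumes "defrel A ls P" "defrel A ls Q"
  shows "defrel A ls (\<lambda>Es. P Es \<longleftrightarrow> Q Es)"
  by (rule defrel_cong[OF defrel_conj[OF defrel_imp[OF assms] defrel_imp[OF assms(2,1)]]]) auto

lemma defrel_Ball: "finite I \<Longrightarrow> (\<And>i. i \<in> I \<Longrightarrow> defrel A ls (P i)) \<Longrightarrow> defrel A ls (\<lambda>Es. \<forall>i\<in>I. P i Es)"
proof (induction I rule: finite_induct)
  case (insert i I)
  then have "defrel A ls (\<lambda>Es. P i Es \<and> (\<forall>i\<in>I. P i Es))" by (intro defrel_conj) auto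
  then show ?case by (rule defrel_cong) auto
qed (auto intro: defrel_True)

lemma defrel_Bex: "finite I \<Longrightarrow> (\<And>i. i \<in> I \<Longrightarrow> defrel A ls (P i)) \<Longrightarrow> defrel A ls (\<lambda>Es. \<exists>i\<in>I. P i Es)"
  by (rule defrel_cong[OF defrel_not[OF defrel_Ball[OF _ defrel_not]]]) auto

lemma defrel_reindex:
  assumes "defrel A ls' Q" and "ls' = map ((!) ls) is" and "set is \<subseteq> {..<length ls}"
  shows "defrel A ls (\<lambda>Es. Q (map ((!) Es) is))"
proof -
  from assms(1) obtain c \<phi> where c: "set c \<subseteq> A" "\<phi> \<in> formulas L (sum_list ls' + length c)"
    "\<And>Es. map length Es = ls' \<Longrightarrow> Q Es = holds C \<phi> (concat Es @ c)" by (rule defrelE) blast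
  define off where "off i = sum_list (take i ls)" for i
  let ?N = "sum_list ls"
  define ps where "ps = concat (map (\<lambda>i. [off i..<off i + ls ! i]) is) @ [?N..<?N + length c]"
  have off: "off i + ls ! i \<le> ?N" if "i < length ls" for i
  proof -
    have "off i + ls ! i = sum_list (take (Suc i) ls)"
      using that by (simp add: off_def take_Suc_conv_app_nth)
    also have "\<dots> \<le> ?N"
      using sum_list_append[of "take (Suc i) ls" "drop (Suc i) ls"] by simp
    finally show ?thesis .
  qed
  have block: "map ((!) (concat Es @ c)) [off i..<off i + ls ! i] = Es ! i"
    if "map length Es = ls" "i < length ls" for Es i
  proof -
    have i: "i < length Es" using that by auto
    have "concat Es = concat (take i Es) @ Es ! i @ concat (drop (Suc i) Es)"
      by (metis append_take_drop_id concat.simps(2) concat_append Cons_nth_drop_Suc[OF i])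
    moreover have "length (concat (take i Es)) = off i"
      using that by (simp add: off_def length_concat take_map[symmetric])
    moreover have "length (Es ! i) = ls ! i" using that by auto
    ultimately show ?thesis
      by (intro nth_equalityI) (simp_all add: nth_append)
  qed
  have "length ps = sum_list ls' + length c"
    unfolding ps_def assms(2) by (simp add: length_concat comp_def)
  moreover have "set ps \<subseteq> {..<?N + length c}"
    using off assms(3) unfolding ps_def by (fastforce simp: subset_eq)
  ultimately obtain \<phi>' where \<phi>': "\<phi>' \<in> formulas L (?N + length c)"
    "\<And>xs. holds C \<phi>' xs = holds C \<phi> (map ((!) xs) ps)"
    using formula_reindex[OF c(2)] by metis
  show ?thesis
  proof (rule defrelI[OF c(1) \<phi>'(1)])
    fix Es :: "'a list list" assume Es: "map length Es = ls"
    have "map (map ((!) (concat Es @ c))) (map (\<lambda>i. [off i..<off i + ls ! i]) is) = map ((!) Es) is"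
      using block[OF Es] assms(3) by (auto simp del: map_append)
    moreover have "map ((!) (concat Es @ c)) [?N..<?N + length c] = c"
      using map_nth_upt_append[of "concat Es" c] length_concat_blocks[OF Es] by simp
    ultimately have "map ((!) (concat Es @ c)) ps = concat (map ((!) Es) is) @ c"
      unfolding ps_def map_append map_concat by presburger
    moreover have "map length (map ((!) Es) is) = ls'"
      unfolding assms(2) Es[symmetric] using assms(3) Es by (auto simp: subset_eq)
    ultimately show "Q (map ((!) Es) is) = holds C \<phi>' (concat Es @ c)"
      using c(3) \<phi>'(2) by simp
  qed
qed

lemma defrel_param:
  assumes "defrel A (ls @ [k]) Q" "length y = k" "set y \<subseteq> A"
  shows "defrel A ls (\<lambda>Es. Q (Es @ [y]))"
proof -
  from assms(1) obtain c \<phi> where c: "set c \<subseteq> A" "\<phi> \<in> formulas L (sum_list (ls @ [k]) + length c)"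
    "\<And>Es. map length Es = ls @ [k] \<Longrightarrow> Q Es = holds C \<phi> (concat Es @ c)" by (rule defrelE) blast
  show ?thesis
    by (rule defrelI[of "y @ c" A \<phi>]) (use c assms in \<open>auto simp: ac_simps\<close>)
qed

lemma defrel_params:
  assumes "defrel A (ls @ ls') Q" "map length Ys = ls'" "set (concat Ys) \<subseteq> A"
  shows "defrel A ls (\<lambda>Es. Q (Es @ Ys))"
proof -
  from assms(1) obtain c \<phi> where c: "set c \<subseteq> A" "\<phi> \<in> formulas L (sum_list (ls @ ls') + length c)"
    "\<And>Es. map length Es = ls @ ls' \<Longrightarrow> Q Es = holds C \<phi> (concat Es @ c)" by (rule defrelE) blast
  show ?thesis
    by (rule defrelI[of "concat Ys @ c" A \<phi>]) (use c assms in \<open>auto simp: ac_simps length_concat\<close>)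
qed

lemma defrel_ex:
  assumes "defrel A (ls @ [k]) Q"
  shows "defrel A ls (\<lambda>Es. \<exists>x. length x = k \<and> Q (Es @ [x]))"
proof -
  \<comment> \<open>The parameters are moved in front of the quantified block.\<close>
  from assms obtain c \<phi> where c: "set c \<subseteq> A" "\<phi> \<in> formulas L (sum_list (ls @ [k]) + length c)"
    "\<And>Es. map length Es = ls @ [k] \<Longrightarrow> Q Es = holds C \<phi> (concat Es @ c)" by (rule defrelE) blast
  let ?N = "sum_list ls"
  let ?ps = "[0..<?N] @ [?N + length c..<?N + length c + k] @ [?N..<?N + length c]"
  obtain \<psi> where \<psi>: "\<psi> \<in> formulas L (?N + length c + k)"
    "\<And>xs. holds C \<psi> xs = holds C \<phi> (map ((!) xs) ?ps)"
    by (rule formula_reindex[OF c(2), of ?ps "?N + length c + k" C]) auto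
  obtain \<phi>' where \<phi>': "\<phi>' \<in> formulas L (?N + length c)"
    "\<And>xs. length xs = ?N + length c \<Longrightarrow>
      holds C \<phi>' xs = (\<exists>ys. length ys = k \<and> holds C \<psi> (xs @ ys))"
    using formula_ex[OF \<psi>(1)] by blast
  show ?thesis
  proof (rule defrelI[OF c(1) \<phi>'(1)])
    fix Es :: "'a list list" assume Es: "map length Es = ls"
    let ?X = "concat Es"
    have N: "length ?X = ?N" by (rule length_concat_blocks[OF Es])
    have "map ((!) (?X @ c @ y)) ?ps = ?X @ y @ c" if y: "length y = k" for y
    proof -
      have "map ((!) (?X @ c @ y)) [0..<?N] = ?X"
        using map_nth_upt[of ?N "?X @ c @ y"] N by simp
      moreover have "map ((!) (?X @ c @ y)) [?N + length c..<?N + length c + k] = y"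
        using map_nth_upt_append[of "?X @ c" y] N y by simp
      moreover have "map ((!) (?X @ c @ y)) [?N..<?N + length c] = c"
        by (rule nth_equalityI) (simp_all add: N nth_append)
      ultimately show ?thesis by simp
    qed
    then have "Q (Es @ [y]) = holds C \<psi> ((?X @ c) @ y)" if "length y = k" for y
      using c(3)[of "Es @ [y]"] \<psi>(2) Es that by simp
    then show "(\<exists>x. length x = k \<and> Q (Es @ [x])) = holds C \<phi>' (?X @ c)"
      using \<phi>'(2)[of "?X @ c"] N by auto
  qed
qed

lemma defrel_exs:
  "defrel A (ls @ ls') Q \<Longrightarrow> defrel A ls (\<lambda>Es. \<exists>Ys. map length Ys = ls' \<and> Q (Es @ Ys))"
proof (induction ls' arbitrary: Q rule: rev_induct)
  case (snoc k ls')
  from defrel_ex[of A "ls @ ls'" k Q] snoc.prems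
  have "defrel A (ls @ ls') (\<lambda>Es. \<exists>x. length x = k \<and> Q (Es @ [x]))" by simp
  from snoc.IH[OF this] show ?case
  proof (rule defrel_cong)
    fix Es
    have "\<exists>Zs x. Ys = Zs @ [x] \<and> map length Zs = ls' \<and> length x = k"
      if "map length Ys = ls' @ [k]" for Ys :: "'a list list"
      using that by (auto simp: map_eq_append_conv map_eq_Cons_conv)
    then have "(\<exists>Ys. map length Ys = ls' @ [k] \<and> Q (Es @ Ys)) \<longleftrightarrow>
      (\<exists>Ys x. map length Ys = ls' \<and> length x = k \<and> Q (Es @ Ys @ [x]))"
      by (metis (no_types, lifting) list.simps(8,9) map_append)
    then show "(\<exists>Ys. map length Ys = ls' @ [k] \<and> Q (Es @ Ys)) \<longleftrightarrow>
      (\<exists>Ys. map length Ys = ls' \<and> (\<exists>x. length x = k \<and> Q ((Es @ Ys) @ [x])))" by auto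
  qed
qed simp

lemma defrel_formula: "\<phi> \<in> formulas L (sum_list ls) \<Longrightarrow> defrel A ls (\<lambda>Es. holds C \<phi> (concat Es))"
  by (rule defrelI[of "[]" A \<phi>]) auto

lemma defrel_formula_params:
  "\<phi> \<in> formulas L (sum_list ls + length c) \<Longrightarrow> set c \<subseteq> A \<Longrightarrow> defrel A ls (\<lambda>Es. holds C \<phi> (concat Es @ c))"
  by (rule defrelI[of c A \<phi>]) auto

lemma split_into_blocks:
  "length xs = sum_list ls \<Longrightarrow> \<exists>Es. map length Es = ls \<and> concat Es = xs"
proof (induction ls arbitrary: xs)
  case (Cons k ls)
  then obtain Es where "map length Es = ls" "concat Es = drop k xs"
    by (metis add_diff_cancel_left' length_drop sum_list.Cons)
  with Cons.prems show ?case by (intro exI[of _ "take k xs # Es"]) auto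
qed simp

text \<open>In a model, the quantifiers of a formula may be taken to range over the model. Applying this to
  one coordinate after the other finds a whole tuple inside the model.\<close>

lemma tarski_vaught_tuple:
  assumes M: "elementary_submodel L C M"
  shows "\<phi> \<in> formulas L (length c + k) \<Longrightarrow> set c \<subseteq> M \<Longrightarrow> length x = k \<Longrightarrow> holds C \<phi> (c @ x) \<Longrightarrow>
    \<exists>y. length y = k \<and> set y \<subseteq> M \<and> holds C \<phi> (c @ y)"
proof (induction k arbitrary: c x)
  case (Suc k)
  let ?l = "length c"
  obtain \<psi> where \<psi>: "\<psi> \<in> formulas L (Suc ?l)"
    "\<And>xs. length xs = Suc ?l \<Longrightarrow> holds C \<psi> xs = (\<exists>ys. length ys = k \<and> holds C \<phi> (xs @ ys))"
    using formula_ex[of \<phi> L "Suc ?l" k C] Suc.prems by auto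
  have ex: "sat U C ((\<lambda>i. c ! i)(?l := a)) \<psi> = sat U C (\<lambda>i. (c @ [a]) ! i) \<psi>" for U a
    by (rule sat_cong) (use formulasD(2)[OF \<psi>(1)] in \<open>auto simp: nth_append less_Suc_eq\<close>)
  obtain a where "holds C \<psi> (c @ [a])"
    using Suc.prems \<psi>(2)[of "c @ [hd x]"] by (cases x) auto
  then have "holds C (Exists ?l \<psi>) c"
    unfolding holds_def by (auto simp: ex)
  moreover have "Exists ?l \<psi> \<in> formulas L ?l"
    using \<psi>(1) by (auto simp: formulas_def less_Suc_eq subset_eq)
  ultimately have "sat M C (\<lambda>i. c ! i) (Exists ?l \<psi>)"
    using M Suc.prems(2) unfolding elementary_submodel_def by blast
  then obtain a where a: "a \<in> M" "sat M C (\<lambda>i. (c @ [a]) ! i) \<psi>" by (auto simp: ex)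
  have "set (c @ [a]) \<subseteq> M" "\<psi> \<in> formulas L (length (c @ [a]))"
    using a Suc.prems(2) \<psi>(1) by simp_all
  then have "holds C \<psi> (c @ [a])"
    using M a(2) unfolding elementary_submodel_def by blast
  then obtain ys where "length ys = k" "holds C \<phi> ((c @ [a]) @ ys)" using \<psi>(2)[of "c @ [a]"] by auto
  with Suc.IH[of "c @ [a]" ys] Suc.prems a obtain ys where
    "length ys = k" "set ys \<subseteq> M" "holds C \<phi> ((c @ [a]) @ ys)" by auto
  with a show ?case by (intro exI[of _ "a # ys"]) auto
qed auto

lemma tarski_vaught:
  assumes M: "elementary_submodel L C M" and "defrel M ls Q" and "map length Es = ls" and "Q Es"
  shows "\<exists>Es. map length Es = ls \<and> set (concat Es) \<subseteq> M \<and> Q Es"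
proof -
  from assms(2) obtain c \<phi> where c: "set c \<subseteq> M" "\<phi> \<in> formulas L (sum_list ls + length c)"
    "\<And>Es. map length Es = ls \<Longrightarrow> Q Es = holds C \<phi> (concat Es @ c)" by (rule defrelE) blast
  let ?N = "sum_list ls"
  let ?ps = "[length c..<length c + ?N] @ [0..<length c]"
  obtain \<psi> where \<psi>: "\<psi> \<in> formulas L (length c + ?N)"
    "\<And>xs. holds C \<psi> xs = holds C \<phi> (map ((!) xs) ?ps)"
    by (rule formula_reindex[OF c(2), of ?ps "length c + ?N" C]) auto
  have swap: "holds C \<psi> (c @ x) = holds C \<phi> (x @ c)" if "length x = ?N" for x
    using \<psi>(2) map_nth_upt_append[of c x] map_nth_upt[of "length c" "c @ x"] that by simp
  have "holds C \<psi> (c @ concat Es)"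
    using swap length_concat_blocks[OF assms(3)] c(3)[OF assms(3)] assms(4) by simp
  from tarski_vaught_tuple[OF M \<psi>(1) c(1) _ this] length_concat_blocks[OF assms(3)] obtain y where
    y: "length y = ?N" "set y \<subseteq> M" "holds C \<psi> (c @ y)" by blast
  from split_into_blocks[OF y(1)] obtain Es' where "map length Es' = ls" "concat Es' = y" by blast
  with y c(3) swap show ?thesis by blast
qed

end


section \<open>Small sets and saturation\<close>

lemma small_mono: "A \<subseteq> B \<Longrightarrow> small \<kappa> B \<Longrightarrow> small \<kappa> A"
  unfolding small_def by (rule ordLeq_ordLess_trans[OF card_of_mono1])

lemma small_image: "small \<kappa> A \<Longrightarrow> small \<kappa> (f ` A)"
  unfolding small_def by (rule ordLeq_ordLess_trans[OF card_of_image])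

lemma small_inj: "inj_on f A \<Longrightarrow> f ` A \<subseteq> B \<Longrightarrow> small \<kappa> B \<Longrightarrow> small \<kappa> A"
  unfolding small_def by (rule ordLeq_ordLess_trans[OF card_of_ordLeqI]) auto

context
  fixes \<kappa> :: "'k rel"
  assumes \<kappa>: "strong_limit \<kappa>"
begin

lemma strong_limitD: "Card_order \<kappa>" "infinite (Field \<kappa>)"
  using \<kappa> by (auto simp: strong_limit_def)

lemma small_Un: "small \<kappa> A \<Longrightarrow> small \<kappa> B \<Longrightarrow> small \<kappa> (A \<union> B)"
  unfolding small_def by (rule card_of_Un_ordLess_infinite_Field[OF strong_limitD(2,1)])

lemma small_finite: "finite A \<Longrightarrow> small \<kappa> A"
  unfolding small_def
  using finite_ordLess_infinite[of "card_of A" \<kappa>] strong_limitD card_of_Well_order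
  by (auto simp: card_order_on_def Field_card_of)

lemma small_insert: "small \<kappa> A \<Longrightarrow> small \<kappa> (insert a A)"
  using small_Un[OF small_finite, of "{a}" A] by simp

lemma small_Pow:
  fixes A :: "'x set"
  assumes "small \<kappa> A"
  shows "small \<kappa> (Pow A)"
proof -
  from assms obtain B :: "'k set" where B: "(card_of A, card_of B) \<in> ordIso" "(card_of B, \<kappa>) \<in> ordLess"
    using internalize_card_of_ordLess[of A \<kappa>] unfolding small_def by blast
  then have "small \<kappa> (Pow B)" using \<kappa> by (auto simp: strong_limit_def small_def)
  moreover obtain f where f: "bij_betw f A B" using B(1) card_of_ordIso by blast
  then have "inj_on ((`) f) (Pow A)" "(`) f ` Pow A \<subseteq> Pow B"
    using bij_betw_imp_inj_on[OF f] bij_betw_imp_surj_on[OF f] by (auto intro: inj_on_image_Pow)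
  ultimately show ?thesis by (blast intro: small_inj)
qed

lemma small_nat:
  assumes "small \<kappa> {\<phi> :: ('f, 'r) fm. wf_fm L \<phi>}"
  shows "small \<kappa> (UNIV :: nat set)"
  by (rule small_inj[OF _ _ assms, of "\<lambda>i. Eq (Var i) (Var i)"]) (auto intro: injI)

lemma small_Times:
  assumes nat: "small \<kappa> (UNIV :: nat set)" and "small \<kappa> A" "small \<kappa> B"
  shows "small \<kappa> (A \<times> B)"
proof -
  let ?Z = "(UNIV :: nat set) <+> (A <+> B)"
  have Z: "small \<kappa> ?Z"
    using assms unfolding small_def
    by (intro card_of_Plus_ordLess_infinite_Field[OF strong_limitD(2,1)])
  have "infinite ?Z" by (simp add: finite_Plus_iff)
  then have "(card_of (?Z \<times> ?Z), card_of ?Z) \<in> ordIso" by (rule card_of_Times_same_infinite)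
  then have "small \<kappa> (?Z \<times> ?Z)"
    using Z unfolding small_def by (rule ordIso_ordLess_trans)
  then show ?thesis
    by (rule small_inj[of "\<lambda>(a, b). (Inr (Inl a), Inr (Inr b))", rotated 2]) (auto intro!: inj_onI)
qed

lemma small_lists:
  assumes nat: "small \<kappa> (UNIV :: nat set)" and A: "small \<kappa> A"
  shows "small \<kappa> {c. set c \<subseteq> A}"
proof -
  let ?f = "\<lambda>c. (length c, (\<lambda>i. (i, c ! i)) ` {..<length c})"
  have "inj_on ?f {c. set c \<subseteq> A}"
  proof (rule inj_onI)
    fix c d assume *: "?f c = ?f d"
    then have "c ! i = d ! i" if "i < length c" for i
      using that by (auto dest: equalityD1)
    with * show "c = d" by (auto intro: nth_equalityI)
  qed
  moreover have "small \<kappa> ((UNIV :: nat set) \<times> Pow ((UNIV :: nat set) \<times> A))"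
    using nat A by (intro small_Times small_Pow)
  ultimately show ?thesis
    by (intro small_inj[of ?f _ "(UNIV :: nat set) \<times> Pow ((UNIV :: nat set) \<times> A)"])
      (auto dest!: nth_mem)
qed

lemma small_Union_sets:
  assumes nat: "small \<kappa> (UNIV :: nat set)" and R: "small \<kappa> R"
  shows "small \<kappa> (\<Union> (set ` R))"
proof (rule small_mono)
  show "\<Union> (set ` R) \<subseteq> (\<lambda>(x, i). x ! i) ` (R \<times> UNIV)"
    by (force simp: in_set_conv_nth image_iff)
  show "small \<kappa> ((\<lambda>(x, i). x ! i) ` (R \<times> (UNIV :: nat set)))"
    by (intro small_image small_Times R nat)
qed

end

locale monster = model L C for L :: "('f, 'r) language" and C :: "('f, 'r, 'a) interp" +
  fixes \<kappa> :: "'k rel"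
  assumes strong_limit: "strong_limit \<kappa>"
    and small_formulas: "small \<kappa> {\<phi>. wf_fm L \<phi>}"
    and saturated: "saturated L C \<kappa>"
    and homogeneous: "strongly_homogeneous L C \<kappa>"
begin

lemmas small_intros = small_Un[OF strong_limit] small_finite[OF strong_limit]
  small_insert[OF strong_limit] small_image

lemmas small_UNIV_nat = small_nat[OF strong_limit small_formulas]

text \<open>Saturation is stated for types of single elements. Blocks are realised one coordinate
  after the other: the first coordinate realises all the formulas saying that the remaining
  coordinates can be found.\<close>

lemma saturation_singletons:
  assumes "small \<kappa> A" and "\<And>Q. Q \<in> \<Q> \<Longrightarrow> defrel A (replicate k 1) Q"
    and "\<And>\<F>. finite \<F> \<Longrightarrow> \<F> \<subseteq> \<Q> \<Longrightarrow> \<exists>Es. map length Es = replicate k 1 \<and> (\<forall>Q\<in>\<F>. Q Es)"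
  shows "\<exists>Es. map length Es = replicate k 1 \<and> (\<forall>Q\<in>\<Q>. Q Es)"
  using assms
proof (induction k arbitrary: A \<Q>)
  case 0
  then have "Q []" if "Q \<in> \<Q>" for Q using 0(3)[of "{Q}"] that by auto
  then show ?case by auto
next
  case (Suc k)
  define R where "R \<F> x = (\<exists>Ys. map length Ys = replicate k 1 \<and> (\<forall>Q\<in>\<F>. Q (x # Ys)))" for \<F> :: "('a list list \<Rightarrow> bool) set" and x
  have R: "defrel A [1] (\<lambda>Es. R \<F> (hd Es))" if "finite \<F>" "\<F> \<subseteq> \<Q>" for \<F>
  proof -
    have "defrel A ([1] @ replicate k 1) (\<lambda>Es. \<forall>Q\<in>\<F>. Q Es)"
      using Suc.prems(2) that by (intro defrel_Ball) auto
    from defrel_exs[OF this] show ?thesis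
      by (rule defrel_cong) (auto simp: R_def Cons_eq_map_conv)
  qed
  let ?p = "{(\<phi>, c). \<phi> \<in> formulas L (1 + length c) \<and> set c \<subseteq> A \<and>
    (\<exists>\<F>. finite \<F> \<and> \<F> \<subseteq> \<Q> \<and> (\<forall>a. R \<F> [a] = holds C \<phi> (a # c)))}"
  have "\<exists>a. \<forall>(\<phi>, c)\<in>q. holds C \<phi> (a # c)" if q: "finite q" "q \<subseteq> ?p" for q
  proof -
    have "\<exists>\<F>. finite \<F> \<and> \<F> \<subseteq> \<Q> \<and> (\<forall>a. R \<F> [a] = holds C \<phi> (a # c))" if "(\<phi>, c) \<in> q" for \<phi> c
      using subsetD[OF q(2) that] by simp
    then have "\<forall>x\<in>q. \<exists>\<F>. finite \<F> \<and> \<F> \<subseteq> \<Q> \<and> (\<forall>a. R \<F> [a] = holds C (fst x) (a # snd x))"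
      by (metis prod.collapse)
    then obtain F where "\<forall>x\<in>q. finite (F x) \<and> F x \<subseteq> \<Q> \<and>
        (\<forall>a. R (F x) [a] = holds C (fst x) (a # snd x))"
      using bchoice[of q "\<lambda>x \<F>. finite \<F> \<and> \<F> \<subseteq> \<Q> \<and> (\<forall>a. R \<F> [a] = holds C (fst x) (a # snd x))"]
      by blast
    then have F: "finite (F (\<phi>, c)) \<and> F (\<phi>, c) \<subseteq> \<Q> \<and> (\<forall>a. R (F (\<phi>, c)) [a] = holds C \<phi> (a # c))"
      if "(\<phi>, c) \<in> q" for \<phi> c using that by fastforce
    have "finite (\<Union> (F ` q))" "\<Union> (F ` q) \<subseteq> \<Q>" using F q(1) by auto
    with Suc.prems(3) obtain Es where
      Es: "map length Es = replicate (Suc k) 1" "\<forall>Q\<in>\<Union> (F ` q). Q Es" by meson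
    from Es(1) obtain a Ys where a: "Es = [a] # Ys" "map length Ys = replicate k 1"
      by (cases Es) (auto simp: length_Suc_conv)
    have "holds C \<phi> (a # c)" if "(\<phi>, c) \<in> q" for \<phi> c
    proof -
      have "\<forall>Q\<in>F (\<phi>, c). Q ([a] # Ys)" using Es(2) a(1) that by blast
      then have "R (F (\<phi>, c)) [a]" unfolding R_def using a(2) by blast
      then show ?thesis using F[OF that] by simp
    qed
    then have "\<forall>(\<phi>, c)\<in>q. holds C \<phi> (a # c)" by (simp add: split_beta)
    then show ?thesis ..
  qed
  then have "\<forall>q. finite q \<and> q \<subseteq> ?p \<longrightarrow> (\<exists>a. \<forall>(\<phi>, c)\<in>q. holds C \<phi> (a # c))" by simp
  moreover have "?p \<subseteq> {(\<phi>, c). \<phi> \<in> formulas L (1 + length c) \<and> set c \<subseteq> A}" by auto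
  ultimately have "\<exists>a. \<forall>(\<phi>, c)\<in>?p. holds C \<phi> (a # c)"
    using saturated Suc.prems(1) unfolding saturated_def by presburger
  then obtain a where a: "\<forall>(\<phi>, c)\<in>?p. holds C \<phi> (a # c)" ..
  have Ra: "R \<F> [a]" if \<F>: "finite \<F>" "\<F> \<subseteq> \<Q>" for \<F>
  proof -
    from R[OF \<F>] obtain c \<phi> where c: "set c \<subseteq> A" "\<phi> \<in> formulas L (sum_list [1] + length c)"
      "\<And>Es. map length Es = [1] \<Longrightarrow> R \<F> (hd Es) = holds C \<phi> (concat Es @ c)" by (rule defrelE) blast
    have eq: "R \<F> [b] = holds C \<phi> (b # c)" for b using c(3)[of "[[b]]"] by simp
    have "\<exists>\<F>. finite \<F> \<and> \<F> \<subseteq> \<Q> \<and> (\<forall>a. R \<F> [a] = holds C \<phi> (a # c))"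
      using \<F> eq by (intro exI[of _ \<F>]) simp
    then have "(\<phi>, c) \<in> ?p" using c(1,2) by simp
    from bspec[OF a this] show ?thesis by (simp add: eq)
  qed
  let ?Q = "(\<lambda>Q Ys. Q ([a] # Ys)) ` \<Q>"
  have "\<exists>Ys. map length Ys = replicate k 1 \<and> (\<forall>Q\<in>?Q. Q Ys)"
  proof (rule Suc.IH)
    show "small \<kappa> (insert a A)" using Suc.prems(1) by (rule small_intros)
    show "defrel (insert a A) (replicate k 1) Q'" if "Q' \<in> ?Q" for Q'
    proof -
      from that obtain Q where Q: "Q \<in> \<Q>" "Q' = (\<lambda>Ys. Q ([a] # Ys))" by blast
      have "defrel (insert a A) (replicate (Suc k) 1) Q"
        using Suc.prems(2)[OF Q(1)] by (rule defrel_mono) auto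
      then have "defrel (insert a A) (replicate k 1 @ [1]) (\<lambda>Es. Q (map ((!) Es) (k # [0..<k])))"
      proof (rule defrel_reindex)
        show "replicate (Suc k) (1::nat) = map ((!) (replicate k 1 @ [1])) (k # [0..<k])"
          using map_nth_upt[of k "replicate k (1::nat) @ [1]"] by (simp add: nth_append del: One_nat_def)
      qed auto
      from defrel_param[OF this, of "[a]"]
      have "defrel (insert a A) (replicate k 1) (\<lambda>Es. Q (map ((!) (Es @ [[a]])) (k # [0..<k])))" by auto
      then show ?thesis unfolding Q(2)
      proof (rule defrel_cong)
        fix Es :: "'a list list" assume "map length Es = replicate k 1"
        then have "length Es = k" by (metis length_map length_replicate)
        then have "map ((!) (Es @ [[a]])) (k # [0..<k]) = [a] # Es"
          using map_nth_upt[of k "Es @ [[a]]"] by (simp add: nth_append)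
        then show "Q ([a] # Es) = Q (map ((!) (Es @ [[a]])) (k # [0..<k]))" by simp
      qed
    qed
    show "\<exists>Es. map length Es = replicate k 1 \<and> (\<forall>Q\<in>\<F>. Q Es)" if \<F>: "finite \<F>" "\<F> \<subseteq> ?Q" for \<F>
    proof -
      from \<F> obtain \<F>' where "\<F>' \<subseteq> \<Q>" "finite \<F>'" "\<F> = (\<lambda>Q Ys. Q ([a] # Ys)) ` \<F>'"
        by (meson finite_subset_image)
      with Ra[of \<F>'] show ?thesis unfolding R_def by auto
    qed
  qed
  then obtain Ys where "map length Ys = replicate k 1" "\<forall>Q\<in>\<Q>. Q ([a] # Ys)" by auto
  then show ?case by (intro exI[of _ "[a] # Ys"]) auto
qed

lemma concat_blocks_inject:
  "map length Es = map length Fs \<Longrightarrow> concat Es = concat Fs \<Longrightarrow> Es = Fs"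
proof (induction Es arbitrary: Fs)
  case (Cons E Es)
  then obtain F Gs where "Fs = F # Gs" by (cases Fs) auto
  with Cons show ?case by auto
qed auto

lemma saturation:
  assumes "small \<kappa> A" and "\<And>Q. Q \<in> \<Q> \<Longrightarrow> defrel A ls Q"
    and fin: "\<And>\<F>. finite \<F> \<Longrightarrow> \<F> \<subseteq> \<Q> \<Longrightarrow> \<exists>Es. map length Es = ls \<and> (\<forall>Q\<in>\<F>. Q Es)"
  shows "\<exists>Es. map length Es = ls \<and> (\<forall>Q\<in>\<Q>. Q Es)"
proof -
  define blocks where "blocks xs = (SOME Es. map length Es = ls \<and> concat Es = xs)" for xs :: "'a list"
  have blocks: "map length (blocks xs) = ls \<and> concat (blocks xs) = xs" if "length xs = sum_list ls" for xs
    unfolding blocks_def by (rule someI_ex[OF split_into_blocks[OF that]])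
  let ?k = "sum_list ls"
  have "sum_list (replicate ?k 1) = ?k" by (simp add: sum_list_replicate)
  then have len: "length (concat Es) = ?k" if "map length Es = replicate ?k 1" for Es :: "'a list list"
    by (simp only: length_concat_blocks[OF that])
  let ?Q = "(\<lambda>Q Es. Q (blocks (concat Es))) ` \<Q>"
  have "\<exists>Es. map length Es = replicate ?k 1 \<and> (\<forall>Q\<in>?Q. Q Es)"
  proof (rule saturation_singletons[OF assms(1)])
    show "defrel A (replicate ?k 1) Q'" if "Q' \<in> ?Q" for Q'
    proof -
      from that obtain Q where Q: "Q \<in> \<Q>" "Q' = (\<lambda>Es. Q (blocks (concat Es)))" by blast
      show ?thesis
      proof (rule defrel_regroup[OF assms(2)[OF Q(1)]])
        show "\<exists>Es. map length Es = ls \<and> concat Es = concat Es' \<and> Q' Es' = Q Es"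
          if "map length Es' = replicate ?k 1" for Es'
          using blocks[OF len[OF that]] Q(2) by blast
      qed (simp add: sum_list_replicate)
    qed
    show "\<exists>Es. map length Es = replicate ?k 1 \<and> (\<forall>Q\<in>\<F>. Q Es)" if \<F>: "finite \<F>" "\<F> \<subseteq> ?Q" for \<F>
    proof -
      from \<F> obtain \<F>' where \<F>': "\<F>' \<subseteq> \<Q>" "finite \<F>'" "\<F> = (\<lambda>Q Es. Q (blocks (concat Es))) ` \<F>'"
        by (meson finite_subset_image)
      from fin[OF this(2,1)] obtain Es where Es: "map length Es = ls" "\<forall>Q\<in>\<F>'. Q Es" by blast
      have l: "length (concat Es) = ?k" by (rule length_concat_blocks[OF Es(1)])
      obtain Es' where Es': "map length Es' = replicate ?k 1" "concat Es' = concat Es"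
        using split_into_blocks[of "concat Es" "replicate ?k 1"] l by (auto simp: sum_list_replicate)
      have "blocks (concat Es) = Es" using blocks[OF l] Es(1) by (intro concat_blocks_inject) auto
      then have "\<forall>Q\<in>\<F>. Q Es'" unfolding \<F>'(3) using Es(2) by (simp add: Es'(2))
      with Es'(1) show ?thesis by blast
    qed
  qed
  then obtain Es where "map length Es = replicate ?k 1" "\<forall>Q\<in>\<Q>. Q (blocks (concat Es))" by auto
  with blocks[OF len] show ?thesis by blast
qed

text \<open>The intended \<open>R P\<close> says that certain products of the blocks agree on \<open>P\<close>. All the \<open>R P\<close> together
  then say that these products have the same type over \<open>M\<close>.\<close>

lemma saturation_over_types:
  assumes A: "small \<kappa> A" and B: "defrel A ls B"
    and R: "\<And>P. defrel M [k] P \<Longrightarrow> defrel A ls (R P)"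
    and fin: "\<And>\<P>. finite \<P> \<Longrightarrow> \<forall>P\<in>\<P>. defrel M [k] P \<Longrightarrow>
      \<exists>Es. map length Es = ls \<and> B Es \<and> (\<forall>P\<in>\<P>. R P Es)"
  shows "\<exists>Es. map length Es = ls \<and> B Es \<and> (\<forall>P. defrel M [k] P \<longrightarrow> R P Es)"
proof -
  let ?Q = "insert B (R ` {P. defrel M [k] P})"
  have "\<exists>Es. map length Es = ls \<and> (\<forall>Q\<in>?Q. Q Es)"
  proof (rule saturation[OF A])
    show "defrel A ls Q" if "Q \<in> ?Q" for Q using that B R by auto
    fix \<F> assume \<F>: "finite \<F>" "\<F> \<subseteq> ?Q"
    have "finite (\<F> - {B})" "\<F> - {B} \<subseteq> R ` {P. defrel M [k] P}" using \<F> by auto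
    then obtain \<P> where \<P>: "\<P> \<subseteq> {P. defrel M [k] P}" "finite \<P>" "\<F> - {B} = R ` \<P>"
      by (meson finite_subset_image)
    then have "\<forall>P\<in>\<P>. defrel M [k] P" by blast
    from fin[OF \<P>(2) this] obtain Es where
      Es: "map length Es = ls" "B Es" "\<forall>P\<in>\<P>. R P Es" by (elim exE conjE)
    have rest: "\<forall>Q\<in>\<F> - {B}. Q Es" unfolding \<P>(3) using Es(3) by simp
    have "Q Es" if "Q \<in> \<F>" for Q
    proof (cases "Q = B")
      case True
      show ?thesis unfolding True by (rule Es(2))
    next
      case False
      with that have "Q \<in> \<F> - {B}" by blast
      from bspec[OF rest this] show ?thesis .
    qed
    then have "\<forall>Q\<in>\<F>. Q Es" by (rule ballI)
    with Es(1) show "\<exists>Es. map length Es = ls \<and> (\<forall>Q\<in>\<F>. Q Es)" by (intro exI[of _ Es] conjI)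
  qed
  then obtain Es where Es: "map length Es = ls" "\<forall>Q\<in>?Q. Q Es" by (elim exE conjE)
  then have "B Es" "\<forall>P. defrel M [k] P \<longrightarrow> R P Es" by simp_all
  with Es(1) show ?thesis by (intro exI[of _ Es] conjI)
qed

end


section \<open>Types and automorphisms\<close>

context model
begin

definition fixing_aut :: "'a set \<Rightarrow> ('a \<Rightarrow> 'a) \<Rightarrow> bool" where
  "fixing_aut A \<sigma> \<longleftrightarrow> automorphism L C \<sigma> \<and> (\<forall>x\<in>A. \<sigma> x = x)"

lemma automorphism_rel:
  "automorphism L C \<sigma> \<Longrightarrow> (r, length xs) \<in> Rels L \<Longrightarrow> rel_int C r (map \<sigma> xs) = rel_int C r xs"
  unfolding automorphism_def by blast

lemma automorphism_val:
  assumes "automorphism L C \<sigma>"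
  shows "wf_trm L t \<Longrightarrow> val C (\<lambda>i. \<sigma> (e i)) t = \<sigma> (val C e t)"
proof (induction t)
  case (Fn f ts)
  then have "map (val C (\<lambda>i. \<sigma> (e i))) ts = map \<sigma> (map (val C e) ts)"
    by (simp add: list_all_iff)
  then have "val C (\<lambda>i. \<sigma> (e i)) (Fn f ts) = fun_int C f (map \<sigma> (map (val C e) ts))"
    by (simp only: val.simps)
  also have "\<dots> = \<sigma> (fun_int C f (map (val C e) ts))"
    using assms Fn.prems unfolding automorphism_def by fastforce
  finally show ?case by simp
qed simp

lemma automorphism_sat:
  assumes \<sigma>: "automorphism L C \<sigma>"
  shows "wf_fm L \<phi> \<Longrightarrow> sat UNIV C (\<lambda>i. \<sigma> (e i)) \<phi> = sat UNIV C e \<phi>"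
proof (induction \<phi> arbitrary: e)
  case (Eq s t)
  have "inj \<sigma>" using \<sigma> by (auto simp: automorphism_def bij_def)
  then show ?case using Eq by (simp add: automorphism_val[OF \<sigma>] inj_eq)
next
  case (Rel r ts)
  have "val C (\<lambda>i. \<sigma> (e i)) t = \<sigma> (val C e t)" if "t \<in> set ts" for t
    using automorphism_val[OF \<sigma>, of t e] Rel.prems that by (simp only: wf_fm.simps list_all_iff)
  then have "map (val C (\<lambda>i. \<sigma> (e i))) ts = map \<sigma> (map (val C e) ts)" by simp
  then have "sat UNIV C (\<lambda>i. \<sigma> (e i)) (Rel r ts) = rel_int C r (map \<sigma> (map (val C e) ts))"
    by (simp only: sat.simps)
  also have "\<dots> = rel_int C r (map (val C e) ts)"
    by (rule automorphism_rel[OF \<sigma>]) (use Rel.prems in simp)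
  finally show ?case by simp
next
  case (Exists i \<phi>)
  have "surj \<sigma>" using \<sigma> by (auto simp: automorphism_def bij_def)
  have "(\<exists>a. sat UNIV C ((\<lambda>j. \<sigma> (e j))(i := a)) \<phi>) = (\<exists>b. sat UNIV C ((\<lambda>j. \<sigma> (e j))(i := \<sigma> b)) \<phi>)"
    using \<open>surj \<sigma>\<close> by (metis surjD)
  also have "\<dots> = (\<exists>b. sat UNIV C (\<lambda>j. \<sigma> ((e(i := b)) j)) \<phi>)"
    by (intro arg_cong[where f = Ex] ext arg_cong[where f = "\<lambda>e. sat UNIV C e \<phi>"]) auto
  also have "\<dots> = (\<exists>b. sat UNIV C (e(i := b)) \<phi>)"
    using Exists.prems by (simp only: wf_fm.simps Exists.IH)
  finally show ?case by simp
qed simp_all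

lemma automorphism_holds:
  assumes "automorphism L C \<sigma>" "\<phi> \<in> formulas L (length xs)"
  shows "holds C \<phi> (map \<sigma> xs) = holds C \<phi> xs"
proof -
  have "sat UNIV C (\<lambda>i. map \<sigma> xs ! i) \<phi> = sat UNIV C (\<lambda>i. \<sigma> (xs ! i)) \<phi>"
    by (rule sat_cong) (use formulasD(2)[OF assms(2)] in auto)
  then show ?thesis
    unfolding holds_def using automorphism_sat[OF assms(1)] formulasD(1)[OF assms(2)] by simp
qed

lemma fixing_aut_map: "fixing_aut A \<sigma> \<Longrightarrow> set c \<subseteq> A \<Longrightarrow> map \<sigma> c = c"
  unfolding fixing_aut_def by (auto intro: map_idI)

lemma fixing_aut_defrel:
  assumes "fixing_aut A \<sigma>" "defrel A ls Q" "map length Es = ls"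
  shows "Q (map (map \<sigma>) Es) = Q Es"
proof -
  from assms(2) obtain c \<phi> where c: "set c \<subseteq> A" "\<phi> \<in> formulas L (sum_list ls + length c)"
    "\<And>Es. map length Es = ls \<Longrightarrow> Q Es = holds C \<phi> (concat Es @ c)" by (rule defrelE) blast
  have "map \<sigma> (concat Es @ c) = concat (map (map \<sigma>) Es) @ c"
    using fixing_aut_map[OF assms(1) c(1)] by (simp add: map_concat)
  moreover have "\<phi> \<in> formulas L (length (concat Es @ c))"
    using c(2) length_concat_blocks[OF assms(3)] by simp
  ultimately have "holds C \<phi> (concat (map (map \<sigma>) Es) @ c) = holds C \<phi> (concat Es @ c)"
    using automorphism_holds[of \<sigma> \<phi> "concat Es @ c"] assms(1) unfolding fixing_aut_def by metis
  moreover have "map length (map (map \<sigma>) Es) = ls" using assms(3) by (simp add: comp_def)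
  ultimately show ?thesis using c(3) assms(3) by metis
qed

lemma fixing_aut_mono: "fixing_aut B \<sigma> \<Longrightarrow> A \<subseteq> B \<Longrightarrow> fixing_aut A \<sigma>"
  unfolding fixing_aut_def by blast

definition eqtype :: "'a set \<Rightarrow> 'a list \<Rightarrow> 'a list \<Rightarrow> bool" where
  "eqtype A a b \<longleftrightarrow> length a = length b \<and> tp L C a A = tp L C b A"

lemma eqtype_length: "eqtype A a b \<Longrightarrow> length a = length b"
  by (simp add: eqtype_def)

lemma eqtype_refl [simp]: "eqtype A a a" and eqtype_sym: "eqtype A a b \<Longrightarrow> eqtype A b a"
  and eqtype_trans: "eqtype A a b \<Longrightarrow> eqtype A b c \<Longrightarrow> eqtype A a c"
  by (auto simp: eqtype_def)

lemma eqtype_defrel: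
  assumes "eqtype A (concat Es) (concat Fs)" "defrel A ls Q" "map length Es = ls" "map length Fs = ls"
  shows "Q Es = Q Fs"
proof -
  from assms(2) obtain c \<phi> where c: "set c \<subseteq> A" "\<phi> \<in> formulas L (sum_list ls + length c)"
    "\<And>Es. map length Es = ls \<Longrightarrow> Q Es = holds C \<phi> (concat Es @ c)" by (rule defrelE) blast
  note len = length_concat_blocks[OF assms(3)] length_concat_blocks[OF assms(4)]
  have "(\<phi>, c) \<in> tp L C (concat Es) A \<longleftrightarrow> (\<phi>, c) \<in> tp L C (concat Fs) A"
    using assms(1) by (simp add: eqtype_def)
  then show ?thesis using c assms(3,4) len by (simp add: tp_def)
qed

lemma eqtypeI:
  assumes "length a = length b" and "\<And>Q. defrel A [length a] Q \<Longrightarrow> Q [a] = Q [b]"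
  shows "eqtype A a b"
proof -
  have "holds C \<phi> (a @ c) = holds C \<phi> (b @ c)"
    if "\<phi> \<in> formulas L (length a + length c)" "set c \<subseteq> A" for \<phi> c
    using assms(2)[OF defrel_formula_params[of \<phi> "[length a]" c A]] that by simp
  then show ?thesis using assms(1) unfolding eqtype_def tp_def by auto
qed

lemma eqtype_mono:
  assumes "eqtype B a b" "A \<subseteq> B"
  shows "eqtype A a b"
proof (rule eqtypeI)
  show len: "length a = length b" by (rule eqtype_length[OF assms(1)])
  show "Q [a] = Q [b]" if "defrel A [length a] Q" for Q
    by (rule eqtype_defrel[of B _ _ "[length a]"]) (use assms that len defrel_mono in auto)
qed

lemma fixing_aut_eqtype: "fixing_aut A \<sigma> \<Longrightarrow> eqtype A a (map \<sigma> a)"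
  by (rule eqtypeI) (use fixing_aut_defrel[of A \<sigma> _ _ "[a]"] in auto)

lemma eqtype_take: 
  assumes "eqtype A (a @ c) (b @ d)" "length a = length b"
  shows "eqtype A a b"
proof (rule eqtypeI[OF assms(2)])
  fix Q assume Q: "defrel A [length a] Q"
  have "defrel A [length a, length c] (\<lambda>Es. Q (map ((!) Es) [0]))"
    by (rule defrel_reindex[OF Q]) auto
  from eqtype_defrel[of A "[a, c]" "[b, d]", OF _ this] assms eqtype_length[OF assms(1)]
  show "Q [a] = Q [b]" by simp
qed

end

context monster
begin

text \<open>Strong homogeneity is stated for elementary maps. The map that fixes \<open>A\<close> and sends \<open>a\<close> to \<open>b\<close> is
  well defined and elementary because the type over \<open>A\<close> contains the equalities between the entries
  of the tuple and between these entries and the elements of \<open>A\<close>.\<close>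

lemma eqtype_imp_aut:
  assumes ab: "eqtype A a b" and A: "small \<kappa> A"
  obtains \<sigma> where "fixing_aut A \<sigma>" "map \<sigma> a = b"
proof -
  define f where "f x = (if x \<in> A then x else b ! (SOME i. i < length a \<and> a ! i = x))" for x
  note len = eqtype_length[OF ab]
  have transfer: "holds C \<phi> (a @ c) = holds C \<phi> (b @ c)"
    if "\<phi> \<in> formulas L (length a + length c)" "set c \<subseteq> A" for \<phi> c
    using eqtype_defrel[of A "[a]" "[b]" "[length a]", OF _ defrel_formula_params] ab len that by simp
  have f: "f (a ! i) = b ! i" if i: "i < length a" for i
  proof (cases "a ! i \<in> A")
    case True
    have "holds C (Eq (Var i) (Var (length a))) (a @ [a ! i]) = holds C (Eq (Var i) (Var (length a))) (b @ [a ! i])"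
      by (rule transfer) (use i True in \<open>auto simp: formulas_def\<close>)
    then have "b ! i = a ! i" using i len by (simp add: holds_def nth_append)
    with True show ?thesis by (simp add: f_def)
  next
    case False
    define j where "j = (SOME j. j < length a \<and> a ! j = a ! i)"
    have j: "j < length a \<and> a ! j = a ! i" unfolding j_def by (rule someI[of _ i]) (use i in simp)
    have "holds C (Eq (Var i) (Var j)) (a @ []) = holds C (Eq (Var i) (Var j)) (b @ [])"
      by (rule transfer) (use i j in \<open>auto simp: formulas_def\<close>)
    then have "b ! i = b ! j" using j by (simp add: holds_def)
    with False show ?thesis by (simp add: f_def j_def)
  qed
  have "elementary_map L C (A \<union> set a) f"
    unfolding elementary_map_def
  proof (intro allI impI ballI)
    fix xs \<phi> assume xs: "set xs \<subseteq> A \<union> set a" and \<phi>: "\<phi> \<in> formulas L (length xs)"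
    define c where "c = filter (\<lambda>x. x \<in> A) xs"
    have "\<exists>p < length a + length c. (a @ c) ! p = x \<and> (b @ c) ! p = f x" if x: "x \<in> set xs" for x
    proof (cases "x \<in> A")
      case True
      then have "x \<in> set c" using x by (simp add: c_def)
      then obtain k where "k < length c" "c ! k = x" by (auto simp: in_set_conv_nth)
      then show ?thesis using True len by (intro exI[of _ "length a + k"]) (auto simp: nth_append f_def)
    next
      case False
      then have "x \<in> set a" using x xs by blast
      then obtain i where "i < length a" "a ! i = x" by (auto simp: in_set_conv_nth)
      then show ?thesis using f len by (intro exI[of _ i]) (auto simp: nth_append)
    qed
    then obtain p where p: "\<And>x. x \<in> set xs \<Longrightarrow> p x < length a + length c"
      "\<And>x. x \<in> set xs \<Longrightarrow> (a @ c) ! p x = x" "\<And>x. x \<in> set xs \<Longrightarrow> (b @ c) ! p x = f x" by metis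
    obtain \<psi> where \<psi>: "\<psi> \<in> formulas L (length a + length c)"
      "\<And>ys. holds C \<psi> ys = holds C \<phi> (map ((!) ys) (map p xs))"
      by (rule formula_reindex[OF \<phi>, of "map p xs" "length a + length c" C]) (use p(1) in auto)
    have "map ((!) (a @ c)) (map p xs) = xs"
      using p(2) by (simp add: comp_def map_idI)
    moreover have "map ((!) (b @ c)) (map p xs) = map f xs" using p(3) by simp
    moreover have "holds C \<psi> (a @ c) = holds C \<psi> (b @ c)"
      by (rule transfer[OF \<psi>(1)]) (auto simp: c_def)
    ultimately show "holds C \<phi> (map f xs) = holds C \<phi> xs" using \<psi>(2) by metis
  qed
  moreover have "small \<kappa> (A \<union> set a)" by (rule small_intros(1)[OF A small_intros(2)]) simp
  ultimately obtain \<sigma> where \<sigma>: "automorphism L C \<sigma>" "\<forall>x\<in>A \<union> set a. \<sigma> x = f x"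
    using homogeneous unfolding strongly_homogeneous_def by blast
  have "fixing_aut A \<sigma>" using \<sigma> by (auto simp: fixing_aut_def f_def)
  moreover have "map \<sigma> a = b"
    using \<sigma> f len by (intro nth_equalityI) auto
  ultimately show ?thesis by (rule that)
qed

end

section \<open>Coheirs\<close>

definition ultrafilter :: "'x set set \<Rightarrow> bool" where
  "ultrafilter U \<longleftrightarrow> UNIV \<in> U \<and> {} \<notin> U \<and> (\<forall>S\<in>U. \<forall>T\<in>U. S \<inter> T \<in> U) \<and>
    (\<forall>S\<in>U. \<forall>T. S \<subseteq> T \<longrightarrow> T \<in> U) \<and> (\<forall>S. S \<in> U \<or> - S \<in> U)"

lemma ultrafilterD:
  assumes "ultrafilter U"
  shows "{} \<notin> U" "S \<in> U \<Longrightarrow> T \<in> U \<Longrightarrow> S \<inter> T \<in> U" "S \<in> U \<Longrightarrow> S \<subseteq> T \<Longrightarrow> T \<in> U"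
    "- S \<in> U \<longleftrightarrow> S \<notin> U"
proof -
  show 1: "{} \<notin> U" "S \<in> U \<Longrightarrow> T \<in> U \<Longrightarrow> S \<inter> T \<in> U" "S \<in> U \<Longrightarrow> S \<subseteq> T \<Longrightarrow> T \<in> U" for S T
    using assms unfolding ultrafilter_def by blast+
  show "- S \<in> U \<longleftrightarrow> S \<notin> U"
    using assms 1(1) 1(2)[of S "- S"] unfolding ultrafilter_def by auto
qed

lemma ultrafilter_Inter: "ultrafilter U \<Longrightarrow> finite X \<Longrightarrow> X \<subseteq> U \<Longrightarrow> \<Inter> X \<in> U"
proof -
  assume U: "ultrafilter U"
  assume "finite X" "X \<subseteq> U"
  then show ?thesis
  proof (induction X rule: finite_induct)
    case empty
    then show ?case using U by (simp add: ultrafilter_def)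
  qed (auto intro: ultrafilterD[OF U])
qed

lemma ultrafilter_cong:
  assumes "ultrafilter U" "D \<in> U" "\<And>x. x \<in> D \<Longrightarrow> x \<in> S \<longleftrightarrow> x \<in> T"
  shows "S \<in> U \<longleftrightarrow> T \<in> U"
proof -
  have "T \<in> U" if "S \<in> U" "\<And>x. x \<in> D \<Longrightarrow> x \<in> S \<Longrightarrow> x \<in> T" for S T
    using ultrafilterD(3)[OF assms(1) ultrafilterD(2)[OF assms(1) that(1) assms(2)], of T] that(2) by blast
  from this[of S T] this[of T S] assms(3) show ?thesis by blast
qed

lemma ultrafilter_vimage:
  assumes "ultrafilter U"
  shows "ultrafilter {S. f -` S \<in> U}"
proof -
  have "f -` T \<in> U" if "f -` S \<in> U" "S \<subseteq> T" for S T
    using ultrafilterD(3)[OF assms that(1) vimage_mono[OF that(2)]] .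
  with assms show ?thesis unfolding ultrafilter_def by (simp add: vimage_Compl)
qed

lemma ultrafilter_exists:
  fixes F :: "'x set set"
  assumes F: "\<And>X. finite X \<Longrightarrow> X \<subseteq> F \<Longrightarrow> \<Inter> X \<noteq> {}"
  obtains U where "ultrafilter U" "F \<subseteq> U"
proof -
  define fip where "fip H \<longleftrightarrow> (\<forall>X. finite X \<and> X \<subseteq> H \<longrightarrow> \<Inter> X \<noteq> {})" for H :: "'x set set"
  have "\<exists>U\<in>{H. F \<subseteq> H \<and> fip H}. \<forall>X\<in>{H. F \<subseteq> H \<and> fip H}. U \<subseteq> X \<longrightarrow> X = U"
  proof (rule subset_Zorn_nonempty)
    show "{H. F \<subseteq> H \<and> fip H} \<noteq> {}" using F by (auto simp: fip_def)
    fix \<C> assume \<C>: "\<C> \<noteq> {}" "subset.chain {H. F \<subseteq> H \<and> fip H} \<C>"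
    then have H: "F \<subseteq> H" "fip H" if "H \<in> \<C>" for H
      using that unfolding subset_chain_def by auto
    have "\<Inter> X \<noteq> {}" if X: "finite X" "X \<subseteq> \<Union> \<C>" for X
    proof -
      from finite_subset_Union_chain[OF X \<C>] obtain H where "H \<in> \<C>" "X \<subseteq> H" .
      then show ?thesis using X(1) H(2)[of H] unfolding fip_def by simp
    qed
    then have "fip (\<Union> \<C>)" by (simp add: fip_def)
    moreover have "F \<subseteq> \<Union> \<C>" using \<C>(1) H(1) by fast
    ultimately show "\<Union> \<C> \<in> {H. F \<subseteq> H \<and> fip H}" by simp
  qed
  then obtain U where U: "F \<subseteq> U" "fip U"
    and max: "\<forall>X\<in>{H. F \<subseteq> H \<and> fip H}. U \<subseteq> X \<longrightarrow> X = U" by auto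
  have max: "H = U" if "U \<subseteq> H" "fip H" for H
    using bspec[OF max, of H] that U(1) by simp
  have add: "S \<in> U" if S: "\<And>X. finite X \<Longrightarrow> X \<subseteq> U \<Longrightarrow> \<Inter> X \<inter> S \<noteq> {}" for S
  proof -
    have "fip (insert S U)"
      unfolding fip_def
    proof (intro allI impI)
      fix X assume X: "finite X \<and> X \<subseteq> insert S U"
      have "\<Inter> (X - {S}) \<inter> S \<noteq> {}" by (rule S) (use X in auto)
      then show "\<Inter> X \<noteq> {}" by (cases "S \<in> X") (auto simp: insert_absorb)
    qed
    then have "insert S U = U" by (intro max) auto
    then show ?thesis by blast
  qed
  have Inter: "\<Inter> X \<in> U" if "finite X" "X \<subseteq> U" for X
  proof (rule add)
    fix Y assume Y: "finite Y" "Y \<subseteq> U"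
    have "\<Inter> (Y \<union> X) \<noteq> {}" using U(2) Y that by (auto simp: fip_def)
    then show "\<Inter> Y \<inter> \<Inter> X \<noteq> {}" by auto
  qed
  have meets: "S \<noteq> {}" if "S \<in> U" for S
    using U(2)[unfolded fip_def, rule_format, of "{S}"] that by simp
  have up: "T \<in> U" if "S \<in> U" "S \<subseteq> T" for S T
  proof (rule add)
    fix X assume X: "finite X" "X \<subseteq> U"
    have "\<Inter> (insert S X) \<in> U" using X that by (intro Inter) auto
    from meets[OF this] that show "\<Inter> X \<inter> T \<noteq> {}" by auto
  qed
  have "S \<in> U \<or> - S \<in> U" for S
  proof (rule ccontr)
    assume *: "\<not> (S \<in> U \<or> - S \<in> U)"
    then obtain X Y where XY: "finite X" "X \<subseteq> U" "\<Inter> X \<inter> S = {}" "finite Y" "Y \<subseteq> U" "\<Inter> Y \<inter> - S = {}"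
      using add[of S] add[of "- S"] by meson
    have "\<Inter> (X \<union> Y) \<noteq> {}" using XY by (intro meets Inter) auto
    with XY show False by blast
  qed
  moreover have "S \<inter> T \<in> U" if "S \<in> U" "T \<in> U" for S T using Inter[of "{S, T}"] that by simp
  moreover have "UNIV \<in> U" using Inter[of "{}"] by simp
  moreover have "{} \<notin> U" using meets by blast
  ultimately have "ultrafilter U" unfolding ultrafilter_def using up by simp
  then show ?thesis using U(1) by (rule that)
qed

context model
begin

definition tuples :: "'a set \<Rightarrow> nat \<Rightarrow> 'a list set" where
  "tuples M k = {x. length x = k \<and> set x \<subseteq> M}"

text \<open>\<open>c\<close> realises over \<open>B\<close> the global type of all definable sets that belong to \<open>U\<close>. When \<open>U\<close> lives on
  tuples from \<open>M\<close>, this global type is finitely satisfiable in \<open>M\<close>: it is a global coheir.\<close>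

definition realises :: "'a list set set \<Rightarrow> 'a set \<Rightarrow> 'a list \<Rightarrow> bool" where
  "realises U B c \<longleftrightarrow> (\<forall>Q. defrel B [length c] Q \<longrightarrow> (Q [c] \<longleftrightarrow> {x. Q [x]} \<in> U))"

lemma realises_mono: "realises U B c \<Longrightarrow> A \<subseteq> B \<Longrightarrow> realises U A c"
  unfolding realises_def by (blast intro: defrel_mono)

lemma realises_eqtype: 
  "realises U B c \<Longrightarrow> realises U B c' \<Longrightarrow> length c = length c' \<Longrightarrow> eqtype B c c'"
  by (rule eqtypeI) (auto simp: realises_def)

text \<open>By Tarski--Vaught, every definable set over \<open>M\<close> that contains \<open>a\<close> contains a tuple from \<open>M\<close>; so the
  traces of these sets on \<open>M\<close> have the finite intersection property.\<close>

lemma coheir_exists: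
  assumes M: "elementary_submodel L C M"
  obtains U where "ultrafilter U" "tuples M (length a) \<in> U"
    "\<forall>Q. defrel M [length a] Q \<and> Q [a] \<longrightarrow> {x. Q [x]} \<in> U"
proof -
  let ?k = "length a"
  let ?F = "{{x \<in> tuples M ?k. Q [x]} |Q. defrel M [?k] Q \<and> Q [a]}"
  have below: "\<exists>Q. defrel M [?k] Q \<and> Q [a] \<and> {x \<in> tuples M ?k. Q [x]} \<subseteq> \<Inter> X" if "finite X" "X \<subseteq> ?F" for X
    using that
  proof (induction X rule: finite_induct)
    case empty
    then show ?case using defrel_True by auto
  next
    case (insert S X)
    then obtain Q where Q: "defrel M [?k] Q" "Q [a]" "{x \<in> tuples M ?k. Q [x]} \<subseteq> \<Inter> X" by auto
    from insert.prems obtain P where P: "defrel M [?k] P" "P [a]" "S = {x \<in> tuples M ?k. P [x]}"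
      by auto
    have "{x \<in> tuples M ?k. P [x] \<and> Q [x]} \<subseteq> \<Inter> (insert S X)" using P(3) Q(3) by blast
    with P(2) Q(2) defrel_conj[OF P(1) Q(1)] show ?case by blast
  qed
  have nonempty: "{x \<in> tuples M ?k. Q [x]} \<noteq> {}" if Q: "defrel M [?k] Q" "Q [a]" for Q
  proof -
    obtain Es where "map length Es = [?k]" "set (concat Es) \<subseteq> M" "Q Es"
      using tarski_vaught[OF M Q(1), of "[a]"] Q(2) by force
    then obtain z where "set z \<subseteq> M" "length z = ?k" "Q [z]" by (auto simp: map_eq_Cons_conv)
    then have "z \<in> {x \<in> tuples M ?k. Q [x]}" by (simp add: tuples_def)
    then show ?thesis by blast
  qed
  have "\<Inter> X \<noteq> {}" if X: "finite X" "X \<subseteq> ?F" for X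
  proof -
    obtain Q where Q: "defrel M [?k] Q" "Q [a]" "{x \<in> tuples M ?k. Q [x]} \<subseteq> \<Inter> X"
      using below[OF X] by blast
    then show ?thesis using nonempty[OF Q(1,2)] by (metis subset_empty)
  qed
  then obtain U where U: "ultrafilter U" "?F \<subseteq> U" by (rule ultrafilter_exists)
  have in_U: "{x \<in> tuples M ?k. Q [x]} \<in> U" if "defrel M [?k] Q" "Q [a]" for Q
    using U(2) that by blast
  have "tuples M ?k \<in> U" using in_U[OF defrel_True] by simp
  moreover have "{x. Q [x]} \<in> U" if "defrel M [?k] Q" "Q [a]" for Q
    by (rule ultrafilterD(3)[OF U(1) in_U[OF that]]) auto
  ultimately show ?thesis using U(1) by (intro that) blast+
qed

text \<open>Finite satisfiability in \<open>M\<close> makes the type of \<open>c\<close> over \<open>b\<close> depend only on the type of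
  \<open>b\<close> over \<open>M\<close>, since the elements of the ultrafilter are tuples from \<open>M\<close>.\<close>

lemma coheir_invariant:
  assumes U: "ultrafilter U" "tuples M k \<in> U" and b: "eqtype M b b'"
    and c: "length c = k" "realises U (M \<union> set b) c"
    and c': "length c' = k" "realises U (M \<union> set b') c'"
  shows "eqtype M (b @ c) (b' @ c')"
proof (rule eqtypeI)
  note len = eqtype_length[OF b]
  show "length (b @ c) = length (b' @ c')" using len c c' by simp
  fix Q assume "defrel M [length (b @ c)] Q"
  then have Q: "defrel M [length b + k] Q" using c by simp
  have Q2: "defrel M [k, length b] (\<lambda>Es. Q [Es ! 1 @ Es ! 0])"
  proof -
    have "defrel M [length b, k] (\<lambda>Es. Q [concat Es])"
    proof (rule defrel_regroup[OF Q])
      show "\<exists>Es. map length Es = [length b + k] \<and> concat Es = concat Es' \<and> Q [concat Es'] = Q Es"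
        if "map length Es' = [length b, k]" for Es'
        using that by (intro exI[of _ "[concat Es']"]) (auto simp: map_eq_Cons_conv)
    qed simp
    then have "defrel M [k, length b] (\<lambda>Es. Q [concat (map ((!) Es) [1, 0])])"
      by (rule defrel_reindex) auto
    then show ?thesis by (rule defrel_cong) simp
  qed
  have *: "Q [d @ e] \<longleftrightarrow> {x. Q [d @ x]} \<in> U"
    if d: "length d = length b" and e: "length e = k" "realises U (M \<union> set d) e" for d e
  proof -
    have "defrel (M \<union> set d) ([k] @ [length b]) (\<lambda>Es. Q [Es ! 1 @ Es ! 0])"
      using Q2 by (auto intro: defrel_mono)
    then have "defrel (M \<union> set d) [k] (\<lambda>Es. Q [(Es @ [d]) ! 1 @ (Es @ [d]) ! 0])"
      by (rule defrel_param) (use d in auto)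
    then have "defrel (M \<union> set d) [k] (\<lambda>Es. Q [d @ Es ! 0])"
      by (rule defrel_cong) (auto simp: map_eq_Cons_conv)
    then show ?thesis using e unfolding realises_def by force
  qed
  have "{x. Q [b @ x]} \<in> U \<longleftrightarrow> {x. Q [b' @ x]} \<in> U"
  proof (rule ultrafilter_cong[OF U])
    fix x assume x: "x \<in> tuples M k"
    have "defrel M ([length b] @ [k]) (\<lambda>Es. Q [Es ! 0 @ Es ! 1])"
      using defrel_reindex[OF Q2, of "[length b, k]" "[1, 0]"] by simp
    then have "defrel M [length b] (\<lambda>Es. Q [(Es @ [x]) ! 0 @ (Es @ [x]) ! 1])"
      by (rule defrel_param) (use x in \<open>auto simp: tuples_def\<close>)
    from eqtype_defrel[of M "[b]" "[b']", OF _ this] b len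
    show "x \<in> {x. Q [b @ x]} \<longleftrightarrow> x \<in> {x. Q [b' @ x]}" by simp
  qed
  then show "Q [b @ c] = Q [b' @ c']" using *[of b c] *[of b' c'] c c' len by simp
qed

end

lemma (in monster) realisation_exists:
  assumes U: "ultrafilter U" "{x. length x = k} \<in> U" and B: "small \<kappa> B"
  obtains c where "length c = k" "realises U B c"
proof -
  let ?Q = "{Q. defrel B [k] Q \<and> {x. Q [x]} \<in> U}"
  have "\<exists>Es. map length Es = [k] \<and> (\<forall>Q\<in>?Q. Q Es)"
  proof (rule saturation[OF B])
    fix \<F> assume \<F>: "finite \<F>" "\<F> \<subseteq> ?Q"
    have "\<Inter> (insert {x. length x = k} ((\<lambda>Q. {x. Q [x]}) ` \<F>)) \<in> U"
      using \<F> U by (intro ultrafilter_Inter) auto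
    then have "\<Inter> (insert {x. length x = k} ((\<lambda>Q. {x. Q [x]}) ` \<F>)) \<noteq> {}"
      using ultrafilterD(1)[OF U(1)] by metis
    then obtain x where "length x = k" "\<forall>Q\<in>\<F>. Q [x]" by auto
    then show "\<exists>Es. map length Es = [k] \<and> (\<forall>Q\<in>\<F>. Q Es)" by (intro exI[of _ "[x]"]) auto
  qed simp
  then obtain c where c: "length c = k" "\<And>Q. defrel B [k] Q \<Longrightarrow> {x. Q [x]} \<in> U \<Longrightarrow> Q [c]"
    by (auto simp: map_eq_Cons_conv)
  have "\<not> Q [c]" if "defrel B [k] Q" "{x. Q [x]} \<notin> U" for Q
    using c(2)[OF defrel_not[OF that(1)]] ultrafilterD(4)[OF U(1), of "{x. Q [x]}"] that(2)
    by (simp add: Compl_eq)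
  then show ?thesis using c by (intro that[of c]) (auto simp: realises_def)
qed


section \<open>Alternation in NIP theories\<close>

context model
begin

text \<open>The VC bound, stated for indexed points: distinct indices of a shattered family belong to
  distinct points, because some set of the family separates them.\<close>

definition shatter_bound :: "('a list \<Rightarrow> 'a list \<Rightarrow> bool) \<Rightarrow> nat \<Rightarrow> nat \<Rightarrow> nat \<Rightarrow> bool" where
  "shatter_bound R k m d \<longleftrightarrow> (\<forall>I (x :: nat \<Rightarrow> 'a list). finite I \<longrightarrow> (\<forall>i\<in>I. length (x i) = k) \<longrightarrow>
     (\<forall>\<eta>. \<eta> \<subseteq> I \<longrightarrow> (\<exists>z. length z = m \<and> (\<forall>i\<in>I. R (x i) z \<longleftrightarrow> i \<in> \<eta>))) \<longrightarrow> card I \<le> d)"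

lemma nip_bound:
  assumes "NIP L C" "\<phi> \<in> formulas L (k + m)"
  shows "\<exists>d. shatter_bound (\<lambda>x z. holds C \<phi> (x @ z)) k m d"
proof -
  let ?F = "{{a. length a = k \<and> holds C \<phi> (a @ b)} |b. length b = m}"
  have "finite_VC_dim ?F" using assms(1)[unfolded NIP_def, rule_format, OF assms(2)] .
  then obtain d where d: "\<forall>A. finite A \<and> shatters ?F A \<longrightarrow> card A \<le> d"
    unfolding finite_VC_dim_def by (rule exE)
  have "card I \<le> d"
    if I: "finite I" "\<forall>i\<in>I. length (x i) = k"
      "\<forall>\<eta>. \<eta> \<subseteq> I \<longrightarrow> (\<exists>z. length z = m \<and> (\<forall>i\<in>I. holds C \<phi> (x i @ z) \<longleftrightarrow> i \<in> \<eta>))"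
    for I and x :: "nat \<Rightarrow> 'a list"
  proof -
    have "inj_on x I"
    proof (rule inj_onI)
      fix i j assume ij: "i \<in> I" "j \<in> I" "x i = x j"
      obtain z where "\<forall>i'\<in>I. holds C \<phi> (x i' @ z) \<longleftrightarrow> i' \<in> {i}"
        using I(3)[rule_format, of "{i}"] ij by auto
      with ij show "i = j" by (metis singletonD singletonI)
    qed
    moreover have "shatters ?F (x ` I)"
      unfolding shatters_def
    proof (intro allI impI)
      fix B assume B: "B \<subseteq> x ` I"
      obtain z where z: "length z = m" "\<And>i. i \<in> I \<Longrightarrow> holds C \<phi> (x i @ z) \<longleftrightarrow> x i \<in> B"
        using I(3)[rule_format, of "{i \<in> I. x i \<in> B}"] by auto
      have "{a. length a = k \<and> holds C \<phi> (a @ z)} \<inter> x ` I = B"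
        using z(2) I(2) B by auto
      with z(1) show "\<exists>S\<in>?F. S \<inter> x ` I = B" by blast
    qed
    ultimately show ?thesis using d[rule_format, of "x ` I"] I(1) by (simp add: card_image)
  qed
  then show ?thesis unfolding shatter_bound_def by (intro exI[of _ d]) blast
qed

lemma nip_bound_swapped:
  assumes "NIP L C" "\<phi> \<in> formulas L (m + k)"
  shows "\<exists>d. shatter_bound (\<lambda>x z. holds C \<phi> (z @ x)) k m d"
proof -
  obtain \<psi> where \<psi>: "\<psi> \<in> formulas L (k + m)"
    "\<And>xs. holds C \<psi> xs = holds C \<phi> (map ((!) xs) ([k..<k + m] @ [0..<k]))"
    by (rule formula_reindex[OF assms(2), of "[k..<k + m] @ [0..<k]" "k + m" C]) auto
  have swap: "holds C \<psi> (y @ z) = holds C \<phi> (z @ y)" if "length y = k" "length z = m" for y z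
    using \<psi>(2)[of "y @ z"] map_nth_upt_append[of y z] map_nth_upt[of k "y @ z"] that by simp
  obtain d where "shatter_bound (\<lambda>x z. holds C \<psi> (x @ z)) k m d" using nip_bound[OF assms(1) \<psi>(1)] ..
  then have "shatter_bound (\<lambda>x z. holds C \<phi> (z @ x)) k m d"
    unfolding shatter_bound_def by (simp add: swap cong: conj_cong)
  then show ?thesis ..
qed

end

lemma (in monster) eqtype_blocks_aut:
  assumes "eqtype A (concat Es) (concat Fs)" "map length Es = map length Fs" "small \<kappa> A"
  obtains \<sigma> where "fixing_aut A \<sigma>" "map (map \<sigma>) Es = Fs"
proof -
  from eqtype_imp_aut[OF assms(1,3)] obtain \<sigma> where
    \<sigma>: "fixing_aut A \<sigma>" "map \<sigma> (concat Es) = concat Fs" by blast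
  have "map (map \<sigma>) Es = Fs"
    by (rule concat_blocks_inject) (use \<sigma> assms(2) in \<open>auto simp: map_concat comp_def\<close>)
  with \<sigma>(1) show ?thesis by (rule that)
qed

context model
begin

definition morley :: "'a list set set \<Rightarrow> 'a set \<Rightarrow> nat \<Rightarrow> (nat \<Rightarrow> 'a list) \<Rightarrow> bool" where
  "morley U M k q \<longleftrightarrow> (\<forall>r. length (q r) = k \<and> realises U (M \<union> \<Union> (set ` q ` {..<r})) (q r))"

text \<open>By \<open>coheir_invariant\<close>, the type over \<open>M\<close> of an initial segment determines that of the next one,
  whichever later member of the sequence is appended.\<close>

lemma morley_indiscernible:
  assumes U: "ultrafilter U" "tuples M k \<in> U" and q: "morley U M k q"
    and h: "\<And>i j. i < j \<Longrightarrow> j < N \<Longrightarrow> h i < h j"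
  shows "eqtype M (concat (map (\<lambda>i. q (h i)) [0..<N])) (concat (map q [0..<N]))"
  using h
proof (induction N)
  case (Suc N)
  let ?b = "concat (map (\<lambda>i. q (h i)) [0..<N])" and ?b' = "concat (map q [0..<N])"
  have "eqtype M (?b @ q (h N)) (?b' @ q N)"
  proof (rule coheir_invariant[OF U])
    show "eqtype M ?b ?b'" using Suc by simp
    show "length (q (h N)) = k" "length (q N) = k" using q by (auto simp: morley_def)
    show "realises U (M \<union> set ?b) (q (h N))"
      by (rule realises_mono[of U "M \<union> \<Union> (set ` q ` {..<h N})"])
        (use q Suc.prems in \<open>auto simp: morley_def\<close>)
    show "realises U (M \<union> set ?b') (q N)"
      by (rule realises_mono[of U "M \<union> \<Union> (set ` q ` {..<N})"]) (use q in \<open>auto simp: morley_def\<close>)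
  qed
  then show ?case by simp
qed simp

end

context monster
begin

text \<open>Along an indiscernible sequence, choosing one point of each consecutive pair realises every
  pattern of alternation by a copy of the initial segment. So a tuple that distinguishes the members
  of many pairs would shatter a long initial segment.\<close>

lemma morley_alternation:
  assumes nip: "NIP L C" and U: "ultrafilter U" "tuples M k \<in> U" and M: "small \<kappa> M"
    and q: "morley U M k q" and \<Psi>: "finite \<Psi>" "\<Psi> \<subseteq> formulas L (k + m)"
  shows "\<exists>N. \<forall>z. length z = m \<longrightarrow>
    (\<exists>i<N. \<forall>\<psi>\<in>\<Psi>. holds C \<psi> (q (2 * i) @ z) = holds C \<psi> (q (2 * i + 1) @ z))"
proof -
  have lenq: "length (q r) = k" for r using q by (simp add: morley_def)
  have "\<forall>\<psi>\<in>\<Psi>. \<exists>d. shatter_bound (\<lambda>x z. holds C \<psi> (x @ z)) k m d"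
    using nip_bound[OF nip] \<Psi>(2) by blast
  from bchoice[OF this] obtain d where
    d: "\<forall>\<psi>\<in>\<Psi>. shatter_bound (\<lambda>x z. holds C \<psi> (x @ z)) k m (d \<psi>)" ..
  define D where "D = sum d \<Psi>"
  define N where "N = card \<Psi> * D + 1"
  have "\<exists>i<N. \<forall>\<psi>\<in>\<Psi>. holds C \<psi> (q (2 * i) @ z) = holds C \<psi> (q (2 * i + 1) @ z)"
    if z: "length z = m" for z
  proof (rule ccontr)
    assume "\<not> ?thesis"
    then have "\<forall>i. \<exists>\<psi>. i < N \<longrightarrow> \<psi> \<in> \<Psi> \<and> holds C \<psi> (q (2 * i) @ z) \<noteq> holds C \<psi> (q (2 * i + 1) @ z)"
      by blast
    then obtain f where f: "\<And>i. i < N \<Longrightarrow> f i \<in> \<Psi>"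
      "\<And>i. i < N \<Longrightarrow> holds C (f i) (q (2 * i) @ z) \<noteq> holds C (f i) (q (2 * i + 1) @ z)" by metis
    define I where "I \<psi> = {i. i < N \<and> f i = \<psi>}" for \<psi>
    have small_class: "card (I \<psi>) \<le> D" if \<psi>: "\<psi> \<in> \<Psi>" for \<psi>
    proof -
      have fin: "finite (I \<psi>)" by (simp add: I_def)
      define e where "e = (!) (sorted_list_of_set (I \<psi>))"
      have e: "e j \<in> I \<psi>" if "j < card (I \<psi>)" for j
        unfolding e_def using nth_mem[of j "sorted_list_of_set (I \<psi>)"] that fin by simp
      have mono: "e i < e j" if "i < j" "j < card (I \<psi>)" for i j
        unfolding e_def using that fin strict_sorted_list_of_set[of "I \<psi>"]
        by (auto intro: sorted_wrt_nth_less)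
      have "\<exists>z. length z = m \<and> (\<forall>i\<in>{..<card (I \<psi>)}. holds C \<psi> (q i @ z) \<longleftrightarrow> i \<in> \<eta>)" for \<eta>
      proof -
        define h where "h j = (if holds C \<psi> (q (2 * e j) @ z) \<longleftrightarrow> j \<in> \<eta> then 2 * e j else 2 * e j + 1)" for j
        have h: "holds C \<psi> (q (h j) @ z) \<longleftrightarrow> j \<in> \<eta>" if "j < card (I \<psi>)" for j
          using f(2)[of "e j"] e[OF that] by (auto simp: h_def I_def)
        let ?l = "[0..<card (I \<psi>)]"
        have "eqtype M (concat (map (\<lambda>j. q (h j)) ?l)) (concat (map q ?l))"
          by (rule morley_indiscernible[OF U q]) (use mono in \<open>fastforce simp: h_def\<close>)
        then obtain \<sigma> where \<sigma>: "fixing_aut M \<sigma>" "map (map \<sigma>) (map (\<lambda>j. q (h j)) ?l) = map q ?l"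
          by (rule eqtype_blocks_aut) (auto simp: lenq M)
        have "holds C \<psi> (q j @ map \<sigma> z) \<longleftrightarrow> j \<in> \<eta>" if j: "j < card (I \<psi>)" for j
        proof -
          have "map \<sigma> (q (h j)) = q j" using \<sigma>(2) j by (simp add: comp_def)
          then have "holds C \<psi> (q j @ map \<sigma> z) = holds C \<psi> (map \<sigma> (q (h j) @ z))" by simp
          also have "\<dots> = holds C \<psi> (q (h j) @ z)"
            by (rule automorphism_holds) (use \<sigma>(1) \<psi> \<Psi>(2) lenq z in \<open>auto simp: fixing_aut_def\<close>)
          finally show ?thesis using h[OF j] by simp
        qed
        then show ?thesis using z by (intro exI[of _ "map \<sigma> z"]) auto
      qed
      then have "card {..<card (I \<psi>)} \<le> d \<psi>"
        using bspec[OF d \<psi>, unfolded shatter_bound_def, THEN spec, THEN spec, of "{..<card (I \<psi>)}" q] lenq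
        by simp
      then have "card (I \<psi>) \<le> d \<psi>" by simp
      also have "d \<psi> \<le> D" unfolding D_def using \<psi> \<Psi>(1) by (intro member_le_sum) auto
      finally show ?thesis .
    qed
    have "N = card (\<Union>\<psi>\<in>\<Psi>. I \<psi>)"
    proof -
      have "{..<N} = (\<Union>\<psi>\<in>\<Psi>. I \<psi>)" using f(1) by (auto simp: I_def)
      then show ?thesis by (metis card_lessThan)
    qed
    also have "\<dots> \<le> (\<Sum>\<psi>\<in>\<Psi>. card (I \<psi>))" by (rule card_UN_le[OF \<Psi>(1)])
    also have "\<dots> \<le> card \<Psi> * D" using small_class sum_bounded_above[of \<Psi> "\<lambda>\<psi>. card (I \<psi>)" D] by simp
    finally show False by (simp add: N_def)
  qed
  then show ?thesis by blast
qed

lemma coheir_sequence: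
  assumes W: "\<And>t. ultrafilter (W t)" "\<And>t. {x. length x = l t} \<in> W t" and M: "small \<kappa> M"
  shows "\<exists>s. \<forall>t::nat. length (s t) = l t \<and> realises (W t) (M \<union> \<Union> (set ` s ` {..<t})) (s t)"
proof -
  let ?P = "\<lambda>s t c. length c = l t \<and> realises (W t) (M \<union> \<Union> (set ` s ` {..<t})) c"
  show ?thesis
  proof (rule dependent_wellorder_choice)
    fix r and f g :: "nat \<Rightarrow> 'a list" and t
    assume "\<And>y. y < t \<Longrightarrow> f y = g y"
    then have "f ` {..<t} = g ` {..<t}" by (intro image_cong) auto
    then show "?P f t r = ?P g t r" by simp
  next
    fix t and f :: "nat \<Rightarrow> 'a list"
    have "small \<kappa> (M \<union> \<Union> (set ` f ` {..<t}))"
      by (rule small_intros(1)[OF M small_intros(2)]) auto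
    from realisation_exists[OF W[of t] this] show "\<exists>c. ?P f t c" by metis
  qed
qed

end

context model
begin

text \<open>Iterating \<open>coheir_invariant\<close>: what is realised later does not distinguish earlier tuples of the
  same type over \<open>M\<close>.\<close>

lemma coheir_tail_invariant:
  assumes W: "\<And>t. ultrafilter (W t)" "\<And>t. tuples M (l t) \<in> W t"
    and s: "\<And>t. length (s t) = l t" "\<And>t. realises (W t) (M \<union> \<Union> (set ` s ` {..<t})) (s t)"
    and b: "eqtype M b b'" "set b \<subseteq> \<Union> (set ` s ` {..<t})" "set b' \<subseteq> \<Union> (set ` s ` {..<t})"
  shows "eqtype M (b @ concat (map s [t..<t + r])) (b' @ concat (map s [t..<t + r]))"
proof (induction r)
  case 0
  then show ?case using b by simp
next
  case (Suc r)
  let ?c = "concat (map s [t..<t + r])"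
  have sub: "\<Union> (set ` s ` {..<t}) \<union> set ?c \<subseteq> \<Union> (set ` s ` {..<t + r})" by force
  have "eqtype M ((b @ ?c) @ s (t + r)) ((b' @ ?c) @ s (t + r))"
  proof (rule coheir_invariant[OF W Suc])
    show "realises (W (t + r)) (M \<union> set (b @ ?c)) (s (t + r))"
      "realises (W (t + r)) (M \<union> set (b' @ ?c)) (s (t + r))"
      using b(2,3) sub by (auto intro!: realises_mono[OF s(2)])
  qed (simp_all add: s)
  then show ?case by simp
qed

lemma realises_prefix:
  assumes "realises U B w" "length w = k + k'"
  shows "realises {S. take k -` S \<in> U} B (take k w)"
  unfolding realises_def
proof (intro allI impI)
  fix Q assume "defrel B [length (take k w)] Q"
  then have "defrel B [k] Q" using assms(2) by simp
  then have "defrel B [k, k'] (\<lambda>Es. Q (map ((!) Es) [0]))" by (rule defrel_reindex) auto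
  then have "defrel B [k + k'] (\<lambda>Es. Q [take k (Es ! 0)])"
  proof (rule defrel_regroup)
    fix Es' :: "'a list list" assume "map length Es' = [k + k']"
    then obtain w where w: "Es' = [w]" "length w = k + k'" by (auto simp: map_eq_Cons_conv)
    then show "\<exists>Es. map length Es = [k, k'] \<and> concat Es = concat Es' \<and>
      Q [take k (Es' ! 0)] = Q (map ((!) Es) [0])"
      by (intro exI[of _ "[take k w, drop k w]"]) auto
  qed simp
  then have "defrel B [length w] (\<lambda>Es. Q [take k (Es ! 0)])" using assms(2) by simp
  with assms(1) have "Q [take k ([w] ! 0)] \<longleftrightarrow> {x. Q [take k ([x] ! 0)]} \<in> U"
    unfolding realises_def by blast
  then show "Q [take k w] \<longleftrightarrow> {x. Q [x]} \<in> {S. take k -` S \<in> U}" by (simp add: vimage_def)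
qed

end


section \<open>Pairs of the same type inside a model\<close>

context model
begin

text \<open>In terms of colourings: the colour that \<open>z\<close> gives to \<open>x\<close> is the set of those \<open>\<psi>\<in>\<Psi>\<close> that hold of
  \<open>x\<close> and \<open>z\<close>, so there are at most \<open>2^card \<Psi>\<close> colours.\<close>

definition separates :: "('f, 'r) fm set \<Rightarrow> 'a list \<Rightarrow> 'a list \<Rightarrow> 'a list \<Rightarrow> bool" where
  "separates \<Psi> z x y \<longleftrightarrow> (\<exists>\<psi>\<in>\<Psi>. holds C \<psi> (x @ z) \<noteq> holds C \<psi> (y @ z))"

text \<open>The relation \<open>\<rho>\<close> is viewed as a graph. A set \<open>P\<close> of pairs is forced if a finite set \<open>E\<close> of edges
  has the property that each \<open>z\<close> colouring \<open>E\<close> properly separates a pair of \<open>P\<close>. That the empty set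
  is forced means that some finite set of edges cannot be coloured properly by any \<open>z\<close>.\<close>

definition forced ::
  "('f, 'r) fm set \<Rightarrow> nat \<Rightarrow> nat \<Rightarrow> ('a list list \<Rightarrow> bool) \<Rightarrow> ('a list \<times> 'a list) set \<Rightarrow> bool" where
  "forced \<Psi> k m \<rho> P \<longleftrightarrow> (\<exists>E. finite E \<and> (\<forall>x y. (x, y) \<in> E \<longrightarrow> length x = k \<and> length y = k \<and> \<rho> [x, y]) \<and>
     (\<forall>z. length z = m \<longrightarrow> (\<forall>x y. (x, y) \<in> E \<longrightarrow> separates \<Psi> z x y) \<longrightarrow> (\<exists>x y. (x, y) \<in> P \<and> separates \<Psi> z x y)))"

lemma forcedI:
  assumes "finite E" "\<And>x y. (x, y) \<in> E \<Longrightarrow> length x = k \<and> length y = k \<and> \<rho> [x, y]"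
    "\<And>z. length z = m \<Longrightarrow> (\<And>x y. (x, y) \<in> E \<Longrightarrow> separates \<Psi> z x y) \<Longrightarrow>
      \<exists>x y. (x, y) \<in> P \<and> separates \<Psi> z x y"
  shows "forced \<Psi> k m \<rho> P"
  unfolding forced_def using assms by (intro exI[of _ E]) simp

lemma separates_aut:
  assumes "automorphism L C \<sigma>" "\<Psi> \<subseteq> formulas L (k + m)" "length z = m" "length x = k" "length y = k"
  shows "separates \<Psi> (map \<sigma> z) (map \<sigma> x) (map \<sigma> y) = separates \<Psi> z x y"
proof -
  have "holds C \<psi> (map \<sigma> x @ map \<sigma> z) = holds C \<psi> (x @ z)" if "length x = k" "\<psi> \<in> \<Psi>" for x \<psi>
    using automorphism_holds[OF assms(1), of \<psi> "x @ z"] assms(2,3) that by auto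
  then show ?thesis unfolding separates_def using assms(4,5) by auto
qed

lemma forced_aut:
  assumes \<sigma>: "fixing_aut M \<sigma>" and \<rho>: "defrel M [k, k] \<rho>" and \<Psi>: "\<Psi> \<subseteq> formulas L (k + m)"
    and P: "\<And>x y. (x, y) \<in> P \<Longrightarrow> length x = k \<and> length y = k" and "forced \<Psi> k m \<rho> P"
  shows "forced \<Psi> k m \<rho> ((\<lambda>(x, y). (map \<sigma> x, map \<sigma> y)) ` P)"
proof -
  have aut: "automorphism L C \<sigma>" using \<sigma> by (simp add: fixing_aut_def)
  then have bij: "bij \<sigma>" by (simp add: automorphism_def)
  let ?f = "\<lambda>(x, y). (map \<sigma> x, map \<sigma> y)"
  from assms(5) obtain E where "finite E"
    "\<forall>x y. (x, y) \<in> E \<longrightarrow> length x = k \<and> length y = k \<and> \<rho> [x, y]"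
    "\<forall>z. length z = m \<longrightarrow> (\<forall>x y. (x, y) \<in> E \<longrightarrow> separates \<Psi> z x y) \<longrightarrow>
      (\<exists>x y. (x, y) \<in> P \<and> separates \<Psi> z x y)"
    unfolding forced_def by (elim exE conjE)
  then have E: "finite E"
    "\<And>x y. (x, y) \<in> E \<Longrightarrow> length x = k \<and> length y = k \<and> \<rho> [x, y]"
    "\<And>z. length z = m \<Longrightarrow> (\<And>x y. (x, y) \<in> E \<Longrightarrow> separates \<Psi> z x y) \<Longrightarrow>
      \<exists>x y. (x, y) \<in> P \<and> separates \<Psi> z x y" by (simp, blast, blast)
  show ?thesis
  proof (rule forcedI)
    show "finite (?f ` E)" using E(1) by simp
    fix u v assume "(u, v) \<in> ?f ` E"
    then obtain x y where xy: "(x, y) \<in> E" "u = map \<sigma> x" "v = map \<sigma> y" by auto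
    have "\<rho> (map (map \<sigma>) [x, y]) = \<rho> [x, y]"
      by (rule fixing_aut_defrel[OF \<sigma> \<rho>]) (use E(2)[OF xy(1)] in simp)
    with E(2)[OF xy(1)] xy show "length u = k \<and> length v = k \<and> \<rho> [u, v]" by simp
  next
    fix z assume z: "length z = m" "\<And>x y. (x, y) \<in> ?f ` E \<Longrightarrow> separates \<Psi> z x y"
    define w where "w = map (inv_into UNIV \<sigma>) z"
    have w: "length w = m" "map \<sigma> w = z"
      using z(1) bij by (auto simp: w_def comp_def bij_def surj_f_inv_f intro: map_idI)
    have "\<exists>x y. (x, y) \<in> P \<and> separates \<Psi> w x y"
    proof (rule E(3)[OF w(1)])
      fix x y assume xy: "(x, y) \<in> E"
      then have "(map \<sigma> x, map \<sigma> y) \<in> ?f ` E" by force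
      then have "separates \<Psi> (map \<sigma> w) (map \<sigma> x) (map \<sigma> y)" using z(2) w(2) by simp
      then show "separates \<Psi> w x y" using separates_aut[OF aut \<Psi> w(1)] E(2)[OF xy] by simp
    qed
    then obtain x y where xy: "(x, y) \<in> P" "separates \<Psi> w x y" by auto
    have "separates \<Psi> z (map \<sigma> x) (map \<sigma> y)"
      using separates_aut[OF aut \<Psi> w(1)] P[OF xy(1)] xy(2) w(2) by simp
    moreover have "(map \<sigma> x, map \<sigma> y) \<in> ?f ` P" using xy(1) by force
    ultimately show "\<exists>x y. (x, y) \<in> ?f ` P \<and> separates \<Psi> z x y" by blast
  qed
qed

lemma forced_finite_combination:
  assumes "finite J" and "\<And>j. j \<in> J \<Longrightarrow> forced \<Psi> k m \<rho> (P j)"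
    and "\<And>z. length z = m \<Longrightarrow> (\<And>j. j \<in> J \<Longrightarrow> \<exists>x y. (x, y) \<in> P j \<and> separates \<Psi> z x y) \<Longrightarrow>
      \<exists>x y. (x, y) \<in> P' \<and> separates \<Psi> z x y"
  shows "forced \<Psi> k m \<rho> P'"
proof -
  define good where "good j E \<longleftrightarrow> finite E \<and>
      (\<forall>x y. (x, y) \<in> E \<longrightarrow> length x = k \<and> length y = k \<and> \<rho> [x, y]) \<and>
      (\<forall>z. length z = m \<longrightarrow> (\<forall>x y. (x, y) \<in> E \<longrightarrow> separates \<Psi> z x y) \<longrightarrow>
        (\<exists>x y. (x, y) \<in> P j \<and> separates \<Psi> z x y))" for j E
  have "\<forall>j\<in>J. \<exists>E. good j E" using assms(2) unfolding forced_def good_def by simp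
  from bchoice[OF this] obtain E where E: "\<And>j. j \<in> J \<Longrightarrow> good j (E j)" by blast
  show ?thesis
  proof (rule forcedI[of "\<Union> (E ` J)"])
    show "finite (\<Union> (E ` J))" using E assms(1) by (simp add: good_def)
    show "length x = k \<and> length y = k \<and> \<rho> [x, y]" if "(x, y) \<in> \<Union> (E ` J)" for x y
      using E that unfolding good_def by blast
    fix z assume z: "length z = m" "\<And>x y. (x, y) \<in> \<Union> (E ` J) \<Longrightarrow> separates \<Psi> z x y"
    show "\<exists>x y. (x, y) \<in> P' \<and> separates \<Psi> z x y"
    proof (rule assms(3)[OF z(1)])
      fix j assume j: "j \<in> J"
      then have "\<forall>x y. (x, y) \<in> E j \<longrightarrow> separates \<Psi> z x y" using z(2) by blast
      with E[OF j] z(1) show "\<exists>x y. (x, y) \<in> P j \<and> separates \<Psi> z x y"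
        unfolding good_def by simp
    qed
  qed
qed

text \<open>By elementarity a finite set of edges without a proper colouring can be found inside \<open>M\<close>, and then
  \<open>d\<close> does not colour it properly either.\<close>

lemma forced_empty_inconsistent:
  assumes M: "elementary_submodel L C M" and \<rho>: "defrel M [k, k] \<rho>"
    and \<Psi>: "finite \<Psi>" "\<Psi> \<subseteq> formulas L (k + m)" and "forced \<Psi> k m \<rho> {}" and d: "length d = m"
  shows "\<exists>a\<in>tuples M k. \<exists>b\<in>tuples M k. \<rho> [a, b] \<and> \<not> separates \<Psi> d a b"
proof -
  from assms(5) obtain E where "finite E"
    "\<forall>x y. (x, y) \<in> E \<longrightarrow> length x = k \<and> length y = k \<and> \<rho> [x, y]"
    "\<forall>z. length z = m \<longrightarrow> (\<forall>x y. (x, y) \<in> E \<longrightarrow> separates \<Psi> z x y) \<longrightarrow>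
      (\<exists>x y. (x, y) \<in> {} \<and> separates \<Psi> z x y)"
    unfolding forced_def by (elim exE conjE)
  then have E: "finite E"
    "\<And>x y. (x, y) \<in> E \<Longrightarrow> length x = k \<and> length y = k \<and> \<rho> [x, y]"
    "\<And>z. length z = m \<Longrightarrow> (\<And>x y. (x, y) \<in> E \<Longrightarrow> separates \<Psi> z x y) \<Longrightarrow>
      \<exists>x y. (x, y) \<in> {} \<and> separates \<Psi> z x y" by (simp, blast, blast)
  from finite_list[OF E(1)] obtain es where es: "set es = E" by blast
  define N where "N = length es"
  let ?ls = "replicate (2 * N) k"
  define R where "R = (\<lambda>Es. (\<forall>i\<in>{..<N}. \<rho> [Es ! (2 * i), Es ! (2 * i + 1)]) \<and>
    \<not> (\<exists>z. length z = m \<and> (\<forall>i\<in>{..<N}. separates \<Psi> z (Es ! (2 * i)) (Es ! (2 * i + 1)))))"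
  have R: "defrel M ?ls R"
    unfolding R_def
  proof (intro defrel_conj defrel_not defrel_Ball)
    show "defrel M ?ls (\<lambda>Es. \<rho> [Es ! (2 * i), Es ! (2 * i + 1)])" if "i \<in> {..<N}" for i
      using defrel_reindex[OF \<rho>, of ?ls "[2 * i, 2 * i + 1]"] that by simp
    have "defrel M (?ls @ [m]) (\<lambda>Fs. \<forall>i\<in>{..<N}. \<exists>\<psi>\<in>\<Psi>. \<not> (
        holds C \<psi> (concat (map ((!) Fs) [2 * i, 2 * N])) \<longleftrightarrow>
        holds C \<psi> (concat (map ((!) Fs) [2 * i + 1, 2 * N]))))"
    proof (intro defrel_Ball defrel_Bex defrel_not defrel_iff \<Psi>(1))
      fix i \<psi> assume i: "i \<in> {..<N}" and "\<psi> \<in> \<Psi>"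
      then have \<psi>: "\<psi> \<in> formulas L (sum_list [k, m])" using \<Psi>(2) by auto
      show "defrel M (?ls @ [m]) (\<lambda>Fs. holds C \<psi> (concat (map ((!) Fs) [2 * i, 2 * N])))"
        by (rule defrel_reindex[OF defrel_formula[OF \<psi>]]) (use i in \<open>auto simp: nth_append\<close>)
      show "defrel M (?ls @ [m]) (\<lambda>Fs. holds C \<psi> (concat (map ((!) Fs) [2 * i + 1, 2 * N])))"
        by (rule defrel_reindex[OF defrel_formula[OF \<psi>]]) (use i in \<open>auto simp: nth_append\<close>)
    qed simp
    from defrel_ex[OF this]
    show "defrel M ?ls (\<lambda>Es. \<exists>z. length z = m \<and> (\<forall>i\<in>{..<N}. separates \<Psi> z (Es ! (2 * i)) (Es ! (2 * i + 1))))"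
    proof (rule defrel_cong)
      fix Es :: "'a list list" assume "map length Es = ?ls"
      then have len: "length Es = 2 * N" by (metis length_map length_replicate)
      then show "(\<exists>z. length z = m \<and> (\<forall>i\<in>{..<N}. separates \<Psi> z (Es ! (2 * i)) (Es ! (2 * i + 1)))) \<longleftrightarrow>
        (\<exists>z. length z = m \<and> (\<forall>i\<in>{..<N}. \<exists>\<psi>\<in>\<Psi>. \<not> (
        holds C \<psi> (concat (map ((!) (Es @ [z])) [2 * i, 2 * N])) \<longleftrightarrow>
        holds C \<psi> (concat (map ((!) (Es @ [z])) [2 * i + 1, 2 * N])))))"
        by (auto simp: separates_def nth_append)
    qed
  qed simp
  define Es where "Es = map (\<lambda>r. (if even r then fst else snd) (es ! (r div 2))) [0..<2 * N]"
  have Es: "Es ! (2 * i) = fst (es ! i)" "Es ! (2 * i + 1) = snd (es ! i)" if "i < N" for i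
    using that by (auto simp: Es_def)
  have edge: "es ! i \<in> E" if "i < N" for i using that es nth_mem[of i es] by (simp add: N_def)
  have "map length Es = ?ls"
  proof (rule nth_equalityI)
    fix r assume "r < length (map length Es)"
    then have r: "r < 2 * N" by (simp add: Es_def)
    then have "es ! (r div 2) \<in> E" by (intro edge) auto
    then show "map length Es ! r = ?ls ! r"
      using E(2)[of "fst (es ! (r div 2))" "snd (es ! (r div 2))"] r by (simp add: Es_def)
  qed (simp add: Es_def)
  moreover have "R Es"
    unfolding R_def
  proof (intro conjI ballI notI)
    fix i assume "i \<in> {..<N}"
    then show "\<rho> [Es ! (2 * i), Es ! (2 * i + 1)]"
      using E(2)[of "fst (es ! i)" "snd (es ! i)"] edge Es by simp
  next
    assume "\<exists>z. length z = m \<and> (\<forall>i\<in>{..<N}. separates \<Psi> z (Es ! (2 * i)) (Es ! (2 * i + 1)))"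
    then obtain z where z: "length z = m" "\<And>i. i < N \<Longrightarrow> separates \<Psi> z (fst (es ! i)) (snd (es ! i))"
      using Es by auto
    have "separates \<Psi> z x y" if "(x, y) \<in> E" for x y
    proof -
      from that es obtain i where "i < N" "es ! i = (x, y)" unfolding N_def by (metis in_set_conv_nth)
      with z(2)[of i] show ?thesis by simp
    qed
    from E(3)[OF z(1) this] show False by blast
  qed
  ultimately obtain Fs where Fs: "map length Fs = ?ls" "set (concat Fs) \<subseteq> M" "R Fs"
    using tarski_vaught[OF M R] by blast
  have len: "length Fs = 2 * N" using Fs(1) by (metis length_map length_replicate)
  have F: "Fs ! r \<in> tuples M k" if "r < 2 * N" for r
  proof -
    have "length (Fs ! r) = k" using Fs(1) that len by (metis nth_map nth_replicate)
    moreover have "Fs ! r \<in> set Fs" using that len by simp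
    then have "set (Fs ! r) \<subseteq> set (concat Fs)" by auto
    then have "set (Fs ! r) \<subseteq> M" using Fs(2) by (rule subset_trans)
    ultimately show ?thesis by (simp add: tuples_def)
  qed
  from Fs(3) d obtain i where "i < N" "\<not> separates \<Psi> d (Fs ! (2 * i)) (Fs ! (2 * i + 1))"
    "\<rho> [Fs ! (2 * i), Fs ! (2 * i + 1)]" unfolding R_def by auto
  with F[of "2 * i"] F[of "2 * i + 1"] show ?thesis by auto
qed

end

context monster
begin

text \<open>If no such pair existed, \<open>d\<close> would colour all \<open>\<rho>\<close>-edges in \<open>M\<close> properly. To refute this it is enough
  that the empty set is forced.

  Choose rows \<open>(A i, f i 0), f i 1, \<dots>, f i K\<close>, one after the other, where \<open>(A i, f i 0)\<close> realises a
  coheir \<open>U\<close> of the type of \<open>(a, b)\<close> and the other points realise its first projection \<open>p\<close>, always over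
  everything chosen before. Then \<open>A 0, f 0 1, A 1, f 1 1, \<dots>\<close> is a Morley sequence of \<open>p\<close>, so by NIP no
  \<open>z\<close> separates \<open>A i\<close> from \<open>f i 1\<close> for all \<open>i < N\<close>. Hence a proper colouring of the edges
  \<open>(A i, f i 0)\<close> separates \<open>f i 0\<close> from \<open>f i 1\<close> for some \<open>i < N\<close>: these \<open>N\<close> pairs are forced.

  The pairs are then removed in the order of \<open>i\<close>. The later rows are finitely satisfiable in \<open>M\<close> over the
  row \<open>i\<close>, and any two points of the row \<open>i\<close> have the type of the first two. So an automorphism
  replaces the pair of the row \<open>i\<close> by any other pair of the row and leaves the later pairs alone; since
  the row has more points than there are colours, one of its pairs is not separated, and the later
  pairs are forced without it. The order matters: earlier rows need not be invariant under later ones,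
  because \<open>U\<close> need not commute with \<open>p\<close>.\<close>

lemma equivalent_pair_in_model_formulas:
  assumes nip: "NIP L C" and M: "elementary_submodel L C M" "small \<kappa> M"
    and ab: "eqtype M a b" "length a = k" and \<rho>: "defrel M [k, k] \<rho>" "\<rho> [a, b]"
    and \<Psi>: "finite \<Psi>" "\<Psi> \<subseteq> formulas L (k + m)" and d: "length d = m"
  shows "\<exists>a'\<in>tuples M k. \<exists>b'\<in>tuples M k. \<rho> [a', b'] \<and> (\<forall>\<psi>\<in>\<Psi>. holds C \<psi> (a' @ d) = holds C \<psi> (b' @ d))"
proof -
  have lb: "length b = k" using eqtype_length[OF ab(1)] ab(2) by simp
  \<comment> \<open>\<open>U\<close> is a coheir of the type of the pair and \<open>p\<close> is its projection to the first component.\<close>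
  obtain U where U: "ultrafilter U" "tuples M (length (a @ b)) \<in> U"
    "\<forall>Q. defrel M [length (a @ b)] Q \<and> Q [a @ b] \<longrightarrow> {x. Q [x]} \<in> U"
    by (rule coheir_exists[OF M(1), of "a @ b"])
  have U2: "tuples M (k + k) \<in> U" using U(2) ab(2) lb by simp
  define p where "p = {S. take k -` S \<in> U}"
  have p: "ultrafilter p" unfolding p_def by (rule ultrafilter_vimage[OF U(1)])
  have p2: "tuples M k \<in> p"
    unfolding p_def mem_Collect_eq
    by (rule ultrafilterD(3)[OF U(1) U2]) (auto simp: tuples_def dest: in_set_takeD)
  \<comment> \<open>There are at most \<open>2^card \<Psi>\<close> colours, so a row of \<open>K + 1\<close> points has two points that are
    not separated.\<close>
  define K where "K = (2::nat) ^ card \<Psi>"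
  have K: "K \<ge> 1" by (simp add: K_def)
  define W where "W t = (if t mod (K + 1) = 0 then U else p)" for t
  define l where "l t = (if t mod (K + 1) = 0 then k + k else k)" for t
  have W: "ultrafilter (W t)" "tuples M (l t) \<in> W t" for t using U(1) U2 p p2 by (simp_all add: W_def l_def)
  have W': "{x. length x = l t} \<in> W t" for t
    by (rule ultrafilterD(3)[OF W]) (auto simp: tuples_def)
  obtain s where "\<forall>t. length (s t) = l t \<and> realises (W t) (M \<union> \<Union> (set ` s ` {..<t})) (s t)"
    using coheir_sequence[where W = W and l = l, OF W(1) W' M(2)] ..
  then have s: "length (s t) = l t" "realises (W t) (M \<union> \<Union> (set ` s ` {..<t})) (s t)" for t
    by blast+
  define st where "st i = i * (K + 1)" for i
  define A where "A i = take k (s (st i))" for i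
  define f where "f i j = (if j = 0 then drop k (s (st i)) else s (st i + j))" for i j
  have mod_pos: "(st i + j) mod (K + 1) = j" if "j \<le> K" for i j
    unfolding st_def mod_mult_self3 using that by simp
  have l0: "l (st i) = k + k" "W (st i) = U" for i
    using mod_pos[of 0 i] by (simp_all add: l_def W_def)
  have lpos: "l (st i + j) = k" "W (st i + j) = p" if "0 < j" "j \<le> K" for i j
    using mod_pos[OF that(2), of i] that(1) by (simp_all add: l_def W_def)
  have lenA: "length (A i) = k" for i using s(1)[of "st i"] l0 by (simp add: A_def)
  have lenf: "length (f i j) = k" if "j \<le> K" for i j
    using s(1) l0 lpos that by (auto simp: f_def)
  have split: "s (st i) = A i @ f i 0" for i by (simp add: A_def f_def)
  have real_A: "realises p (M \<union> \<Union> (set ` s ` {..<st i})) (A i)" for i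
    unfolding p_def A_def
    by (rule realises_prefix[of _ _ _ _ k]) (use s[of "st i"] l0 in auto)
  have real_f: "realises p (M \<union> \<Union> (set ` s ` {..<st i + j})) (f i j)" if "0 < j" "j \<le> K" for i j
    using s(2)[of "st i + j"] lpos[OF that] that by (simp add: f_def)
  have eq_pair: "eqtype M (A i @ f i 0) (a @ b)" for i
  proof (rule eqtypeI)
    show len: "length (A i @ f i 0) = length (a @ b)" using lenA lenf ab(2) lb by simp
    fix Q assume Q: "defrel M [length (A i @ f i 0)] Q"
    have "defrel (M \<union> \<Union> (set ` s ` {..<st i})) [length (s (st i))] Q"
      using Q by (auto simp: split intro: defrel_mono)
    then have "Q [A i @ f i 0] \<longleftrightarrow> {x. Q [x]} \<in> U"
      using s(2)[of "st i"] l0 unfolding realises_def split by auto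
    moreover have "Q [a @ b] \<longleftrightarrow> {x. Q [x]} \<in> U"
      using U(3)[rule_format, of Q] U(3)[rule_format, of "\<lambda>Es. \<not> Q Es"] defrel_not[OF Q] Q len ultrafilterD(4)[OF U(1), of "{x. Q [x]}"]
      by (auto simp: Compl_eq)
    ultimately show "Q [A i @ f i 0] = Q [a @ b]" by simp
  qed
  have edge: "\<rho> [A i, f i 0]" for i
    using eqtype_defrel[of M "[A i, f i 0]" "[a, b]", OF _ \<rho>(1)] eq_pair[of i] \<rho>(2) lenA lenf[of 0] ab(2) lb
    by simp
  have eq_A: "eqtype M (A i) a" for i by (rule eqtype_take[OF eq_pair]) (simp add: lenA ab)
  have eq_f0: "eqtype M (f i 0) b" for i
  proof -
    from eqtype_imp_aut[OF eq_pair[of i] M(2)] obtain \<sigma> where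
      \<sigma>: "fixing_aut M \<sigma>" "map \<sigma> (A i @ f i 0) = a @ b" by blast
    then have "map \<sigma> (f i 0) = b" using lenA ab(2) by (simp add: append_eq_append_conv)
    then show ?thesis using fixing_aut_eqtype[OF \<sigma>(1), of "f i 0"] by simp
  qed
  have eq_f: "eqtype M (f i j) (f i' 0)" if "j \<le> K" for i i' j
  proof (cases "j = 0")
    case True
    then show ?thesis using eqtype_trans[OF eq_f0 eqtype_sym[OF eq_f0]] by simp
  next
    case False
    have "eqtype M (f i j) (A i)"
      by (rule realises_eqtype[of p]) (use False that lenf lenA in \<open>auto intro: realises_mono[OF real_f] realises_mono[OF real_A]\<close>)
    then show ?thesis using eqtype_trans eq_A eqtype_sym[OF ab(1)] eqtype_sym[OF eq_f0] ab(1) by blast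
  qed
  \<comment> \<open>Over \<open>M\<close>, the points \<open>f i j\<close> and \<open>f i 0\<close> have the same type, and \<open>f i j'\<close> and \<open>f i 1\<close>
    both realise \<open>p\<close> over them.\<close>
  have f_sub: "set (f i j) \<subseteq> set (s (st i + j))" for i j
    by (auto simp: f_def dest: in_set_dropD)
  have A_sub: "set (A i) \<subseteq> set (s (st i))" for i
    by (auto simp: A_def dest: in_set_takeD)
  have s_sub: "set (s t) \<subseteq> \<Union> (set ` s ` {..<t'})" if "t < t'" for t t'
    using that by blast
  have set_f: "set (f i j) \<subseteq> \<Union> (set ` s ` {..<st i + r})" if "j < r" for i j r
    using f_sub[of i j] s_sub[of "st i + j" "st i + r"] that by simp
  have row: "eqtype M (f i j @ f i j') (f i 0 @ f i 1)" if "j < j'" "j' \<le> K" for i j j'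
  proof (rule coheir_invariant[OF p p2])
    show "eqtype M (f i j) (f i 0)" using eq_f that by simp
    show "length (f i j') = k" "length (f i 1) = k" using lenf that K by auto
    show "realises p (M \<union> set (f i j)) (f i j')"
      using real_f[of j' i] that set_f[of j j' i] by (auto intro: realises_mono)
    show "realises p (M \<union> set (f i 0)) (f i 1)"
      using real_f[of 1 i] K set_f[of 0 1 i] by (auto intro: realises_mono)
  qed
  \<comment> \<open>The sequence \<open>A 0, f 0 1, A 1, f 1 1, \<dots>\<close> leaves out the second components \<open>f i 0\<close>,
    the only points of the construction that do not realise \<open>p\<close> over the earlier ones.\<close>
  define q where "q r = (if even r then A (r div 2) else f (r div 2) 1)" for r
  have q: "morley p M k q"
    unfolding morley_def
  proof (intro allI conjI)
    fix r
    show "length (q r) = k" using lenA lenf K by (simp add: q_def)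
    let ?i = "r div 2"
    have earlier: "set (q r') \<subseteq> \<Union> (set ` s ` {..<st ?i + (if even r then 0 else 1)})" if "r' < r" for r'
    proof -
      let ?i' = "r' div 2"
      have "?i' < ?i \<or> (?i' = ?i \<and> even r' \<and> odd r)" using that by presburger
      then show ?thesis
      proof
        assume "?i' < ?i"
        then have "Suc ?i' * (K + 1) \<le> ?i * (K + 1)" by (intro mult_le_mono1) simp
        then have "st ?i' + K < st ?i" by (simp add: st_def)
        then show ?thesis
          using A_sub[of ?i'] f_sub[of ?i' 1] s_sub[of "st ?i'" "st ?i"] s_sub[of "st ?i' + 1" "st ?i"]
            s_sub[of "st ?i'" "st ?i + 1"] s_sub[of "st ?i' + 1" "st ?i + 1"] K
          by (auto simp: q_def)
      next
        assume "?i' = ?i \<and> even r' \<and> odd r"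
        then show ?thesis using A_sub[of ?i] s_sub[of "st ?i" "st ?i + 1"] by (auto simp: q_def)
      qed
    qed
    show "realises p (M \<union> \<Union> (set ` q ` {..<r})) (q r)"
    proof (cases "even r")
      case True
      then show ?thesis using earlier by (auto simp: q_def[of r] intro!: realises_mono[OF real_A])
    next
      case False
      have "realises p (M \<union> \<Union> (set ` s ` {..<st ?i + 1})) (q r)" using False real_f[of 1 ?i] K by (simp add: q_def)
      then show ?thesis by (rule realises_mono) (use earlier False in auto)
    qed
  qed
  obtain N where "\<forall>z. length z = m \<longrightarrow>
      (\<exists>i<N. \<forall>\<psi>\<in>\<Psi>. holds C \<psi> (q (2 * i) @ z) = holds C \<psi> (q (2 * i + 1) @ z))"
    using morley_alternation[OF nip p p2 M(2) q \<Psi>] ..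
  then have N: "\<exists>i<N. \<forall>\<psi>\<in>\<Psi>. holds C \<psi> (q (2 * i) @ z) = holds C \<psi> (q (2 * i + 1) @ z)"
    if "length z = m" for z using that by blast
  define P where "P i = (\<lambda>i. (f i 0, f i 1)) ` {i..<N}" for i
  have "forced \<Psi> k m \<rho> (P 0)"
  proof (rule forcedI[of "(\<lambda>i. (A i, f i 0)) ` {..<N}"])
    fix z assume z: "length z = m" "\<And>x y. (x, y) \<in> (\<lambda>i. (A i, f i 0)) ` {..<N} \<Longrightarrow> separates \<Psi> z x y"
    from N[OF z(1)] obtain i where i: "i < N"
      "\<And>\<psi>. \<psi> \<in> \<Psi> \<Longrightarrow> holds C \<psi> (A i @ z) = holds C \<psi> (f i 1 @ z)" by (auto simp: q_def)
    have "separates \<Psi> z (A i) (f i 0)" using z(2) i(1) by auto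
    then have "separates \<Psi> z (f i 0) (f i 1)" using i(2) unfolding separates_def by metis
    then show "\<exists>x y. (x, y) \<in> P 0 \<and> separates \<Psi> z x y" using i(1) unfolding P_def by fastforce
  qed (auto simp: lenA lenf edge)
  moreover have "forced \<Psi> k m \<rho> (P (Suc i))" if i: "i < N" and forced: "forced \<Psi> k m \<rho> (P i)" for i
  proof (rule forced_finite_combination[where P = "\<lambda>(j, j'). insert (f i j, f i j') (P (Suc i))"])
    let ?J = "{(j, j'). j < j' \<and> j' \<le> K}"
    show "finite ?J" by (rule finite_subset[of _ "{..K} \<times> {..K}"]) auto
    show "forced \<Psi> k m \<rho> (case jj of (j, j') \<Rightarrow> insert (f i j, f i j') (P (Suc i)))" if "jj \<in> ?J" for jj
    proof -
      from that obtain j j' where j: "jj = (j, j')" "j < j'" "j' \<le> K" by auto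
      \<comment> \<open>The later rows do not notice which two points of the row \<open>i\<close> are chosen.\<close>
      let ?c = "concat (map s [st (Suc i)..<st N])"
      have Suc_i: "st i + (K + 1) = st (Suc i)" by (simp add: st_def)
      have "st (Suc i) \<le> st N" using i unfolding st_def by (intro mult_le_mono1) simp
      then have c: "st (Suc i) + (st N - st (Suc i)) = st N" by simp
      have "eqtype M ((f i 0 @ f i 1) @ ?c) ((f i j @ f i j') @ ?c)"
        using coheir_tail_invariant[OF W s, of "f i 0 @ f i 1" "f i j @ f i j'" "st (Suc i)" "st N - st (Suc i)"]
          eqtype_sym[OF row[OF j(2,3)]] set_f[of 0 "K + 1" i] set_f[of 1 "K + 1" i] set_f[of j "K + 1" i] set_f[of j' "K + 1" i] j K
        unfolding c Suc_i by auto
      then have "eqtype M (concat [f i 0, f i 1, ?c]) (concat [f i j, f i j', ?c])" by simp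
      then obtain \<sigma> where \<sigma>: "fixing_aut M \<sigma>" "map (map \<sigma>) [f i 0, f i 1, ?c] = [f i j, f i j', ?c]"
        by (rule eqtype_blocks_aut) (use lenf j K M(2) in auto)
      have fix_c: "\<sigma> x = x" if "x \<in> set ?c" for x
      proof -
        have "map \<sigma> ?c = map id ?c" using \<sigma>(2) by simp
        then have "\<forall>x\<in>set ?c. \<sigma> x = id x" by (simp only: map_eq_conv)
        from bspec[OF this that] show ?thesis by simp
      qed
      have later: "map \<sigma> (f i' j) = f i' j" if "Suc i \<le> i'" "i' < N" "j \<le> K" for i' j
      proof (rule map_idI, rule fix_c)
        fix x assume x: "x \<in> set (f i' j)"
        have "st (Suc i) \<le> st i'" using that unfolding st_def by (intro mult_le_mono1) simp
        moreover have "st i' + (K + 1) \<le> st N"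
          using that mult_le_mono1[of "Suc i'" N "K + 1"] by (simp add: st_def)
        ultimately have "st i' + j \<in> {st (Suc i)..<st N}" using that(3) by simp
        moreover have "x \<in> set (s (st i' + j))" using x f_sub by blast
        ultimately show "x \<in> set ?c" by auto
      qed
      have P_i: "P i = insert (f i 0, f i 1) (P (Suc i))"
      proof -
        have "{i..<N} = insert i {Suc i..<N}" using i by auto
        then show ?thesis unfolding P_def by simp
      qed
      have "forced \<Psi> k m \<rho> ((\<lambda>(x, y). (map \<sigma> x, map \<sigma> y)) ` P i)"
        by (rule forced_aut[OF \<sigma>(1) \<rho>(1) \<Psi>(2) _ forced]) (use lenf K in \<open>auto simp: P_def\<close>)
      also have "(\<lambda>(x, y). (map \<sigma> x, map \<sigma> y)) ` P i = insert (f i j, f i j') (P (Suc i))"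
      proof -
        have "(\<lambda>(x, y). (map \<sigma> x, map \<sigma> y)) ` P (Suc i) = P (Suc i)"
          unfolding P_def image_image using later K by (intro image_cong) auto
        then show ?thesis unfolding P_i using \<sigma>(2) by simp
      qed
      finally show ?thesis using j(1) by simp
    qed
    fix z assume z: "length z = m" and sep: "\<And>jj. jj \<in> ?J \<Longrightarrow>
      \<exists>x y. (x, y) \<in> (case jj of (j, j') \<Rightarrow> insert (f i j, f i j') (P (Suc i))) \<and> separates \<Psi> z x y"
    let ?col = "\<lambda>j. {\<psi> \<in> \<Psi>. holds C \<psi> (f i j @ z)}"
    have "\<not> inj_on ?col {..K}"
    proof
      assume "inj_on ?col {..K}"
      then have "card {..K} \<le> card (Pow \<Psi>)" by (rule card_inj_on_le) (use \<Psi>(1) in auto)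
      then show False using \<Psi>(1) by (simp add: K_def card_Pow)
    qed
    then obtain j j' where jj: "j \<le> K" "j' \<le> K" "j \<noteq> j'" "?col j = ?col j'"
      unfolding inj_on_def by blast
    obtain j j' where j: "j < j'" "j' \<le> K" "?col j = ?col j'"
    proof (cases "j < j'")
      case True
      with jj show ?thesis by (intro that)
    next
      case False
      with jj show ?thesis by (intro that[of j' j]) simp_all
    qed
    have "\<not> separates \<Psi> z (f i j) (f i j')" using j(3) unfolding separates_def by blast
    then show "\<exists>x y. (x, y) \<in> P (Suc i) \<and> separates \<Psi> z x y" using sep[of "(j, j')"] j by auto
  qed
  ultimately have "forced \<Psi> k m \<rho> (P i)" if "i \<le> N" for i
    using that by (induction i) auto
  from this[of N] have "forced \<Psi> k m \<rho> {}" by (simp add: P_def)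
  from forced_empty_inconsistent[OF M(1) \<rho>(1) \<Psi> this d]
  show ?thesis unfolding separates_def by blast
qed

end


section \<open>Counting patterns\<close>

text \<open>Pajor's form of the Sauer--Shelah lemma. In the induction a family on \<open>insert x X\<close> is split into the
  sets without \<open>x\<close> and the sets with \<open>x\<close>; a set \<open>S\<close> that both parts shatter on \<open>X\<close> accounts for the
  two shattered sets \<open>S\<close> and \<open>insert x S\<close>.\<close>

lemma card_le_card_shattered:
  assumes "finite X" "F \<subseteq> Pow X"
  shows "card F \<le> card {S. S \<subseteq> X \<and> shatters F S}"
  using assms
proof (induction X arbitrary: F rule: finite_induct)
  case empty
  then have "F = {} \<or> F = {{}}" by auto
  moreover have *: "{S. S \<subseteq> {} \<and> shatters {{}} S} = {{}}" by (auto simp: shatters_def)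
  ultimately show ?case
  proof (elim disjE)
    assume "F = {{}}"
    then show ?thesis by (simp only: *)
  qed simp
next
  case (insert x X)
  define F0 where "F0 = {A \<in> F. x \<notin> A}"
  define F1 where "F1 = {A \<in> F. x \<in> A}"
  define F1' where "F1' = (\<lambda>A. A - {x}) ` F1"
  define sh where "sh H = {S. S \<subseteq> X \<and> shatters H S}" for H
  have fin: "finite F" using insert by (meson finite.insertI finite_Pow_iff finite_subset)
  have "inj_on (\<lambda>A. A - {x}) F1" by (rule inj_onI) (auto simp: F1_def)
  then have "card F1' = card F1" unfolding F1'_def by (rule card_image)
  moreover have "card F = card F0 + card F1"
  proof -
    have "F = F0 \<union> F1" "F0 \<inter> F1 = {}" by (auto simp: F0_def F1_def)
    then show ?thesis using fin card_Un_disjoint[of F0 F1] by (metis finite_Un)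
  qed
  moreover have "card F0 \<le> card (sh F0)" "card F1' \<le> card (sh F1')"
    unfolding sh_def using insert.prems by (auto simp: F0_def F1_def F1'_def intro!: insert.IH)
  moreover have finsh: "finite (sh H)" for H
    by (rule finite_subset[of _ "Pow X"]) (use insert.hyps in \<open>auto simp: sh_def\<close>)
  then have "card (sh F0) + card (sh F1') = card (sh F0 \<union> sh F1') + card (sh F0 \<inter> sh F1')"
    by (intro card_Un_Int)
  moreover have "card (sh F0 \<union> sh F1') + card (sh F0 \<inter> sh F1') \<le> card {S. S \<subseteq> insert x X \<and> shatters F S}"
  proof -
    let ?S = "sh F0 \<union> sh F1'" and ?T = "insert x ` (sh F0 \<inter> sh F1')"
    have "?S \<inter> ?T = {}" using insert.hyps by (auto simp: sh_def)
    moreover have "inj_on (insert x) (sh F0 \<inter> sh F1')"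
      by (rule inj_onI) (use insert.hyps in \<open>auto simp: sh_def insert_ident subset_iff\<close>)
    ultimately have "card (sh F0 \<union> sh F1') + card (sh F0 \<inter> sh F1') = card (?S \<union> ?T)"
      using finsh by (subst card_Un_disjoint) (auto simp: card_image)
    also have "\<dots> \<le> card {S. S \<subseteq> insert x X \<and> shatters F S}"
    proof (rule card_mono)
      show "finite {S. S \<subseteq> insert x X \<and> shatters F S}"
        by (rule finite_subset[of _ "Pow (insert x X)"]) (use insert.hyps in auto)
      have trace0: "\<exists>A\<in>F. x \<notin> A \<and> A \<inter> S = B" if "S \<in> sh F0" "B \<subseteq> S" for S B
      proof -
        have "\<exists>A\<in>F0. A \<inter> S = B" using that by (simp add: sh_def shatters_def)
        then show ?thesis by (auto simp: F0_def)
      qed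
      have trace1: "\<exists>A\<in>F. x \<in> A \<and> (A - {x}) \<inter> S = B" if "S \<in> sh F1'" "B \<subseteq> S" for S B
      proof -
        have "\<exists>A\<in>F1'. A \<inter> S = B" using that by (simp add: sh_def shatters_def)
        then show ?thesis by (auto simp: F1'_def F1_def)
      qed
      have x: "x \<notin> S" if "S \<in> sh H" for S H using that insert.hyps by (auto simp: sh_def)
      have "shatters F S" if S: "S \<in> sh F0" for S
        using trace0[OF S] unfolding shatters_def by blast
      moreover have "shatters F S" if S: "S \<in> sh F1'" for S
        unfolding shatters_def
      proof (intro allI impI)
        fix B assume "B \<subseteq> S"
        then obtain A where "A \<in> F" "x \<in> A" "(A - {x}) \<inter> S = B" using trace1[OF S] by blast
        then show "\<exists>A\<in>F. A \<inter> S = B" using x[OF S] by (intro bexI[of _ A]) auto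
      qed
      moreover have "shatters F (insert x S)" if S: "S \<in> sh F0" "S \<in> sh F1'" for S
        unfolding shatters_def
      proof (intro allI impI)
        fix B assume B: "B \<subseteq> insert x S"
        show "\<exists>A\<in>F. A \<inter> insert x S = B"
        proof (cases "x \<in> B")
          case True
          have "B - {x} \<subseteq> S" using B by blast
          then obtain A where "A \<in> F" "x \<in> A" "(A - {x}) \<inter> S = B - {x}" using trace1[OF S(2)] by blast
          then show ?thesis using True x[OF S(1)] by (intro bexI[of _ A]) auto
        next
          case False
          then have "B \<subseteq> S" using B by blast
          then obtain A where "A \<in> F" "x \<notin> A" "A \<inter> S = B" using trace0[OF S(1)] by blast
          then show ?thesis using False by (intro bexI[of _ A]) auto
        qed
      qed
      moreover have "S \<subseteq> X" if "S \<in> sh H" for S H using that by (simp add: sh_def)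
      ultimately show "?S \<union> ?T \<subseteq> {S. S \<subseteq> insert x X \<and> shatters F S}"
        by (simp add: subset_iff image_iff) blast
    qed
    finally show ?thesis .
  qed
  ultimately show ?case by linarith
qed

lemma card_small_subsets:
  assumes "finite X"
  shows "card {S. S \<subseteq> X \<and> card S \<le> D} \<le> (card X + 1) ^ D"
proof -
  let ?Y = "insert None (Some ` X)"
  let ?L = "{xs. set xs \<subseteq> ?Y \<and> length xs = D}"
  have finL: "finite ?L" using assms by (intro finite_lists_length_eq) simp
  have "S \<in> (\<lambda>xs. {x. Some x \<in> set xs}) ` ?L" if S: "S \<subseteq> X" "card S \<le> D" for S
  proof -
    obtain ys where ys: "set ys = S" "distinct ys"
      using finite_distinct_list finite_subset[OF S(1) assms] by blast
    let ?xs = "map Some ys @ replicate (D - card S) None"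
    have "?xs \<in> ?L" using S ys distinct_card[OF ys(2)] by auto
    moreover have "S = {x. Some x \<in> set ?xs}" using ys(1) by auto
    ultimately show ?thesis by blast
  qed
  then have "card {S. S \<subseteq> X \<and> card S \<le> D} \<le> card ((\<lambda>xs. {x. Some x \<in> set xs}) ` ?L)"
    using finL by (intro card_mono) auto
  also have "\<dots> \<le> card ?L" by (rule card_image_le[OF finL])
  also have "\<dots> = card ?Y ^ D" using assms by (intro card_lists_length_eq) simp
  also have "card ?Y = card X + 1" using assms by (simp add: card_image)
  finally show ?thesis .
qed

lemma polynomial_less_exponential:
  fixes k D :: nat
  shows "\<exists>N. (k * N + 1) ^ D < 2 ^ N"
proof -
  \<comment> \<open>For \<open>N = 2 ^ j\<close> the claim follows from \<open>(k + j) * D < 2 ^ j\<close>. With \<open>j = 3 * t\<close> the right-hand side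
    is a product of three factors \<open>2 ^ t\<close>, which dominate \<open>4\<close>, \<open>t\<close> and \<open>D\<close>.\<close>
  define t where "t = k + D + 2"
  define j where "j = 3 * t"
  have t: "t < 2 ^ t" "4 \<le> (2::nat) ^ t" "D < 2 ^ t"
  proof -
    show "t < 2 ^ t" by (rule less_exp)
    have "(2::nat) ^ 2 \<le> 2 ^ t" by (rule power_increasing) (auto simp: t_def)
    then show "4 \<le> (2::nat) ^ t" by simp
    show "D < 2 ^ t" using less_exp[of t] by (simp add: t_def)
  qed
  have "(k + j) * D \<le> (4 * t) * D" by (intro mult_le_mono1) (simp add: j_def t_def)
  also have "\<dots> \<le> (2 ^ t * 2 ^ t) * D" using t by (intro mult_le_mono1 mult_le_mono) auto
  also have "\<dots> < (2 ^ t * 2 ^ t) * 2 ^ t" using t(3) by (intro mult_strict_left_mono) auto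
  also have "\<dots> = 2 ^ j" by (simp add: j_def power_add[symmetric] mult.commute[of 3])
  finally have less: "(k + j) * D < 2 ^ j" .
  have "k * 2 ^ j + 1 \<le> (k + 1) * 2 ^ j" by simp
  also have "\<dots> \<le> 2 ^ k * 2 ^ j" using Suc_leI[OF less_exp[of k]] by (intro mult_le_mono1) (simp only: Suc_eq_plus1)
  finally have "(k * 2 ^ j + 1) ^ D \<le> (2 ^ k * 2 ^ j) ^ D" by (rule power_mono) simp
  also have "\<dots> = 2 ^ ((k + j) * D)" by (simp add: power_add power_mult)
  also have "\<dots> < 2 ^ (2 ^ j)" using less by (intro power_strict_increasing) auto
  finally show ?thesis by blast
qed

section \<open>Definable groups\<close>

context model
begin

text \<open>Concatenating the parameters turns finitely many definable sets into instances of formulas at one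
  and the same tuple.\<close>

lemma common_parameters:
  assumes "finite \<P>" and "\<And>P. P \<in> \<P> \<Longrightarrow> defrel A [k] P"
  shows "\<exists>m \<Delta>. set m \<subseteq> A \<and> finite \<Delta> \<and> \<Delta> \<subseteq> formulas L (k + length m) \<and>
    (\<forall>P\<in>\<P>. \<exists>\<psi>\<in>\<Delta>. \<forall>x. length x = k \<longrightarrow> P [x] = holds C \<psi> (x @ m))"
  using assms
proof (induction \<P> rule: finite_induct)
  case empty
  show ?case by (intro exI[of _ "[]"] exI[of _ "{}"]) simp
next
  case (insert P \<P>)
  then obtain m \<Delta> where m: "set m \<subseteq> A" "finite \<Delta>" "\<Delta> \<subseteq> formulas L (k + length m)"
    "\<And>P. P \<in> \<P> \<Longrightarrow> \<exists>\<psi>\<in>\<Delta>. \<forall>x. length x = k \<longrightarrow> P [x] = holds C \<psi> (x @ m)" by auto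
  from insert.prems[of P] obtain c \<phi> where c: "set c \<subseteq> A" "\<phi> \<in> formulas L (sum_list [k] + length c)"
    "\<And>Es. map length Es = [k] \<Longrightarrow> P Es = holds C \<phi> (concat Es @ c)" by (auto elim: defrelE)
  obtain \<phi>' where \<phi>': "\<phi>' \<in> formulas L (k + length (m @ c))"
    "\<And>x. length x = k \<Longrightarrow> holds C \<phi>' (x @ m @ c) = holds C \<phi> (x @ c)"
    using formula_weaken_params[where \<phi> = \<phi> and k = k and c = c and c' = m] c(2) by auto
  have \<phi>'P: "P [x] = holds C \<phi>' (x @ m @ c)" if "length x = k" for x
    using c(3)[of "[x]"] \<phi>'(2)[OF that] that by simp
  show ?case
  proof (intro exI[of _ "m @ c"] exI[of _ "insert \<phi>' \<Delta>"] conjI ballI)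
    show "set (m @ c) \<subseteq> A" "finite (insert \<phi>' \<Delta>)" using m c by auto
    show "insert \<phi>' \<Delta> \<subseteq> formulas L (k + length (m @ c))"
      using \<phi>'(1) m(3) formula_weaken_params_right(1) by blast
    fix Q assume Q: "Q \<in> insert P \<P>"
    show "\<exists>\<psi>\<in>insert \<phi>' \<Delta>. \<forall>x. length x = k \<longrightarrow> Q [x] = holds C \<psi> (x @ m @ c)"
    proof (cases "Q = P")
      case True
      then show ?thesis using \<phi>'P by blast
    next
      case False
      then obtain \<psi> where \<psi>: "\<psi> \<in> \<Delta>" "\<forall>x. length x = k \<longrightarrow> Q [x] = holds C \<psi> (x @ m)"
        using m(4) Q by auto
      have "holds C \<psi> (x @ m @ c) = holds C \<psi> (x @ m)" if "length x = k" for x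
        using formula_weaken_params_right(2)[where k = k and c = m and \<phi> = \<psi>] \<psi>(1) m(3) that by blast
      with \<psi> have "\<forall>x. length x = k \<longrightarrow> Q [x] = holds C \<psi> (x @ m @ c)" by simp
      with \<psi>(1) show ?thesis by blast
    qed
  qed
qed

lemma definable_over_defrel: "definable_over L C A k S \<Longrightarrow> defrel A [k] (\<lambda>Es. Es ! 0 \<in> S)"
  unfolding definable_over_def
proof (elim exE conjE bexE)
  fix c \<phi> assume *: "set c \<subseteq> A" "\<phi> \<in> formulas L (k + length c)"
    "S = {xs. length xs = k \<and> holds C \<phi> (xs @ c)}"
  show "defrel A [k] (\<lambda>Es. Es ! 0 \<in> S)"
    by (rule defrelI[of c A \<phi>]) (use * in \<open>auto simp: map_eq_Cons_conv\<close>)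
qed

end

lemma (in monster) equivalent_pair_in_model:
  assumes nip: "NIP L C" and M: "elementary_submodel L C M" "small \<kappa> M"
    and ab: "eqtype M a b" "length a = k" and \<rho>: "defrel M [k, k] \<rho>" "\<rho> [a, b]"
    and \<P>: "finite \<P>" "\<And>P. P \<in> \<P> \<Longrightarrow> defrel A [k] P"
  shows "\<exists>a'\<in>tuples M k. \<exists>b'\<in>tuples M k. \<rho> [a', b'] \<and> (\<forall>P\<in>\<P>. P [a'] = P [b'])"
proof -
  obtain d \<Psi> where d: "finite \<Psi>" "\<Psi> \<subseteq> formulas L (k + length d)"
    "\<And>P. P \<in> \<P> \<Longrightarrow> \<exists>\<psi>\<in>\<Psi>. \<forall>x. length x = k \<longrightarrow> P [x] = holds C \<psi> (x @ d)"
    using common_parameters[OF \<P>] by auto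
  from equivalent_pair_in_model_formulas[OF nip M ab \<rho> d(1,2) refl] obtain a' b' where
    *: "a' \<in> tuples M k" "b' \<in> tuples M k" "\<rho> [a', b']"
    "\<forall>\<psi>\<in>\<Psi>. holds C \<psi> (a' @ d) = holds C \<psi> (b' @ d)" by blast
  have "P [a'] = P [b']" if "P \<in> \<P>" for P
    using d(3)[OF that] * by (auto simp: tuples_def)
  with * show ?thesis by blast
qed

locale group_in_monster = monster L C \<kappa> + group G
  for L :: "('f, 'r) language" and C :: "('f, 'r, 'a) interp" and \<kappa> :: "'k rel"
    and G :: "'a list monoid" (structure) +
  fixes n :: nat
  assumes definable: "definable_group L C {} n G"
begin

lemma length_carrier: "x \<in> carrier G \<Longrightarrow> length x = n"
  using definable unfolding definable_group_def definable_over_def by auto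

lemma defrel_carrier: "defrel A [n] (\<lambda>Es. Es ! 0 \<in> carrier G)"
  using definable unfolding definable_group_def by (auto intro: defrel_mono definable_over_defrel)

lemma defrel_mult: "defrel A [n, n, n] (\<lambda>Es. Es ! 0 \<in> carrier G \<and> Es ! 1 \<in> carrier G \<and> Es ! 2 = Es ! 0 \<otimes> Es ! 1)"
proof -
  let ?S = "{x @ y @ (x \<otimes> y) |x y. x \<in> carrier G \<and> y \<in> carrier G}"
  have "defrel {} [3 * n] (\<lambda>Es. Es ! 0 \<in> ?S)"
    using definable unfolding definable_group_def by (intro definable_over_defrel) simp
  then have "defrel A [3 * n] (\<lambda>Es. Es ! 0 \<in> ?S)" by (rule defrel_mono) simp
  then show ?thesis
  proof (rule defrel_regroup)
    fix Es :: "'a list list" assume "map length Es = [n, n, n]"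
    then obtain x y z where E: "Es = [x, y, z]" "length x = n" "length y = n" "length z = n"
      by (auto simp: map_eq_Cons_conv)
    have "x @ y @ z \<in> ?S \<longleftrightarrow> x \<in> carrier G \<and> y \<in> carrier G \<and> z = x \<otimes> y"
    proof
      assume "x @ y @ z \<in> ?S"
      then obtain x' y' where "x @ y @ z = x' @ y' @ (x' \<otimes> y')" "x' \<in> carrier G" "y' \<in> carrier G"
        by blast
      then show "x \<in> carrier G \<and> y \<in> carrier G \<and> z = x \<otimes> y"
        using E length_carrier by (auto simp: append_eq_append_conv)
    qed blast
    with E show "\<exists>Fs. map length Fs = [3 * n] \<and> concat Fs = concat Es \<and>
        (Es ! 0 \<in> carrier G \<and> Es ! 1 \<in> carrier G \<and> Es ! 2 = Es ! 0 \<otimes> Es ! 1) = (Fs ! 0 \<in> ?S)"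
      by (intro exI[of _ "[x @ y @ z]"]) simp
  qed simp
qed

lemma aut_carrier: "fixing_aut A \<sigma> \<Longrightarrow> x \<in> carrier G \<Longrightarrow> map \<sigma> x \<in> carrier G"
  using fixing_aut_defrel[OF _ defrel_carrier, of A \<sigma> "[x]"] length_carrier by simp

lemma aut_mult:
  assumes "fixing_aut A \<sigma>" "x \<in> carrier G" "y \<in> carrier G"
  shows "map \<sigma> (x \<otimes> y) = map \<sigma> x \<otimes> map \<sigma> y"
  using fixing_aut_defrel[OF assms(1) defrel_mult, of "[x, y, x \<otimes> y]"] assms length_carrier by simp

lemma aut_inv:
  assumes "fixing_aut A \<sigma>" "x \<in> carrier G"
  shows "map \<sigma> (inv x) = inv (map \<sigma> x)"
proof -
  have "map \<sigma> \<one> \<otimes> map \<sigma> \<one> = map \<sigma> \<one>" using aut_mult[OF assms(1), of \<one> \<one>] by simp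
  then have one: "map \<sigma> \<one> = \<one>" using aut_carrier[OF assms(1), of \<one>] by (metis one_closed r_cancel_one')
  have "map \<sigma> (inv x) \<otimes> map \<sigma> x = \<one>" using aut_mult[OF assms(1), of "inv x" x] assms one by simp
  then show ?thesis using aut_carrier[OF assms(1)] assms(2) inv_closed inv_equality by metis
qed

abbreviation X :: "'a set \<Rightarrow> 'a list set" where "X M \<equiv> X_set L C G M"

lemma X_setI: "a \<in> carrier G \<Longrightarrow> b \<in> carrier G \<Longrightarrow> eqtype M a b \<Longrightarrow> inv a \<otimes> b \<in> X M"
  unfolding X_set_def eqtype_def by blast

lemma X_setE:
  assumes "x \<in> X M"
  obtains a b where "a \<in> carrier G" "b \<in> carrier G" "eqtype M a b" "x = inv a \<otimes> b"
  using assms length_carrier unfolding X_set_def eqtype_def by auto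

lemma X_set_carrier: "X M \<subseteq> carrier G"
  by (auto elim!: X_setE)

text \<open>Put \<open>s = u a v\<close> and \<open>s' = u b v'\<close>, let \<open>\<sigma>\<close> move \<open>s\<close> to \<open>s'\<close> over \<open>M\<close>, and let \<open>z\<close> be the image of \<open>v\<inverse>\<close>.
  Then \<open>a\<inverse>b = (s v\<inverse>)\<inverse>(s' v'\<inverse>)\<close> is the product of \<open>(s v\<inverse>)\<inverse>(s' z)\<close> and \<open>z\<inverse>v'\<inverse>\<close>. In the first factor
  \<open>s' z\<close> is the image of \<open>s v\<inverse>\<close>, and in the second one both \<open>z\<close> and \<open>v'\<inverse>\<close> have the type of \<open>v\<inverse>\<close>.\<close>

lemma product_of_two:
  assumes M: "small \<kappa> M" and G: "a \<in> carrier G" "b \<in> carrier G" "u \<in> carrier G" "v \<in> carrier G" "v' \<in> carrier G"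
    and v: "eqtype M v v'" and s: "eqtype M (u \<otimes> a \<otimes> v) (u \<otimes> b \<otimes> v')"
  shows "inv a \<otimes> b \<in> X M <#> X M"
proof -
  define s1 where "s1 = u \<otimes> a \<otimes> v"
  define s2 where "s2 = u \<otimes> b \<otimes> v'"
  have car: "s1 \<in> carrier G" "s2 \<in> carrier G" using G by (simp_all add: s1_def s2_def)
  from eqtype_imp_aut[OF s[folded s1_def s2_def] M] obtain \<sigma> where \<sigma>: "fixing_aut M \<sigma>" "map \<sigma> s1 = s2" by blast
  from eqtype_imp_aut[OF v M] obtain \<tau> where \<tau>: "fixing_aut M \<tau>" "map \<tau> v = v'" by blast
  define z where "z = map \<sigma> (inv v)"
  have z: "z \<in> carrier G" using aut_carrier[OF \<sigma>(1)] G by (simp add: z_def)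
  have "eqtype M (s1 \<otimes> inv v) (s2 \<otimes> z)"
    using fixing_aut_eqtype[OF \<sigma>(1), of "s1 \<otimes> inv v"] aut_mult[OF \<sigma>(1)] car G \<sigma>(2) by (simp add: z_def)
  then have 1: "inv (s1 \<otimes> inv v) \<otimes> (s2 \<otimes> z) \<in> X M" using car G z by (intro X_setI) auto
  have "eqtype M (inv v) z" unfolding z_def by (rule fixing_aut_eqtype[OF \<sigma>(1)])
  moreover have "eqtype M (inv v) (inv v')" using fixing_aut_eqtype[OF \<tau>(1), of "inv v"] aut_inv[OF \<tau>(1) G(4)] \<tau>(2) by simp
  ultimately have "eqtype M z (inv v')" using eqtype_sym eqtype_trans by blast
  then have 2: "inv z \<otimes> inv v' \<in> X M" using z G by (intro X_setI) auto
  have "s1 \<otimes> inv v = u \<otimes> a" using G by (simp add: s1_def m_assoc)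
  moreover have "s2 \<otimes> z \<otimes> (inv z \<otimes> inv v') = u \<otimes> b"
  proof -
    have "s2 \<otimes> z \<otimes> (inv z \<otimes> inv v') = s2 \<otimes> inv v'" using car z G by (simp add: m_assoc inv_solve_left' flip: m_assoc[of z])
    then show ?thesis using G by (simp add: s2_def m_assoc)
  qed
  ultimately have "inv (s1 \<otimes> inv v) \<otimes> (s2 \<otimes> z) \<otimes> (inv z \<otimes> inv v') = inv (u \<otimes> a) \<otimes> (u \<otimes> b)"
    using car z G by (simp add: m_assoc)
  also have "\<dots> = inv a \<otimes> b"
    using G by (simp add: inv_mult_group m_assoc) (simp flip: m_assoc)
  finally show ?thesis using 1 2 unfolding set_mult_def by blast
qed

end


section \<open>Products of two quotients\<close>

definition (in model) agree :: "('f, 'r) fm set \<Rightarrow> 'a list \<Rightarrow> 'a list \<Rightarrow> 'a list \<Rightarrow> bool" where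
  "agree \<Delta> m x y \<longleftrightarrow> (\<forall>\<psi>\<in>\<Delta>. holds C \<psi> (x @ m) = holds C \<psi> (y @ m))"

lemma (in model) agree_sym: "agree \<Delta> m x y = agree \<Delta> m y x"
  by (auto simp: agree_def)

lemma (in model) defrel_agree:
  assumes "finite \<Delta>" "\<Delta> \<subseteq> formulas L (k + l)"
  shows "defrel A [k, k, l] (\<lambda>Es. agree \<Delta> (Es ! 2) (Es ! 0) (Es ! 1))"
  unfolding agree_def
proof (intro defrel_Ball defrel_iff assms(1))
  fix \<psi> assume "\<psi> \<in> \<Delta>"
  then have \<psi>: "\<psi> \<in> formulas L (sum_list [k, l])" using assms(2) by auto
  show "defrel A [k, k, l] (\<lambda>Es. holds C \<psi> (Es ! 0 @ Es ! 2))"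
    "defrel A [k, k, l] (\<lambda>Es. holds C \<psi> (Es ! 1 @ Es ! 2))"
    using defrel_reindex[OF defrel_formula[OF \<psi>], of "[k, k, l]" "[0, 2]"]
      defrel_reindex[OF defrel_formula[OF \<psi>], of "[k, k, l]" "[1, 2]"] by simp_all
qed

context group_in_monster
begin

text \<open>The finitary trace of \<open>a\<inverse>b\<close> not being a product of two elements of \<open>X M\<close>: instead of types over
  \<open>M\<close>, only the formulas in \<open>\<Delta>\<close> at the tuple \<open>m\<close> are compared.\<close>

definition repels :: "('f, 'r) fm set \<Rightarrow> 'a list \<Rightarrow> 'a list \<Rightarrow> 'a list \<Rightarrow> bool" where
  "repels \<Delta> m a b \<longleftrightarrow> a \<in> carrier G \<and> b \<in> carrier G \<and>
    (\<forall>u\<in>carrier G. \<forall>v\<in>carrier G. \<forall>v'\<in>carrier G.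
      agree \<Delta> m v v' \<longrightarrow> \<not> agree \<Delta> m (u \<otimes> a \<otimes> v) (u \<otimes> b \<otimes> v'))"

lemma defrel_mult3:
  "defrel A [n, n, n, n] (\<lambda>Es. Es ! 0 \<in> carrier G \<and> Es ! 1 \<in> carrier G \<and> Es ! 2 \<in> carrier G \<and>
    Es ! 3 = Es ! 0 \<otimes> Es ! 1 \<otimes> Es ! 2)"
proof -
  let ?ls = "[n, n, n, n, n]"
  have 1: "defrel A ?ls (\<lambda>Es. Es ! 0 \<in> carrier G \<and> Es ! 1 \<in> carrier G \<and> Es ! 4 = Es ! 0 \<otimes> Es ! 1)"
    using defrel_reindex[OF defrel_mult, of ?ls "[0, 1, 4]"] by simp
  have 2: "defrel A ?ls (\<lambda>Es. Es ! 4 \<in> carrier G \<and> Es ! 2 \<in> carrier G \<and> Es ! 3 = Es ! 4 \<otimes> Es ! 2)"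
    using defrel_reindex[OF defrel_mult, of ?ls "[4, 2, 3]"] by simp
  have "defrel A ([n, n, n, n] @ [n]) (\<lambda>Es.
      (Es ! 0 \<in> carrier G \<and> Es ! 1 \<in> carrier G \<and> Es ! 4 = Es ! 0 \<otimes> Es ! 1) \<and>
      (Es ! 4 \<in> carrier G \<and> Es ! 2 \<in> carrier G \<and> Es ! 3 = Es ! 4 \<otimes> Es ! 2))"
    unfolding append.simps by (rule defrel_conj[OF 1 2])
  from defrel_ex[OF this] show ?thesis
    by (rule defrel_cong) (auto simp: map_eq_Cons_conv length_carrier)
qed

lemma defrel_mult_const:
  assumes w: "w \<in> carrier G" "set w \<subseteq> A"
  shows "defrel A [n, n, n] (\<lambda>Es. Es ! 0 \<in> carrier G \<and> w \<in> carrier G \<and> Es ! 1 \<in> carrier G \<and>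
    Es ! 2 = Es ! 0 \<otimes> w \<otimes> Es ! 1)"
proof -
  have "defrel A ([n, n, n] @ [n]) (\<lambda>Es. Es ! 0 \<in> carrier G \<and> Es ! 3 \<in> carrier G \<and> Es ! 1 \<in> carrier G \<and>
      Es ! 2 = Es ! 0 \<otimes> Es ! 3 \<otimes> Es ! 1)"
    using defrel_reindex[OF defrel_mult3, of "[n, n, n, n]" "[0, 3, 1, 2]"] by simp
  from defrel_param[OF this length_carrier[OF w(1)] w(2)] show ?thesis
    by (rule defrel_cong) (auto simp: map_eq_Cons_conv)
qed

lemma defrel_repels:
  assumes \<Delta>: "finite \<Delta>" "\<Delta> \<subseteq> formulas L (n + l)"
  shows "defrel A [n, n, l] (\<lambda>Es. repels \<Delta> (Es ! 2) (Es ! 0) (Es ! 1))"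
proof -
  let ?ls = "[n, n, l, n, n, n, n, n]"
  let ?m3 = "\<lambda>w x y z. w \<in> carrier G \<and> x \<in> carrier G \<and> y \<in> carrier G \<and> z = w \<otimes> x \<otimes> y"
  have 1: "defrel A ?ls (\<lambda>Es. ?m3 (Es ! 3) (Es ! 0) (Es ! 4) (Es ! 6))"
    using defrel_reindex[OF defrel_mult3, of ?ls "[3, 0, 4, 6]"] by simp
  have 2: "defrel A ?ls (\<lambda>Es. ?m3 (Es ! 3) (Es ! 1) (Es ! 5) (Es ! 7))"
    using defrel_reindex[OF defrel_mult3, of ?ls "[3, 1, 5, 7]"] by simp
  have 3: "defrel A ?ls (\<lambda>Es. agree \<Delta> (Es ! 2) (Es ! 4) (Es ! 5))"
    using defrel_reindex[OF defrel_agree[OF \<Delta>], of ?ls "[4, 5, 2]"] by simp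
  have 4: "defrel A ?ls (\<lambda>Es. agree \<Delta> (Es ! 2) (Es ! 6) (Es ! 7))"
    using defrel_reindex[OF defrel_agree[OF \<Delta>], of ?ls "[6, 7, 2]"] by simp
  have "defrel A ([n, n, l] @ [n, n, n, n, n]) (\<lambda>Es.
      ?m3 (Es ! 3) (Es ! 0) (Es ! 4) (Es ! 6) \<and> ?m3 (Es ! 3) (Es ! 1) (Es ! 5) (Es ! 7) \<and>
      agree \<Delta> (Es ! 2) (Es ! 4) (Es ! 5) \<and> agree \<Delta> (Es ! 2) (Es ! 6) (Es ! 7))"
    unfolding append.simps by (rule defrel_conj[OF 1 defrel_conj[OF 2 defrel_conj[OF 3 4]]])
  note 5 = defrel_not[OF defrel_exs[OF this]]
  have 6: "defrel A [n, n, l] (\<lambda>Es. Es ! 0 \<in> carrier G)" "defrel A [n, n, l] (\<lambda>Es. Es ! 1 \<in> carrier G)"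
    using defrel_reindex[OF defrel_carrier, of "[n, n, l]" "[0]"] defrel_reindex[OF defrel_carrier, of "[n, n, l]" "[1]"]
    by simp_all
  have "defrel A [n, n, l] (\<lambda>Es. Es ! 0 \<in> carrier G \<and> Es ! 1 \<in> carrier G \<and>
      \<not> (\<exists>Ys. map length Ys = [n, n, n, n, n] \<and>
        ?m3 ((Es @ Ys) ! 3) ((Es @ Ys) ! 0) ((Es @ Ys) ! 4) ((Es @ Ys) ! 6) \<and>
        ?m3 ((Es @ Ys) ! 3) ((Es @ Ys) ! 1) ((Es @ Ys) ! 5) ((Es @ Ys) ! 7) \<and>
        agree \<Delta> ((Es @ Ys) ! 2) ((Es @ Ys) ! 4) ((Es @ Ys) ! 5) \<and>
        agree \<Delta> ((Es @ Ys) ! 2) ((Es @ Ys) ! 6) ((Es @ Ys) ! 7)))"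
    by (rule defrel_conj[OF 6(1) defrel_conj[OF 6(2) 5]])
  then show ?thesis
  proof (rule defrel_cong)
    fix Es :: "'a list list" assume "map length Es = [n, n, l]"
    then obtain a b m where E: "Es = [a, b, m]" by (auto simp: map_eq_Cons_conv)
    have "(\<exists>Ys. map length Ys = [n, n, n, n, n] \<and> ?m3 ((Es @ Ys) ! 3) ((Es @ Ys) ! 0) ((Es @ Ys) ! 4) ((Es @ Ys) ! 6) \<and>
        ?m3 ((Es @ Ys) ! 3) ((Es @ Ys) ! 1) ((Es @ Ys) ! 5) ((Es @ Ys) ! 7) \<and>
        agree \<Delta> ((Es @ Ys) ! 2) ((Es @ Ys) ! 4) ((Es @ Ys) ! 5) \<and>
        agree \<Delta> ((Es @ Ys) ! 2) ((Es @ Ys) ! 6) ((Es @ Ys) ! 7)) \<longleftrightarrow>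
      a \<in> carrier G \<and> b \<in> carrier G \<and> (\<exists>u\<in>carrier G. \<exists>v\<in>carrier G. \<exists>v'\<in>carrier G.
        agree \<Delta> m v v' \<and> agree \<Delta> m (u \<otimes> a \<otimes> v) (u \<otimes> b \<otimes> v'))" (is "?L \<longleftrightarrow> ?R")
    proof
      assume ?L
      then show ?R by (auto simp: E map_eq_Cons_conv) blast
    next
      assume ?R
      then obtain u v v' where "a \<in> carrier G" "b \<in> carrier G" "u \<in> carrier G" "v \<in> carrier G" "v' \<in> carrier G"
        "agree \<Delta> m v v'" "agree \<Delta> m (u \<otimes> a \<otimes> v) (u \<otimes> b \<otimes> v')" by blast
      then show ?L
        by (intro exI[of _ "[u, v, v', u \<otimes> a \<otimes> v, u \<otimes> b \<otimes> v']"]) (auto simp: E length_carrier)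
    qed
    then show "repels \<Delta> (Es ! 2) (Es ! 0) (Es ! 1) \<longleftrightarrow> Es ! 0 \<in> carrier G \<and> Es ! 1 \<in> carrier G \<and>
      \<not> (\<exists>Ys. map length Ys = [n, n, n, n, n] \<and>
        ?m3 ((Es @ Ys) ! 3) ((Es @ Ys) ! 0) ((Es @ Ys) ! 4) ((Es @ Ys) ! 6) \<and>
        ?m3 ((Es @ Ys) ! 3) ((Es @ Ys) ! 1) ((Es @ Ys) ! 5) ((Es @ Ys) ! 7) \<and>
        agree \<Delta> ((Es @ Ys) ! 2) ((Es @ Ys) ! 4) ((Es @ Ys) ! 5) \<and>
        agree \<Delta> ((Es @ Ys) ! 2) ((Es @ Ys) ! 6) ((Es @ Ys) ! 7))"
      unfolding repels_def by (auto simp: E)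
  qed
qed

text \<open>If all finite pieces failed, saturation would produce \<open>u\<close>, \<open>v\<close> and \<open>v'\<close> as in \<open>product_of_two\<close>.\<close>

lemma repels_exists:
  assumes M: "small \<kappa> M" and ab: "a \<in> carrier G" "b \<in> carrier G" "inv a \<otimes> b \<notin> X M <#> X M"
  obtains m \<Delta> where "set m \<subseteq> M" "finite \<Delta>" "\<Delta> \<subseteq> formulas L (n + length m)" "repels \<Delta> m a b"
proof (rule ccontr)
  assume "\<not> thesis"
  with that have none: "\<not> repels \<Delta> m a b"
    if "set m \<subseteq> M" "finite \<Delta>" "\<Delta> \<subseteq> formulas L (n + length m)" for m \<Delta>
    using that by blast
  let ?A = "M \<union> (set a \<union> set b)" and ?ls = "[n, n, n, n, n]"
  define B where "B = (\<lambda>Es. (Es ! 0 \<in> carrier G \<and> a \<in> carrier G \<and> Es ! 1 \<in> carrier G \<and> Es ! 3 = Es ! 0 \<otimes> a \<otimes> Es ! 1) \<and>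
    (Es ! 0 \<in> carrier G \<and> b \<in> carrier G \<and> Es ! 2 \<in> carrier G \<and> Es ! 4 = Es ! 0 \<otimes> b \<otimes> Es ! 2))"
  define R where "R P = (\<lambda>Es. (P [Es ! 1] \<longleftrightarrow> P [Es ! 2]) \<and> (P [Es ! 3] \<longleftrightarrow> P [Es ! 4]))" for P :: "'a list list \<Rightarrow> bool"
  have "\<exists>Es. map length Es = ?ls \<and> B Es \<and> (\<forall>P. defrel M [n] P \<longrightarrow> R P Es)"
  proof (rule saturation_over_types[where A = ?A])
    show "small \<kappa> ?A" by (rule small_intros(1)[OF M small_intros(2)]) simp
    have ab': "set a \<subseteq> ?A" "set b \<subseteq> ?A" by auto
    show "defrel ?A ?ls B"
      unfolding B_def
    proof (rule defrel_conj)
      show "defrel ?A ?ls (\<lambda>Es. Es ! 0 \<in> carrier G \<and> a \<in> carrier G \<and> Es ! 1 \<in> carrier G \<and> Es ! 3 = Es ! 0 \<otimes> a \<otimes> Es ! 1)"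
        using defrel_reindex[OF defrel_mult_const[OF ab(1) ab'(1)], of ?ls "[0, 1, 3]"] by simp
      show "defrel ?A ?ls (\<lambda>Es. Es ! 0 \<in> carrier G \<and> b \<in> carrier G \<and> Es ! 2 \<in> carrier G \<and> Es ! 4 = Es ! 0 \<otimes> b \<otimes> Es ! 2)"
        using defrel_reindex[OF defrel_mult_const[OF ab(2) ab'(2)], of ?ls "[0, 2, 4]"] by simp
    qed
    show "defrel ?A ?ls (R P)" if "defrel M [n] P" for P
    proof -
      have P: "defrel ?A [n] P" using that by (rule defrel_mono) auto
      have "defrel ?A ?ls (\<lambda>Es. P [Es ! i])" if "i < 5" for i
        using defrel_reindex[OF P, of ?ls "[i]"] that by (auto simp: less_Suc_eq numeral_eq_Suc)
      then show ?thesis unfolding R_def by (intro defrel_conj defrel_iff) auto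
    qed
    fix \<P> assume \<P>: "finite \<P>" "\<forall>P\<in>\<P>. defrel M [n] P"
    obtain m \<Delta> where m: "set m \<subseteq> M" "finite \<Delta>" "\<Delta> \<subseteq> formulas L (n + length m)"
      "\<forall>P\<in>\<P>. \<exists>\<psi>\<in>\<Delta>. \<forall>x. length x = n \<longrightarrow> P [x] = holds C \<psi> (x @ m)"
      using common_parameters[OF \<P>(1), of M n] \<P>(2) by blast
    have "\<not> repels \<Delta> m a b" by (rule none[OF m(1-3)])
    then have "\<exists>u\<in>carrier G. \<exists>v\<in>carrier G. \<exists>v'\<in>carrier G.
        agree \<Delta> m v v' \<and> agree \<Delta> m (u \<otimes> a \<otimes> v) (u \<otimes> b \<otimes> v')"
      using ab(1,2) by (simp add: repels_def)
    then obtain u v v' where u: "u \<in> carrier G" "v \<in> carrier G" "v' \<in> carrier G"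
      "agree \<Delta> m v v'" "agree \<Delta> m (u \<otimes> a \<otimes> v) (u \<otimes> b \<otimes> v')" by (elim bexE conjE)
    let ?Es = "[u, v, v', u \<otimes> a \<otimes> v, u \<otimes> b \<otimes> v']"
    have "B ?Es" using u ab by (simp add: B_def)
    moreover have "R P ?Es" if PP: "P \<in> \<P>" for P
    proof -
      obtain \<psi> where \<psi>: "\<psi> \<in> \<Delta>" "\<forall>x. length x = n \<longrightarrow> P [x] = holds C \<psi> (x @ m)"
        using bspec[OF m(4) PP] by (elim bexE)
      have "P [x] = P [y]" if "x \<in> carrier G" "y \<in> carrier G" "agree \<Delta> m x y" for x y
        using \<psi> that(3) length_carrier[OF that(1)] length_carrier[OF that(2)] by (simp add: agree_def)
      then show ?thesis using u ab unfolding R_def by simp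
    qed
    then have "\<forall>P\<in>\<P>. R P ?Es" by (rule ballI)
    moreover have "map length ?Es = ?ls" using u ab length_carrier by simp
    ultimately show "\<exists>Es. map length Es = ?ls \<and> B Es \<and> (\<forall>P\<in>\<P>. R P Es)" by (intro exI[of _ ?Es] conjI)
  qed
  then obtain Es where Es: "map length Es = ?ls" "B Es" "\<forall>P. defrel M [n] P \<longrightarrow> R P Es"
    by (elim exE conjE)
  from Es(1) obtain u v v' s s' where E: "Es = [u, v, v', s, s']"
    "length v = n" "length v' = n" "length s = n" "length s' = n"
    by (auto simp: map_eq_Cons_conv)
  have *: "P [v] = P [v']" "P [s] = P [s']" if "defrel M [n] P" for P
    using Es(3)[rule_format, OF that] E(1) unfolding R_def by simp_all
  have "eqtype M v v'" by (rule eqtypeI, simp add: E, rule *(1), simp add: E)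
  moreover have "eqtype M s s'" by (rule eqtypeI, simp add: E, rule *(2), simp add: E)
  ultimately have "inv a \<otimes> b \<in> X M <#> X M"
    using Es(2) unfolding E(1) B_def by (intro product_of_two[OF M]) auto
  with ab(3) show False by blast
qed

fun words :: "('a list \<times> 'a list \<times> 'a list) list \<Rightarrow> 'a list set" where
  "words [] = {\<one>}"
| "words ((a, b, m) # ts) = (\<lambda>w. a \<otimes> w) ` words ts \<union> (\<lambda>w. b \<otimes> w) ` words ts"

fun word :: "('a list \<times> 'a list \<times> 'a list) list \<Rightarrow> bool list \<Rightarrow> 'a list" where
  "word ((a, b, m) # ts) (e # es) = (if e then a else b) \<otimes> word ts es"
| "word _ _ = \<one>"

text \<open>The letters are listed from left to right, and \<open>words ts\<close> are the tails that may follow the letter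
  with parameter \<open>m\<close>. As \<open>m\<close> must not distinguish them, a tower grows at its front.\<close>

fun tower :: "('f, 'r) fm set \<Rightarrow> nat \<Rightarrow> ('a list \<times> 'a list \<times> 'a list) list \<Rightarrow> bool" where
  "tower \<Delta> l [] \<longleftrightarrow> True"
| "tower \<Delta> l ((a, b, m) # ts) \<longleftrightarrow> length m = l \<and> repels \<Delta> m a b \<and>
    (\<forall>w\<in>words ts. \<forall>w'\<in>words ts. agree \<Delta> m w w') \<and> tower \<Delta> l ts"

lemma words_finite: "finite (words ts)"
  by (induction ts rule: words.induct) auto

lemma words_carrier: "tower \<Delta> l ts \<Longrightarrow> words ts \<subseteq> carrier G"
  by (induction ts rule: words.induct) (auto simp: repels_def)

lemma word_in_words: "length es = length ts \<Longrightarrow> word ts es \<in> words ts"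
  by (induction ts es rule: word.induct) auto

text \<open>At the first letter where the two words differ they have a common prefix \<open>u\<close>, followed by \<open>a\<close> and a
  tail, respectively by \<open>b\<close> and another tail. The tails agree over \<open>m\<close>, so \<open>repels\<close> applies.\<close>

lemma words_separated:
  assumes "tower \<Delta> l ts" "length es = length ts" "length es' = length ts" "es \<noteq> es'" "u \<in> carrier G"
  shows "\<exists>i<length ts. \<not> agree \<Delta> (snd (snd (ts ! i))) (u \<otimes> word ts es) (u \<otimes> word ts es')"
  using assms
proof (induction ts arbitrary: es es' u)
  case (Cons t ts)
  obtain a b m where t: "t = (a, b, m)" by (cases t) auto
  obtain e fs e' fs' where es: "es = e # fs" "es' = e' # fs'" "length fs = length ts" "length fs' = length ts"
    using Cons.prems(2,3) by (cases es; cases es') auto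
  have tow: "tower \<Delta> l ts" "repels \<Delta> m a b" "\<And>w w'. w \<in> words ts \<Longrightarrow> w' \<in> words ts \<Longrightarrow> agree \<Delta> m w w'"
    using Cons.prems(1) t by auto
  note w = word_in_words[OF es(3)] word_in_words[OF es(4)]
  have G: "a \<in> carrier G" "b \<in> carrier G" "word ts fs \<in> carrier G" "word ts fs' \<in> carrier G" "u \<in> carrier G"
    using tow w words_carrier[OF tow(1)] Cons.prems(5) by (auto simp: repels_def)
  show ?case
  proof (cases "e = e'")
    case True
    let ?u = "u \<otimes> (if e then a else b)"
    have "\<exists>i<length ts. \<not> agree \<Delta> (snd (snd (ts ! i))) (?u \<otimes> word ts fs) (?u \<otimes> word ts fs')"
      by (rule Cons.IH) (use tow es True Cons.prems(4) G in auto)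
    then obtain i where "i < length ts" "\<not> agree \<Delta> (snd (snd (ts ! i))) (?u \<otimes> word ts fs) (?u \<otimes> word ts fs')"
      by blast
    then show ?thesis using True G es t by (intro exI[of _ "Suc i"]) (auto simp: m_assoc)
  next
    case False
    have apart: "\<not> agree \<Delta> m (u \<otimes> a \<otimes> v) (u \<otimes> b \<otimes> v')" if "v \<in> words ts" "v' \<in> words ts" for v v'
      using tow that words_carrier[OF tow(1)] G(5) unfolding repels_def by blast
    have "\<not> agree \<Delta> m (u \<otimes> (if e then a else b) \<otimes> word ts fs) (u \<otimes> (if e' then a else b) \<otimes> word ts fs')"
      using False apart[OF w] apart[OF w(2,1)] agree_sym[of \<Delta> m "u \<otimes> b \<otimes> word ts fs"]
      by (cases e) simp_all
    then show ?thesis using G es t by (intro exI[of _ 0]) (auto simp: m_assoc split: if_splits)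
  qed
qed simp

lemma defrel_translate:
  assumes P: "defrel A [n] P" and w: "w \<in> carrier G" "set w \<subseteq> A"
  shows "defrel A [n] (\<lambda>Es. Es ! 0 \<in> carrier G \<and> P [Es ! 0 \<otimes> w])"
proof -
  let ?ls = "[n, n, n]"
  have "defrel A ([n, n] @ [n]) (\<lambda>Es. (Es ! 0 \<in> carrier G \<and> Es ! 1 \<in> carrier G \<and> Es ! 2 = Es ! 0 \<otimes> Es ! 1) \<and> P [Es ! 2])"
    unfolding append.simps using defrel_reindex[OF P, of ?ls "[2]"] by (intro defrel_conj[OF defrel_mult]) simp
  from defrel_ex[OF this] have "defrel A ([n] @ [n]) (\<lambda>Es. Es ! 0 \<in> carrier G \<and> Es ! 1 \<in> carrier G \<and> P [Es ! 0 \<otimes> Es ! 1])"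
    unfolding append.simps by (rule defrel_cong) (auto simp: map_eq_Cons_conv length_carrier)
  from defrel_param[OF this _ w(2)] length_carrier[OF w(1)]
  have "defrel A [n] (\<lambda>Es. (Es @ [w]) ! 0 \<in> carrier G \<and> (Es @ [w]) ! 1 \<in> carrier G \<and> P [(Es @ [w]) ! 0 \<otimes> (Es @ [w]) ! 1])"
    by simp
  then show ?thesis by (rule defrel_cong) (use w in \<open>auto simp: map_eq_Cons_conv\<close>)
qed

lemma defrel_translate_left:
  assumes P: "defrel A [n] P" and w: "w \<in> carrier G" "set w \<subseteq> A"
  shows "defrel A [n] (\<lambda>Es. Es ! 0 \<in> carrier G \<and> P [w \<otimes> Es ! 0])"
proof -
  let ?ls = "[n, n, n]"
  have "defrel A ([n, n] @ [n]) (\<lambda>Es. (Es ! 1 \<in> carrier G \<and> Es ! 0 \<in> carrier G \<and> Es ! 2 = Es ! 1 \<otimes> Es ! 0) \<and> P [Es ! 2])"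
    unfolding append.simps
    by (rule defrel_conj) (use defrel_reindex[OF defrel_mult, of ?ls "[1, 0, 2]"] defrel_reindex[OF P, of ?ls "[2]"] in simp_all)
  from defrel_ex[OF this] have "defrel A ([n] @ [n]) (\<lambda>Es. Es ! 1 \<in> carrier G \<and> Es ! 0 \<in> carrier G \<and> P [Es ! 1 \<otimes> Es ! 0])"
    unfolding append.simps by (rule defrel_cong) (auto simp: map_eq_Cons_conv length_carrier)
  from defrel_param[OF this _ w(2)] length_carrier[OF w(1)]
  have "defrel A [n] (\<lambda>Es. (Es @ [w]) ! 1 \<in> carrier G \<and> (Es @ [w]) ! 0 \<in> carrier G \<and> P [(Es @ [w]) ! 1 \<otimes> (Es @ [w]) ! 0])"
    by simp
  then show ?thesis by (rule defrel_cong) (use w in \<open>auto simp: map_eq_Cons_conv\<close>)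
qed


text \<open>By saturation finitely many requirements can be met at a time, and they are met inside \<open>M\<close>:
  \<open>equivalent_pair_in_model\<close> gives \<open>a'\<close> and \<open>b'\<close> in \<open>M\<close> that the given formulas, with the words
  in \<open>T\<close> as parameters, do not distinguish, and then Tarski--Vaught gives \<open>m'\<close> in \<open>M\<close>. Words in \<open>T\<close> have the
  same type over \<open>M\<close>, hence they are not distinguished over \<open>a'\<close>, \<open>b'\<close> and \<open>m'\<close>.\<close>

lemma tower_step:
  assumes nip: "NIP L C" and M: "elementary_submodel L C M" "small \<kappa> M"
    and ab: "eqtype M a b" "repels \<Delta> m a b" and \<Delta>: "finite \<Delta>" "\<Delta> \<subseteq> formulas L (n + length m)"
    and T: "finite T" "T \<subseteq> carrier G" "\<And>w w'. w \<in> T \<Longrightarrow> w' \<in> T \<Longrightarrow> eqtype M w w'"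
  obtains a' b' m' where "length m' = length m" "repels \<Delta> m' a' b'"
    "\<forall>w\<in>T. \<forall>w'\<in>T. agree \<Delta> m' w w'"
    "\<forall>c\<in>{a', b'}. \<forall>c'\<in>{a', b'}. \<forall>w\<in>T. \<forall>w'\<in>T. eqtype M (c \<otimes> w) (c' \<otimes> w')"
proof -
  let ?A = "M \<union> \<Union> (set ` T)" and ?ls = "[n, n, length m]"
  define B where "B = (\<lambda>Es. repels \<Delta> (Es ! 2) (Es ! 0) (Es ! 1) \<and>
    (\<forall>(w, w')\<in>T \<times> T. agree \<Delta> (Es ! 2) w w'))"
  \<comment> \<open>\<open>V P i w\<close> is the truth value of \<open>P\<close> at the word that starts with the letter \<open>i\<close> and
    continues with \<open>w\<close>.\<close>
  define V where "V P i w = (\<lambda>Es. Es ! i \<in> carrier G \<and> P [Es ! i \<otimes> w])"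
    for P :: "'a list list \<Rightarrow> bool" and i :: nat and w :: "'a list"
  define R where "R P = (\<lambda>Es. \<forall>i\<in>{0, 1}. \<forall>w\<in>T. \<forall>j\<in>{0, 1}. \<forall>w'\<in>T. V P i w Es \<longleftrightarrow> V P j w' Es)"
    for P :: "'a list list \<Rightarrow> bool"
  have subA: "set w \<subseteq> ?A" if "w \<in> T" for w using that by blast
  have "\<exists>Es. map length Es = ?ls \<and> B Es \<and> (\<forall>P. defrel M [n] P \<longrightarrow> R P Es)"
  proof (rule saturation_over_types[where A = ?A])
    show "small \<kappa> ?A" by (rule small_intros(1)[OF M(2) small_intros(2)]) (use T(1) in simp)
    show "defrel ?A ?ls B"
    proof -
      have "defrel ?A ?ls (\<lambda>Es. agree \<Delta> (Es ! 2) w w')" if w: "w \<in> T" "w' \<in> T" for w w'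
      proof -
        have "defrel ?A ([length m] @ [n, n]) (\<lambda>Es. agree \<Delta> (Es ! 0) (Es ! 1) (Es ! 2))"
          using defrel_reindex[OF defrel_agree[OF \<Delta>], of "[length m] @ [n, n]" "[1, 2, 0]"] by simp
        then have "defrel ?A [length m] (\<lambda>Es. agree \<Delta> ((Es @ [w, w']) ! 0) ((Es @ [w, w']) ! 1) ((Es @ [w, w']) ! 2))"
          by (rule defrel_params) (use w T(2) subA length_carrier in auto)
        then have "defrel ?A [length m] (\<lambda>Es. agree \<Delta> (Es ! 0) w w')"
          by (rule defrel_cong) (auto simp: map_eq_Cons_conv)
        from defrel_reindex[OF this, of ?ls "[2]"] show ?thesis by simp
      qed
      then have "defrel ?A ?ls (\<lambda>Es. \<forall>ww\<in>T \<times> T. case ww of (w, w') \<Rightarrow> agree \<Delta> (Es ! 2) w w')"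
        using T(1) by (intro defrel_Ball) auto
      then show ?thesis unfolding B_def by (rule defrel_conj[OF defrel_repels[OF \<Delta>]])
    qed
    show "defrel ?A ?ls (R P)" if "defrel M [n] P" for P
    proof -
      have P: "defrel ?A [n] P" using that by (rule defrel_mono) auto
      have V: "defrel ?A ?ls (V P i w)" if "i \<in> {0, 1}" "w \<in> T" for i w
        using defrel_reindex[OF defrel_translate[OF P, of w], of ?ls "[i]"] that T(2) subA[OF that(2)]
        unfolding V_def by auto
      show ?thesis unfolding R_def by (intro defrel_Ball defrel_iff V) (use T(1) in auto)
    qed
    fix \<P> assume \<P>: "finite \<P>" "\<forall>P\<in>\<P>. defrel M [n] P"
    have G: "a \<in> carrier G" "b \<in> carrier G" using ab(2) by (auto simp: repels_def)
    define \<rho> where "\<rho> = (\<lambda>Es. \<exists>y. length y = length m \<and> repels \<Delta> y (Es ! 0) (Es ! 1))"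
    have \<rho>: "defrel M [n, n] \<rho>"
    proof -
      have "defrel M ([n, n] @ [length m]) (\<lambda>Es. repels \<Delta> (Es ! 2) (Es ! 0) (Es ! 1))"
        using defrel_repels[OF \<Delta>] by simp
      from defrel_ex[OF this] show ?thesis
        unfolding \<rho>_def by (rule defrel_cong) (auto simp: map_eq_Cons_conv)
    qed
    have "\<rho> [a, b]" unfolding \<rho>_def using ab(2) by auto
    moreover have "defrel ?A [n] (V P 0 w)" if "P \<in> \<P>" "w \<in> T" for P w
    proof -
      have "defrel ?A [n] P" using that(1) \<P>(2) defrel_mono[of M "[n]" P ?A] by blast
      then show ?thesis unfolding V_def by (rule defrel_translate) (use that(2) T(2) subA in auto)
    qed
    then have "defrel ?A [n] P" if "P \<in> (\<lambda>(P, w). V P 0 w) ` (\<P> \<times> T)" for P using that by auto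
    ultimately obtain a' b' where a'b': "a' \<in> tuples M n" "b' \<in> tuples M n" "\<rho> [a', b']"
      "\<forall>P\<in>(\<lambda>(P, w). V P 0 w) ` (\<P> \<times> T). P [a'] = P [b']"
      using equivalent_pair_in_model[OF nip M ab(1) length_carrier[OF G(1)] \<rho>, of "(\<lambda>(P, w). V P 0 w) ` (\<P> \<times> T)" ?A]
        T(1) \<P>(1) by auto
    have "\<exists>m'\<in>tuples M (length m). repels \<Delta> m' a' b'"
    proof -
      have "defrel M ([length m] @ [n, n]) (\<lambda>Es. repels \<Delta> (Es ! 0) (Es ! 1) (Es ! 2))"
        using defrel_reindex[OF defrel_repels[OF \<Delta>], of "[length m] @ [n, n]" "[1, 2, 0]"] by simp
      then have "defrel M [length m] (\<lambda>Es. repels \<Delta> ((Es @ [a', b']) ! 0) ((Es @ [a', b']) ! 1) ((Es @ [a', b']) ! 2))"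
        by (rule defrel_params) (use a'b' in \<open>auto simp: tuples_def\<close>)
      moreover obtain y where "length y = length m" "repels \<Delta> y a' b'" using a'b'(3) unfolding \<rho>_def by auto
      ultimately obtain Es where "map length Es = [length m]" "set (concat Es) \<subseteq> M"
        "repels \<Delta> ((Es @ [a', b']) ! 0) ((Es @ [a', b']) ! 1) ((Es @ [a', b']) ! 2)"
        using tarski_vaught[OF M(1), of "[length m]" _ "[y]"] by force
      then show ?thesis by (auto simp: map_eq_Cons_conv tuples_def)
    qed
    then obtain m' where m': "m' \<in> tuples M (length m)" "repels \<Delta> m' a' b'" by blast
    have G': "a' \<in> carrier G" "b' \<in> carrier G" using m'(2) by (auto simp: repels_def)
    let ?Es = "[a', b', m']"
    have "agree \<Delta> m' w w'" if w: "w \<in> T" "w' \<in> T" for w w'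
      unfolding agree_def
    proof
      fix \<psi> assume "\<psi> \<in> \<Delta>"
      then have "\<psi> \<in> formulas L (sum_list [n] + length m')" using \<Delta>(2) m'(1) by (auto simp: tuples_def)
      from defrel_formula_params[OF this, of M] have "defrel M [n] (\<lambda>Es. holds C \<psi> (concat Es @ m'))"
        using m'(1) by (auto simp: tuples_def)
      from eqtype_defrel[OF _ this, of "[w]" "[w']"] show "holds C \<psi> (w @ m') = holds C \<psi> (w' @ m')"
        using T(2,3) w length_carrier by auto
    qed
    then have "B ?Es" using m'(2) by (auto simp: B_def)
    moreover have "R P ?Es" if P: "P \<in> \<P>" for P
    proof -
      have PM: "defrel M [n] P" using P \<P>(2) by blast
      have shift: "P [c \<otimes> w] = P [c \<otimes> w']" if c: "c \<in> {a', b'}" and w: "w \<in> T" "w' \<in> T" for c w w'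
      proof -
        have "defrel M [n] (\<lambda>Es. Es ! 0 \<in> carrier G \<and> P [c \<otimes> Es ! 0])"
          by (rule defrel_translate_left[OF PM]) (use c G' a'b' in \<open>auto simp: tuples_def\<close>)
        from eqtype_defrel[OF _ this, of "[w]" "[w']"] show ?thesis
          using T(2,3) w length_carrier by auto
      qed
      have letters: "P [a' \<otimes> w] = P [b' \<otimes> w]" if "w \<in> T" for w
      proof -
        have "V P 0 w \<in> (\<lambda>(P, w). V P 0 w) ` (\<P> \<times> T)" using P that by force
        from bspec[OF a'b'(4) this] show ?thesis using G' by (simp add: V_def)
      qed
      show ?thesis
        unfolding R_def
      proof (intro ballI)
        fix i w j w' assume i: "i \<in> {0, 1::nat}" "j \<in> {0, 1::nat}" and w: "w \<in> T" "w' \<in> T"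
        have E: "?Es ! i \<in> {a', b'}" "?Es ! j \<in> {a', b'}" using i by auto
        have "P [?Es ! i \<otimes> w] = P [?Es ! j \<otimes> w]" using E letters[OF w(1)] by auto
        also have "\<dots> = P [?Es ! j \<otimes> w']" by (rule shift[OF E(2) w])
        finally have "P [?Es ! i \<otimes> w] = P [?Es ! j \<otimes> w']" .
        moreover have sub: "{a', b'} \<subseteq> carrier G" using G' by simp
        ultimately show "V P i w ?Es \<longleftrightarrow> V P j w' ?Es"
          unfolding V_def using subsetD[OF sub E(1)] subsetD[OF sub E(2)] by (simp only: simp_thms)
      qed
    qed
    then have "\<forall>P\<in>\<P>. R P ?Es" by (rule ballI)
    moreover have "map length ?Es = ?ls" using G' m'(1) length_carrier by (simp add: tuples_def)
    ultimately show "\<exists>Es. map length Es = ?ls \<and> B Es \<and> (\<forall>P\<in>\<P>. R P Es)" by (intro exI[of _ ?Es] conjI)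
  qed
  then obtain Es where Es: "map length Es = ?ls" "B Es" "\<forall>P. defrel M [n] P \<longrightarrow> R P Es"
    by (elim exE conjE)
  from Es(1) obtain a' b' m' where E: "Es = [a', b', m']" "length m' = length m"
    by (auto simp: map_eq_Cons_conv)
  from Es(2) have B: "repels \<Delta> m' a' b'" "\<forall>w\<in>T. \<forall>w'\<in>T. agree \<Delta> m' w w'"
    unfolding B_def E by auto
  then have G': "a' \<in> carrier G" "b' \<in> carrier G" by (auto simp: repels_def)
  have "eqtype M (c \<otimes> w) (c' \<otimes> w')" if c: "c \<in> {a', b'}" "c' \<in> {a', b'}" and w: "w \<in> T" "w' \<in> T" for c c' w w'
  proof (rule eqtypeI)
    have l: "length (c \<otimes> w) = n" "length (c' \<otimes> w') = n" using c w G' T(2) length_carrier by auto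
    then show "length (c \<otimes> w) = length (c' \<otimes> w')" by simp
    fix P assume "defrel M [length (c \<otimes> w)] P"
    then have "defrel M [n] P" using l by simp
    then have "R P Es" using Es(3) by simp
    moreover obtain i j where "i \<in> {0, 1}" "Es ! i = c" "j \<in> {0, 1}" "Es ! j = c'"
      using c unfolding E by force
    ultimately have "V P i w Es = V P j w' Es" "c = Es ! i" "c' = Es ! j" using w unfolding R_def by auto
    then show "P [c \<otimes> w] = P [c' \<otimes> w']" using c G' unfolding V_def by auto
  qed
  then show ?thesis using that[OF E(2) B] by blast
qed

lemma tower_exists:
  assumes nip: "NIP L C" and M: "elementary_submodel L C M" "small \<kappa> M"
    and ab: "eqtype M a b" "repels \<Delta> m a b" and \<Delta>: "finite \<Delta>" "\<Delta> \<subseteq> formulas L (n + length m)"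
  shows "\<exists>ts. length ts = N \<and> tower \<Delta> (length m) ts \<and> (\<forall>w\<in>words ts. \<forall>w'\<in>words ts. eqtype M w w')"
proof (induction N)
  case 0
  show ?case by (intro exI[of _ "[]"]) simp
next
  case (Suc N)
  then obtain ts where ts: "length ts = N" "tower \<Delta> (length m) ts"
    "\<And>w w'. w \<in> words ts \<Longrightarrow> w' \<in> words ts \<Longrightarrow> eqtype M w w'" by blast
  obtain a' b' m' where *: "length m' = length m" "repels \<Delta> m' a' b'"
    "\<forall>w\<in>words ts. \<forall>w'\<in>words ts. agree \<Delta> m' w w'"
    "\<forall>c\<in>{a', b'}. \<forall>c'\<in>{a', b'}. \<forall>w\<in>words ts. \<forall>w'\<in>words ts. eqtype M (c \<otimes> w) (c' \<otimes> w')"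
    by (rule tower_step[OF nip M ab \<Delta> words_finite words_carrier[OF ts(2)] ts(3)])
  have "\<forall>w\<in>words ((a', b', m') # ts). \<forall>w'\<in>words ((a', b', m') # ts). eqtype M w w'"
    using *(4) by auto
  moreover have "tower \<Delta> (length m) ((a', b', m') # ts)" using * ts by simp
  ultimately show ?case using ts(1) by (intro exI[of _ "(a', b', m') # ts"]) simp
qed

text \<open>A tower of height \<open>N\<close> has \<open>2 ^ N\<close> words, and the truth values of the formulas in \<open>\<Delta>\<close> at its \<open>N\<close>
  parameters tell all of them apart. By NIP and \<open>card_le_card_shattered\<close> the number of these patterns
  is bounded by a polynomial in \<open>N\<close>.\<close>

lemma no_repelling_pair:
  assumes nip: "NIP L C" and M: "elementary_submodel L C M" "small \<kappa> M"
    and ab: "eqtype M a b" and \<Delta>: "finite \<Delta>" "\<Delta> \<subseteq> formulas L (n + length m)"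
  shows "\<not> repels \<Delta> m a b"
proof
  assume rep: "repels \<Delta> m a b"
  let ?l = "length m"
  have "\<forall>\<psi>\<in>\<Delta>. \<exists>d. shatter_bound (\<lambda>x z. holds C \<psi> (z @ x)) ?l n d"
    using nip_bound_swapped[OF nip] \<Delta>(2) by blast
  from bchoice[OF this] obtain d where
    d: "\<forall>\<psi>\<in>\<Delta>. shatter_bound (\<lambda>x z. holds C \<psi> (z @ x)) ?l n (d \<psi>)" ..
  define D where "D = sum d \<Delta>"
  obtain N where N: "(card \<Delta> * N + 1) ^ D < 2 ^ N" using polynomial_less_exponential by blast
  obtain ts where ts: "length ts = N" "tower \<Delta> ?l ts"
    using tower_exists[OF nip M ab rep \<Delta>, of N] by blast
  define \<mu> where "\<mu> i = snd (snd (ts ! i))" for i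
  have len\<mu>: "length (\<mu> i) = ?l" if "i < N" for i
    using ts that unfolding \<mu>_def
  proof (induction ts arbitrary: N i)
    case (Cons t ts)
    then show ?case by (cases t; cases i) auto
  qed simp
  define Y where "Y = \<Delta> \<times> {..<N}"
  define pat where "pat z = {(\<psi>, i) \<in> Y. holds C \<psi> (z @ \<mu> i)}" for z
  let ?E = "{es :: bool list. length es = N}"
  define F where "F = (\<lambda>es. pat (word ts es)) ` ?E"
  have Y: "finite Y" "card Y = card \<Delta> * N" using \<Delta>(1) by (simp_all add: Y_def)
  have word_len: "length (word ts es) = n" "word ts es \<in> carrier G" if "length es = N" for es
    using word_in_words[of es ts] words_carrier[OF ts(2)] that ts(1) length_carrier by auto
  have "inj_on (\<lambda>es. pat (word ts es)) ?E"
  proof (rule inj_onI, rule ccontr)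
    fix es es' assume es: "es \<in> ?E" "es' \<in> ?E" "pat (word ts es) = pat (word ts es')" "es \<noteq> es'"
    obtain i where i: "i < N" "\<not> agree \<Delta> (\<mu> i) (\<one> \<otimes> word ts es) (\<one> \<otimes> word ts es')"
      using words_separated[OF ts(2), of es es' \<one>] es ts(1) unfolding \<mu>_def by auto
    then obtain \<psi> where "\<psi> \<in> \<Delta>" "holds C \<psi> (word ts es @ \<mu> i) \<noteq> holds C \<psi> (word ts es' @ \<mu> i)"
      using word_len es by (auto simp: agree_def)
    then have "((\<psi>, i) \<in> pat (word ts es)) \<noteq> ((\<psi>, i) \<in> pat (word ts es'))"
      using i(1) by (simp add: pat_def Y_def)
    with es(3) show False by simp
  qed
  then have "card F = card ?E" unfolding F_def by (rule card_image)
  also have "card ?E = 2 ^ N" using card_lists_length_eq[of "UNIV :: bool set" N] by simp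
  finally have "2 ^ N = card F" ..
  also have "\<dots> \<le> card {S. S \<subseteq> Y \<and> shatters F S}"
    by (rule card_le_card_shattered[OF Y(1)]) (auto simp: F_def pat_def)
  also have "\<dots> \<le> card {S. S \<subseteq> Y \<and> card S \<le> D}"
  proof (rule card_mono)
    show "finite {S. S \<subseteq> Y \<and> card S \<le> D}"
      by (rule finite_subset[of _ "Pow Y"]) (use Y(1) in auto)
    have "card S \<le> D" if S: "S \<subseteq> Y" "shatters F S" for S
    proof -
      define I where "I \<psi> = {i. (\<psi>, i) \<in> S}" for \<psi>
      have I: "I \<psi> \<subseteq> {..<N}" for \<psi> using S(1) by (auto simp: I_def Y_def)
      then have fin: "finite (I \<psi>)" for \<psi> by (rule finite_subset) simp
      have "card (I \<psi>) \<le> d \<psi>" if \<psi>: "\<psi> \<in> \<Delta>" for \<psi>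
      proof -
        have "\<exists>z. length z = n \<and> (\<forall>i\<in>I \<psi>. holds C \<psi> (z @ \<mu> i) \<longleftrightarrow> i \<in> \<eta>)" if \<eta>: "\<eta> \<subseteq> I \<psi>" for \<eta>
        proof -
          have "{\<psi>} \<times> \<eta> \<subseteq> S" using \<eta> by (auto simp: I_def)
          then obtain A where A: "A \<in> F" "A \<inter> S = {\<psi>} \<times> \<eta>" using S(2) unfolding shatters_def by blast
          then obtain es where es: "length es = N" "A = pat (word ts es)" by (auto simp: F_def)
          have "holds C \<psi> (word ts es @ \<mu> i) \<longleftrightarrow> i \<in> \<eta>" if "i \<in> I \<psi>" for i
          proof -
            have "(\<psi>, i) \<in> S" using that by (simp add: I_def)
            then have "(\<psi>, i) \<in> A \<longleftrightarrow> i \<in> \<eta>" using A(2) by blast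
            moreover have "(\<psi>, i) \<in> Y" using \<open>(\<psi>, i) \<in> S\<close> S(1) by blast
            ultimately show ?thesis by (simp add: es(2) pat_def)
          qed
          with word_len(1)[OF es(1)] show ?thesis by blast
        qed
        moreover have "\<forall>i\<in>I \<psi>. length (\<mu> i) = ?l" using len\<mu> I[of \<psi>] by auto
        ultimately show ?thesis
          using bspec[OF d \<psi>, unfolded shatter_bound_def, THEN spec, THEN spec, of "I \<psi>" \<mu>] fin by simp
      qed
      then have "(\<Sum>\<psi>\<in>\<Delta>. card (I \<psi>)) \<le> D" unfolding D_def by (rule sum_mono)
      moreover have "S = Sigma \<Delta> I" using S(1) by (auto simp: I_def Y_def)
      then have "card S = (\<Sum>\<psi>\<in>\<Delta>. card (I \<psi>))" using \<Delta>(1) fin by (simp add: card_SigmaI)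
      ultimately show ?thesis by simp
    qed
    then show "{S. S \<subseteq> Y \<and> shatters F S} \<subseteq> {S. S \<subseteq> Y \<and> card S \<le> D}" by blast
  qed
  also have "\<dots> \<le> (card \<Delta> * N + 1) ^ D" using card_small_subsets[OF Y(1), of D] unfolding Y(2) .
  finally show False using N by simp
qed

lemma X_set_subset_product:
  assumes nip: "NIP L C" and M0: "elementary_submodel L C M0" "small \<kappa> M0" and M: "small \<kappa> M"
  shows "X M0 \<subseteq> X M <#> X M"
proof
  fix x assume "x \<in> X M0"
  then obtain a b where ab: "a \<in> carrier G" "b \<in> carrier G" "eqtype M0 a b" "x = inv a \<otimes> b"
    by (rule X_setE)
  show "x \<in> X M <#> X M"
  proof (rule ccontr)
    assume "x \<notin> X M <#> X M"
    then obtain m \<Delta> where "set m \<subseteq> M" "finite \<Delta>" "\<Delta> \<subseteq> formulas L (n + length m)" "repels \<Delta> m a b"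
      using repels_exists[OF M ab(1,2)] ab(4) by blast
    with no_repelling_pair[OF nip M0 ab(3)] show False by blast
  qed
qed

end


section \<open>The smallest invariant subgroup of bounded index\<close>

lemma (in model) fixing_aut_inv:
  assumes "fixing_aut A \<sigma>"
  shows "fixing_aut A (inv_into UNIV \<sigma>)"
proof -
  have \<sigma>: "automorphism L C \<sigma>" "\<And>x. x \<in> A \<Longrightarrow> \<sigma> x = x" using assms by (auto simp: fixing_aut_def)
  then have bij: "bij \<sigma>" by (simp add: automorphism_def)
  let ?\<tau> = "inv_into UNIV \<sigma>"
  have 1: "\<sigma> (?\<tau> x) = x" "?\<tau> (\<sigma> x) = x" for x
    using bij by (auto simp: bij_def surj_f_inv_f)
  then have map1: "map \<sigma> (map ?\<tau> xs) = xs" for xs by (simp add: comp_def)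
  have "?\<tau> (fun_int C f xs) = fun_int C f (map ?\<tau> xs)" if "(f, length xs) \<in> Funs L" for f xs
  proof -
    have "\<sigma> (fun_int C f (map ?\<tau> xs)) = fun_int C f (map \<sigma> (map ?\<tau> xs))"
      using \<sigma>(1) that unfolding automorphism_def by fastforce
    then show ?thesis using map1 1(2) by metis
  qed
  moreover have "rel_int C r (map ?\<tau> xs) = rel_int C r xs" if "(r, length xs) \<in> Rels L" for r xs
    using automorphism_rel[OF \<sigma>(1), of r "map ?\<tau> xs"] that map1[of xs] by simp
  moreover have "bij ?\<tau>" using bij by (rule bij_imp_bij_inv)
  ultimately have "automorphism L C ?\<tau>" unfolding automorphism_def by auto
  then show ?thesis using \<sigma>(2) 1(2) unfolding fixing_aut_def by metis
qed

context group_in_monster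
begin

lemma X_set_subgroup: "subgroup (generate G (X M)) G"
  by (rule generate_is_subgroup[OF X_set_carrier])

lemma aut_X_set:
  assumes \<sigma>: "fixing_aut M \<sigma>" and "x \<in> X M"
  shows "map \<sigma> x \<in> X M"
proof -
  from assms(2) obtain a b where ab: "a \<in> carrier G" "b \<in> carrier G" "eqtype M a b" "x = inv a \<otimes> b"
    by (rule X_setE)
  have "eqtype M (map \<sigma> a) (map \<sigma> b)"
    using fixing_aut_eqtype[OF \<sigma>] ab(3) eqtype_sym eqtype_trans by blast
  then have "inv (map \<sigma> a) \<otimes> map \<sigma> b \<in> X M" using aut_carrier[OF \<sigma>] ab by (intro X_setI) auto
  then show ?thesis using ab aut_mult[OF \<sigma>] aut_inv[OF \<sigma>] by simp
qed

lemma X_set_generate_invariant: "invariant_over L C M (generate G (X M))"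
proof -
  have closed: "map \<sigma> h \<in> generate G (X M)" if \<sigma>: "fixing_aut M \<sigma>" and h: "h \<in> generate G (X M)" for \<sigma> h
    using h
  proof (induction h rule: generate.induct)
    case one
    have "map \<sigma> \<one> \<otimes> map \<sigma> \<one> = map \<sigma> \<one>" using aut_mult[OF \<sigma>, of \<one> \<one>] by simp
    then have "map \<sigma> \<one> = \<one>" using aut_carrier[OF \<sigma>, of \<one>] by (metis one_closed r_cancel_one')
    then show ?case by (simp add: generate.one)
  next
    case (incl h)
    then show ?case by (intro generate.incl aut_X_set[OF \<sigma>])
  next
    case (inv h)
    then have "inv (map \<sigma> h) \<in> generate G (X M)" by (intro generate.inv aut_X_set[OF \<sigma>])
    moreover have "h \<in> carrier G" using inv X_set_carrier by blast
    ultimately show ?case using aut_inv[OF \<sigma>] by simp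
  next
    case (eng h1 h2)
    have "h1 \<in> carrier G" "h2 \<in> carrier G" using eng generate_in_carrier[OF X_set_carrier] by blast+
    then show ?case using eng generate.eng[of _ G "X M"] aut_mult[OF \<sigma>] by simp
  qed
  show ?thesis unfolding invariant_over_def
  proof (intro allI impI)
    fix \<sigma> assume "automorphism L C \<sigma> \<and> (\<forall>x\<in>M. \<sigma> x = x)"
    then have \<sigma>: "fixing_aut M \<sigma>" by (simp add: fixing_aut_def)
    then have "bij \<sigma>" by (simp add: fixing_aut_def automorphism_def)
    then have "map \<sigma> (map (inv_into UNIV \<sigma>) h) = h" for h
      by (simp add: comp_def bij_def surj_f_inv_f)
    then have "h \<in> map \<sigma> ` generate G (X M)" if "h \<in> generate G (X M)" for h
      using closed[OF fixing_aut_inv[OF \<sigma>] that] by (metis imageI)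
    then show "map \<sigma> ` generate G (X M) = generate G (X M)" using closed[OF \<sigma>] by auto
  qed
qed

text \<open>If \<open>x\<inverse>\<close> and \<open>y\<inverse>\<close> have the same type over \<open>M\<close>, then \<open>x y\<inverse> \<in> X M\<close>, so \<open>x\<close> and \<open>y\<close> lie in the same right
  coset: there are at most as many cosets as types.\<close>

lemma X_set_generate_bounded:
  assumes M: "small \<kappa> M"
  shows "bounded_index \<kappa> G (generate G (X M))"
proof -
  let ?H = "generate G (X M)"
  define rep where "rep Q = (SOME x. x \<in> carrier G \<and> Q = ?H #> x)" for Q
  have rep: "rep Q \<in> carrier G" "Q = ?H #> rep Q" if "Q \<in> rcosets ?H" for Q
  proof -
    have "\<exists>x. x \<in> carrier G \<and> Q = ?H #> x" using that unfolding RCOSETS_def by auto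
    from someI_ex[OF this] show "rep Q \<in> carrier G" "Q = ?H #> rep Q" unfolding rep_def by auto
  qed
  have "inj_on (\<lambda>Q. tp L C (inv (rep Q)) M) (rcosets ?H)"
  proof (rule inj_onI)
    fix Q Q' assume Q: "Q \<in> rcosets ?H" "Q' \<in> rcosets ?H"
      and tp: "tp L C (inv (rep Q)) M = tp L C (inv (rep Q')) M"
    let ?x = "rep Q" and ?y = "rep Q'"
    note G = rep(1)[OF Q(1)] rep(1)[OF Q(2)]
    have "inv (inv ?x) \<otimes> inv ?y \<in> X M"
      using G tp length_carrier by (intro X_setI) (auto simp: eqtype_def)
    then have "?x \<otimes> inv ?y \<in> ?H" using G by (simp add: generate.incl)
    then have "?x \<in> ?H #> ?y" using G unfolding r_coset_def
      by (auto intro!: bexI[of _ "?x \<otimes> inv ?y"] simp: m_assoc)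
    then have "?H #> ?y = ?H #> ?x" using repr_independence[OF _ G(2) X_set_subgroup] by blast
    then show "Q = Q'" using rep(2)[OF Q(1)] rep(2)[OF Q(2)] by simp
  qed
  moreover have "(\<lambda>Q. tp L C (inv (rep Q)) M) ` (rcosets ?H) \<subseteq> Pow ({\<phi>. wf_fm L \<phi>} \<times> {c. set c \<subseteq> M})"
    by (auto simp: tp_def formulas_def)
  moreover have "small \<kappa> (Pow ({\<phi>. wf_fm L \<phi>} \<times> {c. set c \<subseteq> M}))"
    by (intro small_Pow[OF strong_limit] small_Times[OF strong_limit small_UNIV_nat] small_formulas
      small_lists[OF strong_limit small_UNIV_nat M])
  ultimately show ?thesis unfolding bounded_index_def by (rule small_inj)
qed

text \<open>Let \<open>c\<close> realise a coheir of the type of \<open>a\<close> over \<open>M\<close> and a small set \<open>R\<close> of representatives of the cosets,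
  and let \<open>c'\<close> realise the same coheir over \<open>a\<close>, \<open>b\<close> and \<open>c\<close> as well. As \<open>c\<close> and \<open>c'\<close> have the same
  type over \<open>M\<close> and \<open>R\<close>, they lie in the coset of the same representative. Since \<open>a\<close>, \<open>b\<close> and \<open>c\<close> have the
  same type over \<open>M\<close>, they have it over \<open>c'\<close> too, so \<open>a\<close> and \<open>b\<close> also lie in the coset of \<open>c'\<close>.\<close>

lemma X_set_subset_bounded:
  assumes M: "elementary_submodel L C M" "small \<kappa> M"
    and H: "subgroup H G" "invariant_over L C M H" "bounded_index \<kappa> G H"
  shows "X M \<subseteq> H"
proof
  fix x assume "x \<in> X M"
  then obtain a b where ab: "a \<in> carrier G" "b \<in> carrier G" "eqtype M a b" and x: "x = inv a \<otimes> b"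
    by (rule X_setE)
  have H_carrier: "H \<subseteq> carrier G" by (rule subgroup.subset[OF H(1)])
  \<comment> \<open>\<open>E\<close> is equality of left cosets, an \<open>M\<close>-invariant equivalence relation with few classes.\<close>
  define E where "E y z \<longleftrightarrow> inv y \<otimes> z \<in> H" for y z
  have E_sym: "E z y" if "E y z" "y \<in> carrier G" "z \<in> carrier G" for y z
  proof -
    have "inv (inv y \<otimes> z) \<in> H" using that subgroup.m_inv_closed[OF H(1)] by (simp add: E_def)
    then show ?thesis using that by (simp add: E_def inv_mult_group)
  qed
  have E_trans: "E w z" if "E w y" "E y z" "w \<in> carrier G" "y \<in> carrier G" "z \<in> carrier G" for w y z
  proof -
    have "(inv w \<otimes> y) \<otimes> (inv y \<otimes> z) \<in> H" using that subgroup.m_closed[OF H(1)] by (simp add: E_def)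
    moreover have "(inv w \<otimes> y) \<otimes> (inv y \<otimes> z) = inv w \<otimes> z"
      using that by (simp add: m_assoc) (simp flip: m_assoc)
    ultimately show ?thesis by (simp add: E_def)
  qed
  have E_aut: "E (map \<sigma> y) (map \<sigma> z)" if "fixing_aut M \<sigma>" "E y z" "y \<in> carrier G" "z \<in> carrier G" for \<sigma> y z
  proof -
    have "map \<sigma> ` H = H" using H(2) that(1) unfolding invariant_over_def fixing_aut_def by blast
    then have "map \<sigma> (inv y \<otimes> z) \<in> H" using that(2) unfolding E_def by blast
    then show ?thesis using aut_mult[OF that(1)] aut_inv[OF that(1)] that by (simp add: E_def)
  qed
  define R where "R = (\<lambda>Q. inv (SOME g. g \<in> Q)) ` (rcosets H)"
  have R: "\<exists>r\<in>R. r \<in> carrier G \<and> E c r" if c: "c \<in> carrier G" for c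
  proof -
    have Q: "H #> inv c \<in> rcosets H" using c unfolding RCOSETS_def by blast
    define g where "g = (SOME g. g \<in> H #> inv c)"
    have "inv c \<in> H #> inv c" using c H(1) by (intro rcos_self) auto
    then have "g \<in> H #> inv c" unfolding g_def by (rule someI)
    then obtain h where h: "h \<in> H" "g = h \<otimes> inv c" unfolding r_coset_def by blast
    have hG: "h \<in> carrier G" using h(1) H_carrier by blast
    have "inv g = c \<otimes> inv h" using h(2) hG c by (simp add: inv_mult_group)
    then have "inv c \<otimes> inv g = inv h" using hG c by (simp add: m_assoc[symmetric])
    then have "E c (inv g)" unfolding E_def using h(1) subgroup.m_inv_closed[OF H(1)] by simp
    moreover have "inv g \<in> R" using Q unfolding R_def g_def by blast
    moreover have "inv g \<in> carrier G" using h(2) hG c by simp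
    ultimately show ?thesis by blast
  qed
  have smallR: "small \<kappa> (M \<union> \<Union> (set ` R))"
    unfolding R_def using H(3) unfolding bounded_index_def
    by (intro small_intros(1)[OF M(2)] small_Union_sets[OF strong_limit small_UNIV_nat] small_image)
  let ?B = "M \<union> \<Union> (set ` R)"
  obtain U where U: "ultrafilter U" "tuples M (length a) \<in> U"
    "\<forall>Q. defrel M [length a] Q \<and> Q [a] \<longrightarrow> {x. Q [x]} \<in> U"
    by (rule coheir_exists[OF M(1)])
  have la: "length a = n" "length b = n" using ab length_carrier by auto
  have U': "{x. length x = n} \<in> U"
    by (rule ultrafilterD(3)[OF U(1,2)]) (auto simp: tuples_def la)
  obtain c where c: "length c = n" "realises U ?B c" by (rule realisation_exists[OF U(1) U' smallR])
  have "small \<kappa> (?B \<union> (set a \<union> set b \<union> set c))"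
    by (rule small_intros(1)[OF smallR small_intros(2)]) simp
  then obtain c' where c': "length c' = n" "realises U (?B \<union> (set a \<union> set b \<union> set c)) c'"
    by (rule realisation_exists[OF U(1) U'])
  have cc': "eqtype ?B c c'"
    by (rule realises_eqtype[OF c(2) realises_mono[OF c'(2)]]) (auto simp: c c')
  have ac: "eqtype M a c"
  proof (rule eqtypeI)
    fix Q assume Q: "defrel M [length a] Q"
    have "Q [c] \<longleftrightarrow> {x. Q [x]} \<in> U"
      using c defrel_mono[OF Q, of ?B] la unfolding realises_def by auto
    moreover have "Q [a] \<longleftrightarrow> {x. Q [x]} \<in> U"
      using U(3)[rule_format, of Q] U(3)[rule_format, of "\<lambda>Es. \<not> Q Es"] defrel_not[OF Q] Q
        ultrafilterD(4)[OF U(1), of "{x. Q [x]}"] by (auto simp: Compl_eq)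
    ultimately show "Q [a] = Q [c]" by simp
  qed (simp add: la c)
  have cG: "c \<in> carrier G"
    using eqtype_defrel[of M "[a]" "[c]", OF _ defrel_carrier] ac ab(1) la c by simp
  have c'G: "c' \<in> carrier G"
    using eqtype_defrel[of ?B "[c]" "[c']", OF _ defrel_carrier] cc' cG c c' by simp
  obtain r where r: "r \<in> R" "r \<in> carrier G" "E c r" using R[OF cG] by blast
  from eqtype_imp_aut[OF cc' smallR] obtain \<sigma> where \<sigma>: "fixing_aut ?B \<sigma>" "map \<sigma> c = c'" by blast
  have "map \<sigma> r = r" using r(1) by (intro fixing_aut_map[OF \<sigma>(1)]) auto
  then have "E c' r" using E_aut[OF fixing_aut_mono[OF \<sigma>(1)] r(3) cG r(2)] \<sigma>(2) by simp
  then have Ecc': "E c c'" using E_trans[OF r(3) E_sym] r(2) cG c'G by blast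
  have to_c': "E y c'" if y: "y \<in> {a, b}" "eqtype M y c" for y
  proof -
    have "eqtype M (c @ c') (y @ c')"
    proof (rule coheir_invariant[OF U(1,2)])
      show "eqtype M c y" using y(2) by (rule eqtype_sym)
      show "realises U (M \<union> set c) c'" "realises U (M \<union> set y) c'"
        using y(1) by (auto intro!: realises_mono[OF c'(2)])
    qed (simp_all add: c' la)
    then have "eqtype M (concat [c, c']) (concat [y, c'])" by simp
    then obtain \<tau> where \<tau>: "fixing_aut M \<tau>" "map (map \<tau>) [c, c'] = [y, c']"
      by (rule eqtype_blocks_aut) (use c y la in \<open>auto simp: M(2)\<close>)
    then show ?thesis using E_aut[OF \<tau>(1) Ecc' cG c'G] by simp
  qed
  have "E a c'" "E b c'" using to_c' ac eqtype_trans[OF eqtype_sym[OF ab(3)] ac] by auto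
  then have "E a b" using E_trans E_sym ab(1,2) c'G by blast
  then show "x \<in> H" by (simp add: x E_def)
qed

end

lemma dcl_subset_model:
  assumes "elementary_submodel L C M"
  shows "dcl L C {} \<subseteq> M"
proof
  interpret model L C .
  fix b assume "b \<in> dcl L C {}"
  then have "defrel {} [1] (\<lambda>Es. Es ! 0 \<in> {[b]})" unfolding dcl_def by (auto dest: definable_over_defrel)
  then have "defrel M [1] (\<lambda>Es. Es ! 0 \<in> {[b]})" by (rule defrel_mono) simp
  from tarski_vaught[OF assms this, of "[[b]]"] show "b \<in> M" by (auto simp: map_eq_Cons_conv)
qed

theorem corollary4p3:
  fixes L :: "('f, 'r) language"
    and T :: "('f, 'r) fm set"
    and C :: "('f, 'r, 'a) interp"
    and \<kappa> :: "'k rel"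
    and G :: "'a list monoid"
    and n :: nat
    and M\<^sub>0 M :: "'a set"
  assumes "complete_theory L T"
    and "monster_model L T C \<kappa>"
    and "NIP L C"
    and "dcl L C {} = M\<^sub>0"
    and "elementary_submodel L C M\<^sub>0"
    and "definable_group L C {} n G"
    and "elementary_submodel L C M"
    and "small \<kappa> M"
  shows "X_set L C G M\<^sub>0 \<subseteq> X_set L C G M <#>\<^bsub>G\<^esub> X_set L C G M
    \<and> G_infinity L C \<kappa> G M\<^sub>0 = G_infinity L C \<kappa> G M"
proof -
  interpret group G using assms(6) by (simp add: definable_group_def)
  interpret group_in_monster L C \<kappa> G n
    by unfold_locales (use assms(2,6) in \<open>auto simp: monster_model_def\<close>)
  have sub: "M\<^sub>0 \<subseteq> M" using dcl_subset_model[OF assms(7)] assms(4) by simp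
  have small: "small \<kappa> M\<^sub>0" by (rule small_mono[OF sub assms(8)])
  have incl: "X M\<^sub>0 \<subseteq> X M <#>\<^bsub>G\<^esub> X M"
    by (rule X_set_subset_product[OF assms(3,5) small assms(8)])
  let ?P = "\<lambda>N H. subgroup H G \<and> invariant_over L C N H \<and> bounded_index \<kappa> G H"
  let ?H = "generate G (X M\<^sub>0)"
  have "X M \<subseteq> X M\<^sub>0"
    using sub by (auto elim!: X_setE intro!: X_setI eqtype_mono[OF _ sub])
  then have "generate G (X M) \<subseteq> ?H" by (rule mono_generate)
  moreover have "?H \<subseteq> generate G (X M)"
  proof (rule generate_subgroup_incl[OF _ X_set_subgroup])
    show "X M\<^sub>0 \<subseteq> generate G (X M)"
      using incl unfolding set_mult_def by (auto intro: generate.eng generate.incl)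
  qed
  ultimately have gen: "generate G (X M) = ?H" by blast
  have least: "?H \<subseteq> H" if "?P M H" for H
    unfolding gen[symmetric]
    by (rule generate_subgroup_incl[OF X_set_subset_bounded[OF assms(7,8)]]) (use that in auto)
  have inv: "invariant_over L C M H" if "invariant_over L C M\<^sub>0 H" for H
    using that sub unfolding invariant_over_def by blast
  have P0: "?P M\<^sub>0 ?H"
    using X_set_subgroup X_set_generate_invariant X_set_generate_bounded[OF small] by blast
  have "G_infinity L C \<kappa> G M\<^sub>0 = ?H"
    unfolding G_infinity_def by (rule Least_equality) (use P0 inv least in blast)+
  moreover have "G_infinity L C \<kappa> G M = ?H"
    unfolding G_infinity_def by (rule Least_equality) (use P0 inv least in blast)+
  ultimately show ?thesis using incl by simp
qed

end
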